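(* Let $n\ge2$, $h=h_\mathbb{K}$, and let $u_1,\dots,u_h\in\mathbb{K}$ be such that the fractional ideals $\mathcal{I}_j=\mathcal{O}_\mathbb{K}u_j+\mathcal{O}_\mathbb{K}$, $j=1,\dots,h$, form a set of representatives of the ideal classes of $\mathbb{K}$. For each $j$ let $U_j\in GL_n(\mathbb{K})$ be the $n\times n$ identity matrix except that its entry in row $n$, column $n-1$ equals $\overline{u}_j$. Then $f\in\mathcal{M}(\Gamma_n,k)$ is a cusp form if and only if $(f\mid_kR_{U_j})\mid\phi\equiv0$ for all $j=1,\dots,h$.
   Context: $\mathbb{K}=\mathbb{Q}(\sqrt{-m})$, $m\in\mathbb{N}$ squarefree, discriminant $d_\mathbb{K}$, ring of integers $\mathcal{O}_\mathbb{K}$, class number $h_\mathbb{K}$. With $I$ the identity and $J=\begin{pmatrix}0&-I\\ I&0\end{pmatrix}$, $\Gamma_n=\{M\in\mathcal{O}_\mathbb{K}^{2n\times2n}:\overline{M}^{tr}JM=J\}$. $\mathbb{H}_n=\{Z\in\mathbb{C}^{n\times n}:\frac1{2i}(Z-\overline Z^{tr})>0\}$. For $M=\begin{pmatrix}A&B\\C&D\end{pmatrix}$ with $\overline M^{tr}JM=qJ$, $q>0$, and $k\in\mathbb{Z}$: $(f\mid_kM)(Z)=\det(CZ+D)^{-k}f((AZ+B)(CZ+D)^{-1})$. For $U\in GL_n(\mathbb{K})$, $R_U=\begin{pmatrix}\overline U^{tr}&0\\0&U^{-1}\end{pmatrix}$. $\mathcal{M}(\Gamma_n,k)$ is the space of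 holomorphic $f$ on $\mathbb{H}_n$ with $f\mid_kM=f$ for all $M\in\Gamma_n$; such $f$ has Fourier expansion $f(Z)=\sum_T\alpha_f(T)e^{2\pi i\,\mathrm{trace}(TZ)}$ over Hermitian $T\ge0$ with integral diagonal and off-diagonal entries in $\frac1{\sqrt{d_\mathbb{K}}}\mathcal{O}_\mathbb{K}$; $f$ is a cusp form if $\alpha_f(T)\ne0$ implies $T>0$. The Siegel $\phi$-operator is $(g\mid\phi)(Z_1)=\lim_{y\to\infty}g\begin{pmatrix}Z_1&0\\0&iy\end{pmatrix}$ for $Z_1\in\mathbb{H}_{n-1}$. *)

theory Defs
  imports
    "Jordan_Normal_Form.Gauss_Jordan_Elimination"
    "Jordan_Normal_Form.Schur_Decomposition"
    "HOL-Computational_Algebra.Computational_Algebra"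
    "HOL-Analysis.Infinite_Sum"
begin

section \<open>The imaginary quadratic field \<open>K = \<rat>(sqrt (- m))\<close>\<close>

definition quad_field :: "nat \<Rightarrow> complex set" where
  "quad_field m = {of_rat a + of_rat b * csqrt (- of_nat m) | a b. True}"

definition ring_ints :: "nat \<Rightarrow> complex set" where
  "ring_ints m = {x \<in> quad_field m. algebraic_int x}"

text \<open>The discriminant of \<open>K\<close>; here \<open>- m\<close> is congruent to 1 modulo 4 iff \<open>m mod 4 = 3\<close>.\<close>

definition quad_disc :: "nat \<Rightarrow> int" where
  "quad_disc m = (if m mod 4 = 3 then - int m else - 4 * int m)"

definition fractional_ideals :: "nat \<Rightarrow> complex set set" where
  "fractional_ideals m = {I. I \<subseteq> quad_field m \<and> 0 \<in> I \<and> I \<noteq> {0}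
     \<and> (\<forall>x\<in>I. \<forall>y\<in>I. x + y \<in> I)
     \<and> (\<forall>r\<in>ring_ints m. \<forall>x\<in>I. r * x \<in> I)
     \<and> (\<exists>c\<in>ring_ints m. c \<noteq> 0 \<and> (\<forall>x\<in>I. c * x \<in> ring_ints m))}"

definition ideal_equiv :: "nat \<Rightarrow> (complex set \<times> complex set) set" where
  "ideal_equiv m = {(I, I'). I \<in> fractional_ideals m \<and> I' \<in> fractional_ideals m
     \<and> (\<exists>c\<in>quad_field m. c \<noteq> 0 \<and> I' = (\<lambda>x. c * x) ` I)}"

definition ideal_classes :: "nat \<Rightarrow> complex set set set" where
  "ideal_classes m = fractional_ideals m // ideal_equiv m"

definition class_number :: "nat \<Rightarrow> nat" where
  "class_number m = card (ideal_classes m)"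

definition ideal_class :: "nat \<Rightarrow> complex set \<Rightarrow> complex set set" where
  "ideal_class m I = ideal_equiv m `` {I}"

definition ideal_gen1 :: "nat \<Rightarrow> complex \<Rightarrow> complex set" where
  "ideal_gen1 m u = {a * u + b | a b. a \<in> ring_ints m \<and> b \<in> ring_ints m}"

section \<open>Matrices\<close>

text \<open>Rows and columns are indexed from 0, so the last index of an \<open>n \<times> n\<close> matrix is \<open>n - 1\<close>.\<close>

definition mat_trace :: "complex mat \<Rightarrow> complex" where
  "mat_trace A = (\<Sum>i<dim_row A. A $$ (i, i))"

definition mat_norm1 :: "complex mat \<Rightarrow> real" where
  "mat_norm1 A = (\<Sum>i<dim_row A. \<Sum>j<dim_col A. cmod (A $$ (i, j)))"

text \<open>Only meaningful for invertible arguments.\<close>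

definition mat_inv :: "complex mat \<Rightarrow> complex mat" where
  "mat_inv A = the (mat_inverse A)"

definition hermitian_mat :: "nat \<Rightarrow> complex mat \<Rightarrow> bool" where
  "hermitian_mat n A \<longleftrightarrow> A \<in> carrier_mat n n \<and> mat_adjoint A = A"

definition pos_def :: "nat \<Rightarrow> complex mat \<Rightarrow> bool" where
  "pos_def n A \<longleftrightarrow> hermitian_mat n A
     \<and> (\<forall>v\<in>carrier_vec n. v \<noteq> 0\<^sub>v n \<longrightarrow> Re ((A *\<^sub>v v) \<bullet>c v) > 0)"

definition pos_semidef :: "nat \<Rightarrow> complex mat \<Rightarrow> bool" where
  "pos_semidef n A \<longleftrightarrow> hermitian_mat n A
     \<and> (\<forall>v\<in>carrier_vec n. Re ((A *\<^sub>v v) \<bullet>c v) \<ge> 0)"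

section \<open>The Hermitian modular group and half-space\<close>

definition J_mat :: "nat \<Rightarrow> complex mat" where
  "J_mat n = four_block_mat (0\<^sub>m n n) (- 1\<^sub>m n) (1\<^sub>m n) (0\<^sub>m n n)"

definition hermitian_modular_group :: "nat \<Rightarrow> nat \<Rightarrow> complex mat set" where
  "hermitian_modular_group m n = {M \<in> carrier_mat (2 * n) (2 * n).
     elements_mat M \<subseteq> ring_ints m \<and> mat_adjoint M * J_mat n * M = J_mat n}"

definition half_space :: "nat \<Rightarrow> complex mat set" where
  "half_space n = {Z \<in> carrier_mat n n. pos_def n ((1 / (2 * \<i>)) \<cdot>\<^sub>m (Z - mat_adjoint Z))}"

definition slash :: "nat \<Rightarrow> int \<Rightarrow> complex mat \<Rightarrow> (complex mat \<Rightarrow> complex) \<Rightarrow> complex mat \<Rightarrow> complex" where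
  "slash n k M f Z = (let (A, B, C, D) = split_block M n n
     in det (C * Z + D) powi (- k) * f ((A * Z + B) * mat_inv (C * Z + D)))"

definition R_mat :: "nat \<Rightarrow> complex mat \<Rightarrow> complex mat" where
  "R_mat n U = four_block_mat (mat_adjoint U) (0\<^sub>m n n) (0\<^sub>m n n) (mat_inv U)"

text \<open>The identity matrix, except that the entry in the last row and last but one column is \<open>x\<close>.\<close>

definition U_mat :: "nat \<Rightarrow> complex \<Rightarrow> complex mat" where
  "U_mat n x = mat n n (\<lambda>(i, j). if i = n - 1 \<and> j = n - 2 then x else if i = j then 1 else 0)"

section \<open>Hermitian modular forms\<close>

text \<open>Complex Frechet differentiability at every point of the half-space, which is open in
  the space of \<open>n \<times> n\<close> matrices. Every complex linear functional on this space has the form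
  \<open>H \<mapsto> trace (D H)\<close>.\<close>

definition holomorphic_on_half_space :: "nat \<Rightarrow> (complex mat \<Rightarrow> complex) \<Rightarrow> bool" where
  "holomorphic_on_half_space n f \<longleftrightarrow>
     (\<forall>Z\<in>half_space n. \<exists>D\<in>carrier_mat n n. \<forall>\<epsilon>>0. \<exists>\<delta>>0. \<forall>W\<in>half_space n.
        mat_norm1 (W - Z) < \<delta> \<longrightarrow>
        cmod (f W - f Z - mat_trace (D * (W - Z))) \<le> \<epsilon> * mat_norm1 (W - Z))"

text \<open>Functions on the half-space are represented by total functions whose values elsewhere
  are irrelevant. For \<open>n = 1\<close> one would have to add regularity at the cusps; for \<open>n \<ge> 2\<close> it is
  automatic.\<close>

definition modular_forms :: "nat \<Rightarrow> nat \<Rightarrow> int \<Rightarrow> (complex mat \<Rightarrow> complex) set" where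
  "modular_forms m n k = {f. holomorphic_on_half_space n f
     \<and> (\<forall>M\<in>hermitian_modular_group m n. \<forall>Z\<in>half_space n. slash n k M f Z = f Z)}"

definition fourier_index :: "nat \<Rightarrow> nat \<Rightarrow> complex mat set" where
  "fourier_index m n = {T. pos_semidef n T
     \<and> (\<forall>i<n. T $$ (i, i) \<in> \<int>)
     \<and> (\<forall>i<n. \<forall>j<n. i \<noteq> j \<longrightarrow>
          (\<exists>a\<in>ring_ints m. T $$ (i, j) = a / csqrt (of_int (quad_disc m))))}"

definition has_fourier_expansion ::
  "nat \<Rightarrow> nat \<Rightarrow> (complex mat \<Rightarrow> complex) \<Rightarrow> (complex mat \<Rightarrow> complex) \<Rightarrow> bool" where
  "has_fourier_expansion m n f \<alpha> \<longleftrightarrow> (\<forall>Z\<in>half_space n.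
     ((\<lambda>T. \<alpha> T * exp (2 * of_real pi * \<i> * mat_trace (T * Z))) has_sum f Z) (fourier_index m n))"

text \<open>The Fourier coefficients on \<^term>\<open>fourier_index m n\<close> are uniquely determined by the function,
  so the witness \<open>\<alpha>\<close> is the family of Fourier coefficients of \<open>f\<close>.\<close>

definition cusp_form :: "nat \<Rightarrow> nat \<Rightarrow> int \<Rightarrow> (complex mat \<Rightarrow> complex) \<Rightarrow> bool" where
  "cusp_form m n k f \<longleftrightarrow> f \<in> modular_forms m n k
     \<and> (\<exists>\<alpha>. has_fourier_expansion m n f \<alpha>
          \<and> (\<forall>T\<in>fourier_index m n. \<alpha> T \<noteq> 0 \<longrightarrow> pos_def n T))"

text \<open>\<open>has_siegel_phi n g Z1 L\<close>: the limit defining the value at \<open>Z1\<close> of the Siegel operator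
  applied to \<open>g\<close> (in degree \<open>n\<close>) exists and equals \<open>L\<close>.\<close>

definition has_siegel_phi :: "nat \<Rightarrow> (complex mat \<Rightarrow> complex) \<Rightarrow> complex mat \<Rightarrow> complex \<Rightarrow> bool" where
  "has_siegel_phi n g Z1 L \<longleftrightarrow>
     ((\<lambda>y::real. g (four_block_mat Z1 (0\<^sub>m (n - 1) 1) (0\<^sub>m 1 (n - 1)) (mat 1 1 (\<lambda>_. \<i> * of_real y))))
        \<longlongrightarrow> L) at_top"

end

theory Submission
  imports "HOL-Complex_Analysis.Cauchy_Integral_Formula" Defs
begin

text \<open>A modular form is a series of exponentials over the Hermitian matrices \<open>T\<close> in the dual lattice, and
  the coefficients at \<open>T\<close> and \<open>U T U*\<close> differ by a root of unity for \<open>U\<close> in \<open>GL\<^sub>n\<close> over the ring of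
  integers; by the Koecher principle only \<open>T \<ge> 0\<close> occur. Applying the Siegel operator to the form
  transformed by \<open>U\<^sub>j\<close> extracts the coefficients at those \<open>T\<close> that annihilate
  \<open>w = (0, \<dots>, 0, u\<^sub>j, 1)\<close>. A singular \<open>T \<ge> 0\<close> annihilates a nonzero vector over \<open>K\<close>. Since the
  fractional ideals \<open>(u\<^sub>j, 1)\<close> represent all ideal classes, \<open>GL\<^sub>n\<close> over the ring of integers carries that
  vector to a multiple of one of the \<open>w\<close>, so the coefficient at \<open>T\<close> vanishes.\<close>

unbundle no vec_syntax

section \<open>Fourier expansion on a strip\<close>

text \<open>Integral translations and unimodular substitutions, both block triangular, carry the
  argument. In coordinates along a \<int>-basis of the integral Hermitian matrices the translations
  become unit shifts and the half-space a tube over an open convex cone, locally a product of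
  strips. One-variable Fourier series, iterated over the coordinates, give a series near each
  imaginary part, and uniqueness of the coefficients glues these series along segments of the cone.
  The same uniqueness returns twice: it turns the action of a unimodular matrix into a relation
  between coefficients, and it extracts single coefficients from the Siegel limit. Null vectors have
  to be brought to the form \<open>(0, ..., 0, u, 1)\<close> although two integers of the field need
  not have a greatest common divisor. Annihilation does not see scalar factors, so the ideal class
  of the last two entries is the only obstruction, and one \<open>u\<close> per class suffices.
  Indices that are not semidefinite must be excluded before the Siegel limit is taken, since their
  terms could grow with \<open>y\<close>.\<close>

definition ee :: "complex \<Rightarrow> complex" where
  "ee w = exp (2 * of_real pi * \<i> * w)"

lemma ee_0 [simp]: "ee 0 = 1"
  by (simp add: ee_def)

lemma ee_add: "ee (a + b) = ee a * ee b"
  by (simp add: ee_def exp_add ring_distribs)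

lemma ee_nonzero [simp]: "ee a \<noteq> 0"
  by (simp add: ee_def)

lemma norm_ee: "norm (ee w) = exp (- 2 * pi * Im w)"
  by (simp add: ee_def norm_exp_eq_Re)

lemma ee_eq_1_iff: "ee w = 1 \<longleftrightarrow> (\<exists>n::int. w = of_int n)"
proof -
  have "ee w = 1 \<longleftrightarrow> Im w = 0 \<and> (\<exists>n::int. Re w = of_int n)"
    by (auto simp: ee_def exp_eq_1)
  also have "\<dots> \<longleftrightarrow> (\<exists>n::int. w = of_int n)"
    by (auto simp: complex_eq_iff)
  finally show ?thesis .
qed

lemma ee_of_int [simp]: "ee (of_int n) = 1"
  using ee_eq_1_iff by blast

lemma ee_add_of_int [simp]: "ee (w + of_int n) = ee w" "ee (of_int n + w) = ee w"
  by (simp_all add: ee_add)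

lemma ee_add_1 [simp]: "ee (w + 1) = ee w"
  using ee_add_of_int(1)[of w 1] by simp

lemma ee_has_field_derivative [derivative_intros]:
  "(g has_field_derivative g') (at x within S) \<Longrightarrow>
    ((\<lambda>w. ee (g w)) has_field_derivative (2 * of_real pi * \<i> * ee (g x) * g')) (at x within S)"
  unfolding ee_def by (auto intro!: derivative_eq_intros)

lemma holomorphic_on_ee [holomorphic_intros]:
  "g holomorphic_on S \<Longrightarrow> (\<lambda>w. ee (g w)) holomorphic_on S"
  unfolding ee_def by (intro holomorphic_intros)

definition strip :: "real \<Rightarrow> real \<Rightarrow> complex set" where
  "strip y r = {w. \<bar>Im w - y\<bar> < r}"

lemma strip_eq: "strip y r = {w. Im w < y + r} \<inter> {w. Im w > y - r}"
  by (auto simp: strip_def)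

lemma open_strip: "open (strip y r)"
  unfolding strip_eq by (intro open_Int open_halfspace_Im_lt open_halfspace_Im_gt)

lemma convex_strip: "convex (strip y r)"
  unfolding strip_eq by (intro convex_Int convex_halfspace_Im_lt convex_halfspace_Im_gt)

lemma strip_add_real: "w \<in> strip y r \<Longrightarrow> Im t = 0 \<Longrightarrow> w + t \<in> strip y r"
  by (auto simp: strip_def)

lemma periodic_strip_int:
  assumes per: "\<And>w. w \<in> strip y0 r \<Longrightarrow> F (w + 1) = F w" and w: "w \<in> strip y0 r"
  shows "F (w + of_int k) = F w"
proof -
  have nat: "F (w + of_nat n) = F w" if "w \<in> strip y0 r" for w n
  proof (induction n)
    case (Suc n)
    have "F (w + of_nat (Suc n)) = F ((w + of_nat n) + 1)"
      by (simp add: algebra_simps)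
    also have "\<dots> = F (w + of_nat n)"
      by (intro per strip_add_real that) simp
    finally show ?case using Suc by simp
  qed simp
  show ?thesis
  proof (cases "k \<ge> 0")
    case True
    then show ?thesis using nat[OF w, of "nat k"] by simp
  next
    case False
    then show ?thesis
      using nat[OF strip_add_real[OF w], of "of_int k" "nat (-k)"] by simp
  qed
qed

text \<open>For a primitive \<open>P\<close> of \<open>G\<close> the difference
  \<open>P (w + 1) - P w\<close> has derivative zero by periodicity, so it is constant on the strip;
  this constant is the integral over a period at every height.\<close>

lemma integral_period_strip:
  assumes hol: "G holomorphic_on strip y0 r" and per: "\<And>w. w \<in> strip y0 r \<Longrightarrow> G (w + 1) = G w"
  obtains c where "\<And>y. \<bar>y - y0\<bar> < r \<Longrightarrow> ((\<lambda>x. G (of_real x + \<i> * of_real y)) has_integral c) {0..1}"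
proof -
  let ?S = "strip y0 r"
  obtain P where P: "\<And>w. w \<in> ?S \<Longrightarrow> (P has_field_derivative G w) (at w within ?S)"
    by (rule holomorphic_convex_primitive'[OF convex_strip open_strip hol]) (rule that)
  have P': "(P has_field_derivative G w) (at w)" if "w \<in> ?S" for w
    using P[OF that] at_within_open[OF that open_strip] by simp
  have "((\<lambda>w. P (w + 1) - P w) has_field_derivative 0) (at w within ?S)" if w: "w \<in> ?S" for w
  proof -
    have "(P has_field_derivative G (w + 1)) (at (w + 1))"
      using P' w strip_add_real by simp
    then have "((\<lambda>w. P (w + 1) - P w) has_field_derivative (G (w + 1) - G w)) (at w)"
      by (intro derivative_intros P'[OF w]) (simp add: DERIV_shift)
    then show ?thesis
      using per[OF w] by (simp add: has_field_derivative_at_within)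
  qed
  from has_field_derivative_zero_constant[OF convex_strip this]
  obtain c where c: "\<And>w. w \<in> ?S \<Longrightarrow> P (w + 1) - P w = c"
    by blast
  have "((\<lambda>x. G (of_real x + \<i> * of_real y)) has_integral c) {0..1}" if y: "\<bar>y - y0\<bar> < r" for y
  proof -
    have S: "of_real x + \<i> * of_real y \<in> ?S" for x
      using y by (simp add: strip_def)
    have "((\<lambda>x. G (of_real x + \<i> * of_real y)) has_integral
        (P (of_real 1 + \<i> * of_real y) - P (of_real 0 + \<i> * of_real y))) {0..1}"
    proof (rule fundamental_theorem_of_calculus)
      fix x :: real
      have "((\<lambda>w. P (w + \<i> * of_real y)) has_field_derivative G (of_real x + \<i> * of_real y)) (at (of_real x))"
        using P'[OF S] by (simp only: DERIV_shift)
      then show "((\<lambda>x. P (of_real x + \<i> * of_real y)) has_vector_derivative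
          G (of_real x + \<i> * of_real y)) (at x within {0..1})"
        by (rule has_vector_derivative_real_field)
    qed simp
    then show ?thesis
      using c[OF S[of 0]] by (simp add: add.commute)
  qed
  then show ?thesis
    using that by blast
qed

definition fcoef :: "real \<Rightarrow> (complex \<Rightarrow> complex) \<Rightarrow> int \<Rightarrow> complex" where
  "fcoef y F s = integral {0..1} (\<lambda>x. F (of_real x + \<i> * of_real y) * ee (- of_int s * (of_real x + \<i> * of_real y)))"

context
  fixes F :: "complex \<Rightarrow> complex" and y0 r :: real
  assumes hol: "F holomorphic_on strip y0 r"
    and per: "\<And>w. w \<in> strip y0 r \<Longrightarrow> F (w + 1) = F w"
begin

text \<open>The twisted integrand is again periodic because \<open>s\<close> is an integer, so the
  line of integration may be moved within the strip. All later estimates exploit this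
  freedom.\<close>

lemma has_integral_fcoef:
  assumes "\<bar>y - y0\<bar> < r"
  shows "((\<lambda>x. F (of_real x + \<i> * of_real y) * ee (- of_int s * (of_real x + \<i> * of_real y)))
    has_integral fcoef y0 F s) {0..1}"
proof -
  have r: "r > 0" using assms by linarith
  have "ee (- (of_int s * (w + 1))) = ee (- of_int s * w)" for w
    using ee_add_of_int(1)[of "- of_int s * w" "-s"] by (simp add: ring_distribs add.commute)
  then obtain c where c: "\<And>y. \<bar>y - y0\<bar> < r \<Longrightarrow>
      ((\<lambda>x. F (of_real x + \<i> * of_real y) * ee (- of_int s * (of_real x + \<i> * of_real y))) has_integral c) {0..1}"
    using integral_period_strip[of "\<lambda>w. F w * ee (- of_int s * w)" y0 r] hol per
    by (force intro!: holomorphic_intros)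
  have "c = fcoef y0 F s"
    using c[of y0] r by (simp add: fcoef_def integral_unique)
  then show ?thesis
    using c[OF assms] by simp
qed

lemma norm_fcoef_le:
  assumes "\<bar>y - y0\<bar> < r" and M: "\<And>w. Im w = y \<Longrightarrow> norm (F w) \<le> M"
  shows "norm (fcoef y0 F s) \<le> M * exp (2 * pi * of_int s * y)"
proof -
  have "0 \<le> M" by (rule order_trans[OF norm_ge_zero M[of "\<i> * of_real y"]]) simp
  have "norm (fcoef y0 F s) \<le> (M * exp (2 * pi * of_int s * y)) * measure lborel {0..1::real}"
  proof (rule has_integral_bound_real[OF _ finite.emptyI has_integral_fcoef[OF assms(1)]])
    show "0 \<le> M * exp (2 * pi * of_int s * y)"
      using \<open>0 \<le> M\<close> by simp
    fix x :: real
    show "norm (F (of_real x + \<i> * of_real y) * ee (- of_int s * (of_real x + \<i> * of_real y))) \<le> M * exp (2 * pi * of_int s * y)"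
      using M by (simp add: norm_mult norm_ee mult_right_mono mult.assoc)
  qed
  then show ?thesis by simp
qed

text \<open>By periodicity a compact segment of length one controls the whole line.\<close>

lemma bounded_line:
  assumes "\<bar>y - y0\<bar> < r"
  obtains M where "\<And>w. Im w = y \<Longrightarrow> norm (F w) \<le> M"
proof -
  have "continuous_on {0..1} (\<lambda>x. F (of_real x + \<i> * of_real y))"
    by (rule continuous_on_compose2[OF holomorphic_on_imp_continuous_on[OF hol]])
       (use assms in \<open>auto intro!: continuous_intros simp: strip_def\<close>)
  then have "bounded ((\<lambda>x. F (of_real x + \<i> * of_real y)) ` {0..1})"
    using compact_continuous_image compact_imp_bounded by blast
  then obtain M where M: "\<And>x. x \<in> {0..1} \<Longrightarrow> norm (F (of_real x + \<i> * of_real y)) \<le> M"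
    unfolding bounded_iff by (metis imageI)
  have "norm (F w) \<le> M" if w: "Im w = y" for w
  proof -
    have "w = (of_real (frac (Re w)) + \<i> * of_real y) + of_int \<lfloor>Re w\<rfloor>"
      using w by (simp add: complex_eq_iff frac_def)
    moreover have "(of_real (frac (Re w)) + \<i> * of_real y) \<in> strip y0 r"
      using assms by (simp add: strip_def)
    ultimately have "F w = F (of_real (frac (Re w)) + \<i> * of_real y)"
      using periodic_strip_int[of y0 r F, OF per] by metis
    then show ?thesis
      using M[of "frac (Re w)"] by (simp add: frac_lt_1 less_imp_le)
  qed
  then show ?thesis using that by blast
qed

text \<open>The line of integration is moved away from the height of \<open>z0\<close>, downwards
  for \<open>s \<ge> 0\<close> and upwards for \<open>s < 0\<close>; either move gains the factor
  \<open>exp (- 2 * pi * d * \<bar>s\<bar>)\<close>.\<close>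

lemma fcoef_decay:
  assumes z0: "z0 \<in> strip y0 r"
  obtains M \<delta> where "\<delta> > 0" "\<And>s. norm (fcoef y0 F s * ee (of_int s * z0)) \<le> M * exp (- \<delta> * \<bar>of_int s\<bar>)"
proof -
  \<comment> \<open>Half the distance from \<open>z0\<close> to the boundary of the strip, so that
    both shifted lines stay inside.\<close>
  define d where "d = (r - \<bar>Im z0 - y0\<bar>) / 2"
  have d: "d > 0" "\<bar>(Im z0 + d) - y0\<bar> < r" "\<bar>(Im z0 - d) - y0\<bar> < r"
    using z0 unfolding d_def strip_def by (auto simp: field_simps abs_if split: if_splits)
  obtain M1 where M1: "\<And>w. Im w = Im z0 + d \<Longrightarrow> norm (F w) \<le> M1"
    using bounded_line[OF d(2)] by blast
  obtain M2 where M2: "\<And>w. Im w = Im z0 - d \<Longrightarrow> norm (F w) \<le> M2"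
    using bounded_line[OF d(3)] by blast
  have "norm (fcoef y0 F s * ee (of_int s * z0)) \<le> max M1 M2 * exp (- (2 * pi * d) * \<bar>of_int s\<bar>)" for s
  proof (cases "s \<ge> 0")
    case True
    have "norm (fcoef y0 F s * ee (of_int s * z0)) \<le> (M2 * exp (2 * pi * of_int s * (Im z0 - d))) * exp (- 2 * pi * Im (of_int s * z0))"
      unfolding norm_mult norm_ee by (intro mult_right_mono norm_fcoef_le[OF d(3) M2]) auto
    also have "\<dots> = M2 * exp (- (2 * pi * d) * \<bar>of_int s\<bar>)"
      using True by (simp add: mult.assoc exp_add[symmetric]) (simp add: algebra_simps)
    also have "\<dots> \<le> max M1 M2 * exp (- (2 * pi * d) * \<bar>of_int s\<bar>)"
      by (intro mult_right_mono) auto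
    finally show ?thesis .
  next
    case False
    have "norm (fcoef y0 F s * ee (of_int s * z0)) \<le> (M1 * exp (2 * pi * of_int s * (Im z0 + d))) * exp (- 2 * pi * Im (of_int s * z0))"
      unfolding norm_mult norm_ee by (intro mult_right_mono norm_fcoef_le[OF d(2) M1]) auto
    also have "\<dots> = M1 * exp (- (2 * pi * d) * \<bar>of_int s\<bar>)"
      using False by (simp add: mult.assoc exp_add[symmetric]) (simp add: algebra_simps)
    also have "\<dots> \<le> max M1 M2 * exp (- (2 * pi * d) * \<bar>of_int s\<bar>)"
      by (intro mult_right_mono) auto
    finally show ?thesis .
  qed
  then show ?thesis
    by (intro that[of "2 * pi * d" "max M1 M2"]) (use d in auto)
qed

end

lemma summable_exp_abs_int:
  assumes "\<delta> > 0"
  shows "(\<lambda>s::int. exp (- \<delta> * \<bar>of_int s\<bar>) :: real) summable_on UNIV"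
proof -
  have "(\<lambda>n::nat. exp (-\<delta>) ^ n) summable_on UNIV"
    using assms by (intro summable_on_UNIV_nonneg_real_iff[THEN iffD2] summable_geometric) auto
  then have *: "(\<lambda>n::nat. exp (- \<delta> * of_nat n)) summable_on UNIV"
    by (simp add: exp_of_nat_mult[symmetric] mult.commute)
  have "(\<lambda>s::int. exp (- \<delta> * \<bar>of_int s\<bar>)) summable_on range int"
    by (subst summable_on_reindex) (use * in \<open>auto simp: o_def\<close>)
  moreover have "(\<lambda>s::int. exp (- \<delta> * \<bar>of_int s\<bar>)) summable_on range (\<lambda>n. - int n)"
    by (subst summable_on_reindex) (use * in \<open>auto simp: o_def inj_on_def\<close>)
  ultimately have "(\<lambda>s::int. exp (- \<delta> * \<bar>of_int s\<bar>)) summable_on (range int \<union> range (\<lambda>n. - int n))"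
    by (rule summable_on_union)
  moreover have "range int \<union> range (\<lambda>n. - int n) = UNIV"
    by (auto intro: int_cases2)
  ultimately show ?thesis by simp
qed

lemma summable_fcoef:
  assumes "F holomorphic_on strip y0 r" "\<And>w. w \<in> strip y0 r \<Longrightarrow> F (w + 1) = F w" "z0 \<in> strip y0 r"
  shows "(\<lambda>s. fcoef y0 F s * ee (of_int s * z0)) summable_on UNIV"
proof -
  obtain M \<delta> where "\<delta> > 0" "\<And>s. norm (fcoef y0 F s * ee (of_int s * z0)) \<le> M * exp (- \<delta> * \<bar>of_int s\<bar>)"
    using fcoef_decay[OF assms] by blast
  then have "(\<lambda>s. norm (fcoef y0 F s * ee (of_int s * z0))) summable_on UNIV"
    by (intro Infinite_Sum.abs_summable_on_comparison_test'[where g = "\<lambda>s. M * exp (- \<delta> * \<bar>of_int s\<bar>)"]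
        summable_on_cmult_right summable_exp_abs_int) auto
  then show ?thesis by (rule abs_summable_summable)
qed

text \<open>The quotient by \<open>ee (w - z0) - 1\<close> turns the partial sums of the Fourier series at \<open>z0\<close>
  into telescoping sums (Chernoff's proof of pointwise convergence).\<close>

lemma periodic_quotient:
  assumes hol: "F holomorphic_on strip y0 r" and per: "\<And>w. w \<in> strip y0 r \<Longrightarrow> F (w + 1) = F w"
    and z0: "z0 \<in> strip y0 r"
  obtains g where "g holomorphic_on strip y0 r" "\<And>w. w \<in> strip y0 r \<Longrightarrow> g (w + 1) = g w"
    "\<And>w. w \<in> strip y0 r \<Longrightarrow> F w - F z0 = (ee (w - z0) - 1) * g w"
proof -
  let ?S = "strip y0 r"
  \<comment> \<open>The denominator vanishes exactly at the points \<open>z0 + n\<close> with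
    \<open>n\<close> an integer. There it has derivative \<open>2 * pi * \<i>\<close>, so the value
    chosen is the limit of the quotient.\<close>
  define g where "g w = (if ee (w - z0) = 1 then deriv F w / (2 * of_real pi * \<i>)
    else (F w - F z0) / (ee (w - z0) - 1))" for w
  have F_zero: "F w = F z0" if w: "w \<in> ?S" and e1: "ee (w - z0) = 1" for w
  proof -
    obtain n :: int where "w - z0 = of_int n" using e1 unfolding ee_eq_1_iff ..
    then have "w = z0 + of_int n" by (simp add: algebra_simps)
    then show ?thesis using periodic_strip_int[of y0 r F, OF per z0] by simp
  qed
  have 1: "g (w + 1) = g w" if w: "w \<in> ?S" for w
  proof -
    have "deriv F (w + 1) = deriv F w"
    proof -
      have "(F has_field_derivative deriv F (w + 1)) (at (w + 1))"
        using holomorphic_derivI[OF hol open_strip, of "w + 1"] strip_add_real[OF w, of 1] by simp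
      then have "((\<lambda>x. F (x + 1)) has_field_derivative deriv F (w + 1)) (at w)"
        by (simp add: DERIV_shift)
      then have "(F has_field_derivative deriv F (w + 1)) (at w)"
        by (rule has_field_derivative_transform_within_open[OF _ open_strip w]) (use per in auto)
      then show ?thesis by (simp add: DERIV_imp_deriv)
    qed
    moreover have "ee (w + 1 - z0) = ee (w - z0)"
      using ee_add_1[of "w - z0"] by (simp add: algebra_simps)
    ultimately show ?thesis
      using per[OF w] by (simp add: g_def)
  qed
  have 2: "F w - F z0 = (ee (w - z0) - 1) * g w" if "w \<in> ?S" for w
    using F_zero[OF that] by (simp add: g_def)
  have 3: "g holomorphic_on ?S"
  proof -
    have "\<exists>e>0. g holomorphic_on ball p e" if p: "p \<in> ?S" for p
    proof -
      obtain e0 where e0: "e0 > 0" "ball p e0 \<subseteq> ?S"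
        using open_contains_ball open_strip p by blast
      show ?thesis
      proof (cases "ee (p - z0) = 1")
        case False
        have "open {w. ee (w - z0) \<noteq> 1}"
          by (intro open_Collect_neq continuous_intros holomorphic_on_imp_continuous_on holomorphic_intros)
        then obtain e1 where e1: "e1 > 0" "ball p e1 \<subseteq> {w. ee (w - z0) \<noteq> 1}"
          using open_contains_ball False by (metis (mono_tags, lifting) mem_Collect_eq)
        have "(\<lambda>w. (F w - F z0) / (ee (w - z0) - 1)) holomorphic_on ball p (min e0 e1)"
          using e0 e1 by (intro holomorphic_intros holomorphic_on_subset[OF hol]) (auto simp: subset_iff)
        then have "g holomorphic_on ball p (min e0 e1)"
          by (rule holomorphic_transform) (use e1 in \<open>auto simp: g_def subset_iff\<close>)
        then show ?thesis using e0 e1 by (intro exI[of _ "min e0 e1"]) auto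
      next
        case True
        \<comment> \<open>Two zeros of the denominator differ by an integer, so a ball of radius at
          most 1 around \<open>p\<close> contains no other one.\<close>
        define B where "B = ball p (min e0 1)"
        have BS: "B \<subseteq> ?S" using e0 by (auto simp: B_def)
        have pB: "p \<in> interior B" using e0 by (simp add: B_def)
        have iff: "ee (w - z0) = 1 \<longleftrightarrow> w = p" if w: "w \<in> B" for w
        proof
          assume "ee (w - z0) = 1"
          then obtain a b :: int where ab: "w - z0 = of_int a" "p - z0 = of_int b"
            using True ee_eq_1_iff by metis
          then have wp: "w - p = of_int (a - b)" by (simp add: algebra_simps)
          have "norm (w - p) < 1" using w by (simp add: B_def dist_norm norm_minus_commute)
          then have "real_of_int \<bar>a - b\<bar> < 1" unfolding wp norm_of_int by simp
          then have "\<bar>a - b\<bar> < 1" by (simp only: of_int_less_1_iff)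
          then show "w = p" using wp by simp
        qed (use True in simp)
        \<comment> \<open>\<open>F1\<close> and \<open>E1\<close> are the difference quotients at
          \<open>p\<close> of numerator and denominator. Their singularities are removable,
          \<open>E1\<close> has no zero in \<open>B\<close>, and \<open>g\<close> is their quotient
          there.\<close>
        define F1 where "F1 = (\<lambda>w. if w = p then deriv F p else (F w - F p) / (w - p))"
        define E1 where "E1 = (\<lambda>w. if w = p then deriv (\<lambda>w. ee (w - z0)) p else (ee (w - z0) - ee (p - z0)) / (w - p))"
        have hF: "F1 holomorphic_on B" unfolding F1_def
          by (intro pole_lemma holomorphic_on_subset[OF hol] BS pB)
        have hE: "E1 holomorphic_on B" unfolding E1_def
          by (intro pole_lemma pB holomorphic_intros)
        have dE: "deriv (\<lambda>w. ee (w - z0)) p = 2 * of_real pi * \<i>"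
          by (rule DERIV_imp_deriv) (auto intro!: derivative_eq_intros simp: True)
        have E1nz: "E1 w \<noteq> 0" if "w \<in> B" for w
          using iff[OF that] True by (auto simp: E1_def dE)
        have "g w = F1 w / E1 w" if w: "w \<in> B" for w
          using iff[OF w] True F_zero[of p] p by (auto simp: g_def F1_def E1_def dE)
        then have "g holomorphic_on B"
          using holomorphic_on_divide[OF hF hE E1nz] by (simp cong: holomorphic_cong)
        then show ?thesis unfolding B_def using e0 by (intro exI[of _ "min e0 1"]) auto
      qed
    qed
    then have "g analytic_on ?S"
      unfolding analytic_on_def by blast
    then show ?thesis
      by (rule analytic_imp_holomorphic)
  qed
  show ?thesis by (rule that[OF 3 1 2])
qed

lemma fcoef_one:
  "((\<lambda>x. ee (- of_int s * (of_real x + \<i> * of_real y))) has_integral (if s = 0 then 1 else 0)) {0..1}"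
proof (cases "s = 0")
  case False
  let ?k = "- 2 * of_real pi * \<i> * of_int s :: complex"
  let ?P = "\<lambda>w. ee (- of_int s * (w + \<i> * of_real y)) / ?k"
  have k: "?k \<noteq> 0" using False by simp
  have "((\<lambda>x. ee (- of_int s * (of_real x + \<i> * of_real y))) has_integral
      (?P (of_real 1) - ?P (of_real 0))) {0..1}"
  proof (rule fundamental_theorem_of_calculus)
    fix x :: real
    have "(?P has_field_derivative ee (- of_int s * (of_real x + \<i> * of_real y))) (at (of_real x))"
      using k by (auto intro!: derivative_eq_intros simp: field_simps)
    then show "((\<lambda>x. ?P (of_real x)) has_vector_derivative
        ee (- of_int s * (of_real x + \<i> * of_real y))) (at x within {0..1})"
      by (rule has_vector_derivative_real_field)
  qed simp
  moreover have "ee (- of_int s * (of_real 1 + \<i> * of_real y)) = ee (- of_int s * (of_real 0 + \<i> * of_real y))"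
    using ee_add_of_int(2)[of "-s" "- of_int s * (\<i> * of_real y)"] by (simp add: ring_distribs)
  ultimately show ?thesis using False by simp
qed (use has_integral_const_real[of "1::complex" 0 1] in simp)

theorem fourier_strip:
  assumes hol: "F holomorphic_on strip y0 r" and per: "\<And>w. w \<in> strip y0 r \<Longrightarrow> F (w + 1) = F w"
    and z0: "z0 \<in> strip y0 r"
  shows "((\<lambda>s. fcoef y0 F s * ee (of_int s * z0)) has_sum F z0) UNIV"
proof -
  obtain g where g: "g holomorphic_on strip y0 r" "\<And>w. w \<in> strip y0 r \<Longrightarrow> g (w + 1) = g w"
    "\<And>w. w \<in> strip y0 r \<Longrightarrow> F w - F z0 = (ee (w - z0) - 1) * g w"
    using periodic_quotient[OF assms] by blast
  have r: "\<bar>y0 - y0\<bar> < r" using z0 by (auto simp: strip_def)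
  define e where "e = (\<lambda>s. fcoef y0 g s * ee (of_int s * z0))"
  \<comment> \<open>Coefficients of both sides of
    \<open>F w = F z0 + (ee (w - z0) - 1) * g w\<close>: multiplication by
    \<open>ee (w - z0)\<close> shifts the index by one.\<close>
  have coef: "fcoef y0 F s = F z0 * (if s = 0 then 1 else 0) + ee (- z0) * fcoef y0 g (s - 1) - fcoef y0 g s" for s
  proof -
    let ?w = "\<lambda>x. complex_of_real x + \<i> * complex_of_real y0"
    have "((\<lambda>x. F z0 * ee (- of_int s * ?w x)
          + ee (- z0) * (g (?w x) * ee (- of_int (s - 1) * ?w x))
          - g (?w x) * ee (- of_int s * ?w x))
        has_integral (F z0 * (if s = 0 then 1 else 0) + ee (- z0) * fcoef y0 g (s - 1) - fcoef y0 g s)) {0..1}"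
      by (intro has_integral_diff has_integral_add has_integral_mult_right fcoef_one
          has_integral_fcoef[OF g(1,2) r])
    moreover have "F z0 * ee (- of_int s * w)
          + ee (- z0) * (g w * ee (- of_int (s - 1) * w))
          - g w * ee (- of_int s * w) = F w * ee (- of_int s * w)" if "w \<in> strip y0 r" for w
    proof -
      have 1: "ee (- z0) * (g w * ee (- of_int (s - 1) * w)) = ee (w - z0) * g w * ee (- of_int s * w)"
      proof -
        have "ee (- z0) * ee (- of_int (s - 1) * w) = ee (w - z0) * ee (- of_int s * w)"
          unfolding ee_add[symmetric] by (rule arg_cong[of _ _ ee]) (simp add: algebra_simps)
        then show ?thesis by (simp add: mult_ac)
      qed
      have 2: "F w = F z0 + (ee (w - z0) - 1) * g w"
        using g(3)[OF that] by (simp add: algebra_simps)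
      show ?thesis unfolding 1 unfolding 2 by (simp add: algebra_simps)
    qed
    moreover have "?w x \<in> strip y0 r" for x using r by (simp add: strip_def)
    ultimately have "((\<lambda>x. F (?w x) * ee (- of_int s * ?w x))
        has_integral (F z0 * (if s = 0 then 1 else 0) + ee (- z0) * fcoef y0 g (s - 1) - fcoef y0 g s)) {0..1}"
      by simp
    then show ?thesis
      using has_integral_fcoef[OF hol per r] has_integral_unique by blast
  qed
  have d: "fcoef y0 F s * ee (of_int s * z0) = (if s = 0 then F z0 else 0) + e (s - 1) - e s" for s
  proof -
    have "ee (- z0) * fcoef y0 g (s - 1) * ee (of_int s * z0) = e (s - 1)"
    proof -
      have "ee (- z0) * ee (of_int s * z0) = ee (of_int (s - 1) * z0)"
        unfolding ee_add[symmetric] by (rule arg_cong[of _ _ ee]) (simp add: algebra_simps)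
      then show ?thesis unfolding e_def by (metis mult.assoc mult.commute)
    qed
    then show ?thesis
      unfolding coef by (simp add: algebra_simps e_def)
  qed
  \<comment> \<open>The series of \<open>g\<close> at \<open>z0\<close> is summable over all
    integers, so shifting its index leaves the sum \<open>E\<close> unchanged and the telescoping
    part contributes \<open>E - E\<close>.\<close>
  obtain E where E: "(e has_sum E) UNIV"
    using summable_fcoef[of g y0 r z0, OF g(1,2) z0] unfolding e_def[symmetric] summable_on_def ..
  have E': "((\<lambda>s. e (s - 1)) has_sum E) UNIV"
    using has_sum_reindex_bij_betw[of "\<lambda>s. s - 1" UNIV UNIV e E] E
    by (metis bij_diff_right)
  have "((\<lambda>s::int. if s = 0 then F z0 else 0) has_sum F z0) UNIV"
    using has_sum_finite_neutralI[of "{0::int}" UNIV "\<lambda>s. if s = 0 then F z0 else 0" "F z0"] by simp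
  then have "((\<lambda>s. (if s = 0 then F z0 else 0) + e (s - 1) + (- e s)) has_sum (F z0 + E + (- E))) UNIV"
    by (intro has_sum_add has_sum_uminusI E E')
  then show ?thesis by (simp add: d)
qed

section \<open>Fourier expansion on a tube\<close>

lemma deriv_bound_ball:
  assumes "f holomorphic_on U" "open U" "cball w e \<subseteq> U" "e > 0"
    and B: "\<And>x. x \<in> cball w e \<Longrightarrow> norm (f x) \<le> B"
  shows "norm (deriv f w) \<le> B / e"
proof -
  have "norm ((deriv ^^ 1) f w) \<le> fact 1 * B / e ^ 1"
  proof (rule Cauchy_inequality)
    show "f holomorphic_on ball w e"
      by (rule holomorphic_on_subset[OF assms(1)]) (use assms(3) ball_subset_cball in blast)
    show "continuous_on (cball w e) f"
      by (rule holomorphic_on_imp_continuous_on holomorphic_on_subset[OF assms(1)] assms(3))+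
  qed (use assms in \<open>auto simp: dist_norm\<close>)
  then show ?thesis by simp
qed

text \<open>Differentiation under the integral needs the \<open>w\<close>-derivative to be jointly
  continuous. Cauchy's estimate, applied to the difference of \<open>G\<close> at two values of
  \<open>x\<close>, carries the uniform Lipschitz bound in \<open>x\<close> over to the derivative;
  continuity in \<open>w\<close> at a fixed \<open>x0\<close> does the rest.\<close>

lemma holomorphic_integral_param:
  fixes G :: "complex \<Rightarrow> real \<Rightarrow> complex"
  assumes U: "open U" and hol: "\<And>x. x \<in> {0..1} \<Longrightarrow> (\<lambda>w. G w x) holomorphic_on U"
    and lip: "\<And>w x x'. w \<in> U \<Longrightarrow> x \<in> {0..1} \<Longrightarrow> x' \<in> {0..1} \<Longrightarrow> norm (G w x - G w x') \<le> L * \<bar>x - x'\<bar>"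
  shows "(\<lambda>w. integral {0..1} (G w)) holomorphic_on U"
proof -
  have "\<exists>e>0. (\<lambda>w. integral {0..1} (G w)) holomorphic_on ball p e" if p: "p \<in> U" for p
  proof -
    have L: "L \<ge> 0" using order_trans[OF norm_ge_zero lip[OF p, of 1 0]] by simp
    obtain e0 where e0: "e0 > 0" "cball p e0 \<subseteq> U"
      using U p open_contains_cball by blast
    \<comment> \<open>With half the radius, closed balls of radius \<open>e\<close> around points of
      \<open>ball p e\<close> still lie in \<open>U\<close>, as Cauchy's estimate requires.\<close>
    define e where "e = e0 / 2"
    have e: "e > 0" using e0 by (simp add: e_def)
    have sub: "cball w e \<subseteq> U" if "w \<in> ball p e" for w
    proof -
      have "cball w e \<subseteq> cball p e0"
      proof
        fix x assume "x \<in> cball w e"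
        then show "x \<in> cball p e0"
          using that dist_triangle[of p x w] by (simp add: e_def)
      qed
      then show ?thesis using e0 by blast
    qed
    have inU: "w \<in> U" if "w \<in> ball p e" for w
      using sub[OF that] e by auto
    have "(\<lambda>w. integral (cbox 0 1) (G w)) holomorphic_on ball p e"
    proof (rule leibniz_rule_holomorphic)
      fix w and x :: real assume wx: "w \<in> ball p e" "x \<in> cbox 0 1"
      show "((\<lambda>w. G w x) has_field_derivative deriv (\<lambda>w. G w x) w) (at w within ball p e)"
        using holomorphic_derivI[OF hol U] wx inU by (simp add: has_field_derivative_at_within)
    next
      fix w assume w: "w \<in> ball p e"
      have "L-lipschitz_on {0..1} (G w)"
        by (rule lipschitz_onI) (use lip[OF inU[OF w]] L in \<open>auto simp: dist_norm\<close>)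
      then show "G w integrable_on cbox 0 1"
        by (metis cbox_interval integrable_continuous_interval lipschitz_on_continuous_on)
    next
      show "continuous_on (ball p e \<times> cbox 0 1) (\<lambda>(w, x). deriv (\<lambda>w. G w x) w)"
        unfolding continuous_on_iff
      proof safe
        fix w0 and x0 \<epsilon> :: real
        assume w0: "w0 \<in> ball p e" and x0: "x0 \<in> cbox 0 1" and \<epsilon>: "\<epsilon> > 0"
        have "continuous_on U (deriv (\<lambda>w. G w x0))"
          using hol x0 U by (intro holomorphic_on_imp_continuous_on holomorphic_deriv) auto
        then obtain d where d: "d > 0" "\<And>w. w \<in> U \<Longrightarrow> dist w w0 < d \<Longrightarrow>
            dist (deriv (\<lambda>w. G w x0) w) (deriv (\<lambda>w. G w x0) w0) < \<epsilon> / 2"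
          unfolding continuous_on_iff using inU[OF w0] \<epsilon> by (metis half_gt_zero)
        have dd: "norm (deriv (\<lambda>w. G w x) w - deriv (\<lambda>w. G w x0) w) \<le> L * \<bar>x - x0\<bar> / e"
          if w: "w \<in> ball p e" and x: "x \<in> cbox 0 1" for w x
        proof -
          have "deriv (\<lambda>w. G w x - G w x0) w = deriv (\<lambda>w. G w x) w - deriv (\<lambda>w. G w x0) w"
            using holomorphic_on_imp_differentiable_at[OF hol U inU[OF w]] x x0
            by (intro deriv_diff) auto
          moreover have "norm (deriv (\<lambda>w. G w x - G w x0) w) \<le> L * \<bar>x - x0\<bar> / e"
            by (rule deriv_bound_ball[OF _ U sub[OF w] e])
               (use hol lip sub[OF w] x x0 in \<open>auto intro!: holomorphic_intros\<close>)
          ultimately show ?thesis by simp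
        qed
        \<comment> \<open>Each variable may spend half of the tolerance; \<open>L + 1\<close> keeps
          the denominator positive when \<open>L = 0\<close>.\<close>
        define d' where "d' = min d (\<epsilon> * e / (2 * (L + 1)))"
        have "d' > 0" using d \<epsilon> e L by (simp add: d'_def)
        moreover have "dist (deriv (\<lambda>w. G w x) w) (deriv (\<lambda>w. G w x0) w0) < \<epsilon>"
          if w: "w \<in> ball p e" and x: "x \<in> cbox 0 1" and dist: "dist (w, x) (w0, x0) < d'" for w x
        proof -
          have 1: "dist w w0 < d'" "\<bar>x - x0\<bar> < d'"
            using dist dist_fst_le[of "(w,x)" "(w0,x0)"] dist_snd_le[of "(w,x)" "(w0,x0)"]
            by (auto simp: dist_real_def)
          have "L * \<bar>x - x0\<bar> \<le> (L + 1) * (\<epsilon> * e / (2 * (L + 1)))"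
            using 1 L by (intro mult_mono) (auto simp: d'_def)
          also have "\<dots> = \<epsilon> / 2 * e" using L by (simp add: field_simps)
          finally have "L * \<bar>x - x0\<bar> / e \<le> \<epsilon> / 2" using e by (simp add: field_simps)
          then have "norm (deriv (\<lambda>w. G w x) w - deriv (\<lambda>w. G w x0) w) \<le> \<epsilon> / 2"
            using dd[OF w x] by linarith
          moreover have "dist (deriv (\<lambda>w. G w x0) w) (deriv (\<lambda>w. G w x0) w0) < \<epsilon> / 2"
            using d(2)[OF inU[OF w]] 1 by (simp add: d'_def)
          ultimately show ?thesis
            by (smt (verit) dist_norm dist_triangle field_sum_of_halves)
        qed
        ultimately show "\<exists>d>0. \<forall>x'\<in>ball p e \<times> cbox 0 1. dist x' (w0, x0) < d \<longrightarrow>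
            dist (case x' of (w, x) \<Rightarrow> deriv (\<lambda>w. G w x) w) (deriv (\<lambda>w. G w x0) w0) < \<epsilon>"
          by (intro exI[of _ d']) auto
      qed
    qed auto
    then show ?thesis using e by auto
  qed
  then have "(\<lambda>w. integral {0..1} (G w)) analytic_on U"
    unfolding analytic_on_def by blast
  then show ?thesis by (rule analytic_imp_holomorphic)
qed

text \<open>Separate holomorphy and a uniform bound yield the Lipschitz condition of
  \<open>holomorphic_integral_param\<close>: Cauchy's estimate with radius \<open>r / 2\<close>
  bounds the derivative along the line of integration.\<close>

lemma holomorphic_fcoef_param:
  assumes r: "r > 0" and U: "open U"
    and hol1: "\<And>w. w \<in> U \<Longrightarrow> F w holomorphic_on strip y0 r"
    and hol2: "\<And>v. v \<in> strip y0 r \<Longrightarrow> (\<lambda>w. F w v) holomorphic_on U"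
    and M: "\<And>w v. w \<in> U \<Longrightarrow> v \<in> strip y0 r \<Longrightarrow> norm (F w v) \<le> M"
  shows "(\<lambda>w. fcoef y0 (F w) s) holomorphic_on U"
proof -
  \<comment> \<open>On the strip \<open>\<bar>Im v\<bar>\<close> stays below
    \<open>\<bar>y0\<bar> + r\<close>, which bounds the exponential twist.\<close>
  define M' where "M' = \<bar>M\<bar> * exp (2 * pi * \<bar>of_int s\<bar> * (\<bar>y0\<bar> + r))"
  define G where "G = (\<lambda>w v. F w v * ee (- of_int s * v))"
  have Gb: "norm (G w v) \<le> M'" if "w \<in> U" "v \<in> strip y0 r" for w v
  proof -
    have "of_int s * Im v \<le> \<bar>of_int s\<bar> * \<bar>Im v\<bar>"
      by (metis abs_ge_self abs_mult)
    also have "\<dots> \<le> \<bar>of_int s\<bar> * (\<bar>y0\<bar> + r)"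
      using that by (intro mult_left_mono) (auto simp: strip_def)
    finally have "2 * pi * (of_int s * Im v) \<le> 2 * pi * (\<bar>of_int s\<bar> * (\<bar>y0\<bar> + r))"
      by (intro mult_left_mono) auto
    then have "norm (ee (- of_int s * v)) \<le> exp (2 * pi * \<bar>of_int s\<bar> * (\<bar>y0\<bar> + r))"
      by (simp add: norm_ee mult.assoc)
    then show ?thesis
      unfolding G_def M'_def norm_mult using M[OF that] by (intro mult_mono) auto
  qed
  have Gh: "G w holomorphic_on strip y0 r" if "w \<in> U" for w
    unfolding G_def by (intro holomorphic_intros hol1 that)
  have "(\<lambda>w. integral {0..1} (\<lambda>x. G w (of_real x + \<i> * of_real y0))) holomorphic_on U"
  proof (rule holomorphic_integral_param[OF U, where L = "M' / (r / 2)"])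
    fix x :: real
    have "of_real x + \<i> * of_real y0 \<in> strip y0 r" using r by (simp add: strip_def)
    then show "(\<lambda>w. G w (of_real x + \<i> * of_real y0)) holomorphic_on U"
      unfolding G_def by (intro holomorphic_intros hol2)
  next
    fix w and x x' :: real assume w: "w \<in> U"
    let ?S = "{v. Im v = y0}"
    have "norm (G w (of_real x + \<i> * of_real y0) - G w (of_real x' + \<i> * of_real y0))
        \<le> M' / (r / 2) * norm ((of_real x + \<i> * of_real y0) - (of_real x' + \<i> * of_real y0))"
    proof (rule field_differentiable_bound)
      show "convex ?S" by (auto simp: convex_def algebra_simps simp flip: distrib_right)
      fix v assume v: "v \<in> ?S"
      show "(G w has_field_derivative deriv (G w) v) (at v within ?S)"
        using holomorphic_derivI[OF Gh[OF w] open_strip, of v] v r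
        by (auto simp: strip_def intro: has_field_derivative_at_within)
      have "cball v (r / 2) \<subseteq> strip y0 r"
      proof
        fix u assume "u \<in> cball v (r / 2)"
        then have "\<bar>Im (v - u)\<bar> \<le> r / 2"
          using abs_Im_le_cmod[of "v - u"] by (simp add: dist_norm)
        then have "\<bar>Im u - y0\<bar> \<le> r / 2" using v by (simp add: abs_minus_commute)
        also have "\<dots> < r" using r by simp
        finally show "u \<in> strip y0 r" by (simp add: strip_def)
      qed
      then show "norm (deriv (G w) v) \<le> M' / (r / 2)"
        using Gb[OF w] r by (intro deriv_bound_ball[OF Gh[OF w] open_strip]) auto
    qed auto
    also have "\<dots> = M' / (r / 2) * \<bar>x - x'\<bar>"
      by (simp flip: of_real_diff)
    finally show "norm (G w (of_real x + \<i> * of_real y0) - G w (of_real x' + \<i> * of_real y0)) \<le> M' / (r / 2) * \<bar>x - x'\<bar>" .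
  qed
  then show ?thesis by (simp add: fcoef_def G_def)
qed

text \<open>A product of strips whose points are functions on the whole index type, constrained on
  \<open>I\<close> only; in the induction over \<open>I\<close> their type therefore does not
  change.\<close>

definition tube :: "'i set \<Rightarrow> ('i \<Rightarrow> real) \<Rightarrow> real \<Rightarrow> ('i \<Rightarrow> complex) set" where
  "tube I y r = {z. \<forall>i\<in>I. \<bar>Im (z i) - y i\<bar> < r}"

lemma summable_prod_PiE:
  fixes g :: "'i \<Rightarrow> int \<Rightarrow> real"
  assumes "finite I" "\<And>i. i \<in> I \<Longrightarrow> (\<lambda>s. g i s) summable_on UNIV" "\<And>i s. g i s \<ge> 0"
  shows "(\<lambda>t. \<Prod>i\<in>I. g i (t i)) summable_on (PiE I (\<lambda>_. UNIV))"
proof -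
  have "Infinite_Set_Sum.abs_summable_on (\<lambda>t. \<Prod>i\<in>I. g i (t i)) (PiE I (\<lambda>_. UNIV))"
    using assms by (intro abs_summable_on_prod_PiE) (auto simp flip: abs_summable_equivalent)
  then have "(\<lambda>t. norm (\<Prod>i\<in>I. g i (t i))) summable_on (PiE I (\<lambda>_. UNIV))"
    by (rule abs_summable_equivalent[THEN iffD2])
  then show ?thesis by (rule abs_summable_summable)
qed

text \<open>The bound holds at every height \<open>y'\<close> in the tube, so \<open>y'\<close> may
  depend on \<open>t\<close>: each coordinate moves against the sign of \<open>t i\<close>, as in
  \<open>fcoef_decay\<close>, and a product of geometric majorants results.\<close>

lemma tube_summable:
  fixes c :: "('i \<Rightarrow> int) \<Rightarrow> complex"
  assumes I: "finite I" and z: "z \<in> tube I y r"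
    and bound: "\<And>t y'. t \<in> PiE I (\<lambda>_. UNIV) \<Longrightarrow> (\<And>i. i \<in> I \<Longrightarrow> \<bar>y' i - y i\<bar> < r) \<Longrightarrow>
      norm (c t) \<le> M * exp (2 * pi * (\<Sum>i\<in>I. of_int (t i) * y' i))"
  shows "(\<lambda>t. norm (c t * ee (\<Sum>i\<in>I. of_int (t i) * z i))) summable_on (PiE I (\<lambda>_. UNIV))"
proof -
  \<comment> \<open>The value 1 outside \<open>I\<close> only serves to make \<open>d i > 0\<close>
    hold for every index.\<close>
  define d where "d i = (if i \<in> I then (r - \<bar>Im (z i) - y i\<bar>) / 2 else 1)" for i
  have d: "d i > 0" for i using z by (auto simp: d_def tube_def)
  let ?g = "\<lambda>i s. exp (- (2 * pi * d i) * \<bar>of_int s\<bar>)"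
  have "(\<lambda>t. M * (\<Prod>i\<in>I. ?g i (t i))) summable_on (PiE I (\<lambda>_. UNIV))"
    by (intro summable_on_cmult_right summable_prod_PiE I summable_exp_abs_int) (use d in auto)
  then show ?thesis
  proof (rule Infinite_Sum.abs_summable_on_comparison_test')
    fix t :: "'i \<Rightarrow> int" assume t: "t \<in> PiE I (\<lambda>_. UNIV)"
    define y' where "y' i = Im (z i) - d i * sgn (of_int (t i))" for i
    have y': "\<bar>y' i - y i\<bar> < r" if i: "i \<in> I" for i
    proof -
      have "\<bar>y' i - y i\<bar> \<le> \<bar>Im (z i) - y i\<bar> + d i"
        using d[of i] by (auto simp: y'_def sgn_if)
      also have "\<dots> < r" using z i by (auto simp: d_def tube_def field_simps)
      finally show ?thesis .
    qed
    have "norm (c t * ee (\<Sum>i\<in>I. of_int (t i) * z i)) \<le>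
        M * exp (2 * pi * (\<Sum>i\<in>I. of_int (t i) * y' i)) * exp (- 2 * pi * (\<Sum>i\<in>I. of_int (t i) * Im (z i)))"
      using mult_right_mono[OF bound[OF t y'], of "exp (- 2 * pi * (\<Sum>i\<in>I. of_int (t i) * Im (z i)))"]
      by (simp add: norm_mult norm_ee)
    also have "\<dots> = M * exp (2 * pi * (\<Sum>i\<in>I. of_int (t i) * y' i) - 2 * pi * (\<Sum>i\<in>I. of_int (t i) * Im (z i)))"
      by (simp add: exp_diff exp_minus divide_inverse)
    also have "2 * pi * (\<Sum>i\<in>I. of_int (t i) * y' i) - 2 * pi * (\<Sum>i\<in>I. of_int (t i) * Im (z i))
        = (\<Sum>i\<in>I. - (2 * pi * d i) * \<bar>of_int (t i)\<bar>)"
      unfolding sum_distrib_left sum_subtractf[symmetric]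
      by (intro sum.cong refl) (auto simp: y'_def abs_sgn algebra_simps)
    also have "M * exp (\<Sum>i\<in>I. - (2 * pi * d i) * \<bar>of_int (t i)\<bar>) = M * (\<Prod>i\<in>I. ?g i (t i))"
      using I by (simp add: exp_sum)
    finally show "norm (c t * ee (\<Sum>i\<in>I. of_int (t i) * z i)) \<le> M * (\<Prod>i\<in>I. ?g i (t i))" .
  qed
qed

text \<open>One variable is expanded first, then each of its coefficients as a function of the
  remaining variables. The estimate of \<open>c t\<close> is carried through the induction because
  absolute summability of the full series, by way of \<open>tube_summable\<close>, depends on it; it
  is quantified over \<open>y'\<close> since that lemma chooses the height after
  \<open>t\<close>.\<close>

theorem fourier_tube:
  fixes F :: "('i \<Rightarrow> complex) \<Rightarrow> complex"
  assumes "finite I" and r: "r > 0"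
    and "\<And>z z'. (\<And>i. i \<in> I \<Longrightarrow> z i = z' i) \<Longrightarrow> F z = F z'"
    and "\<And>z i. z \<in> tube I y r \<Longrightarrow> i \<in> I \<Longrightarrow> F (z(i := z i + 1)) = F z"
    and "\<And>z i. z \<in> tube I y r \<Longrightarrow> i \<in> I \<Longrightarrow> (\<lambda>w. F (z(i := w))) holomorphic_on strip (y i) r"
    and "\<And>z. z \<in> tube I y r \<Longrightarrow> norm (F z) \<le> M"
  shows "\<exists>c. (\<forall>t\<in>PiE I (\<lambda>_. UNIV). \<forall>y' M'. (\<forall>i\<in>I. \<bar>y' i - y i\<bar> < r) \<longrightarrow>
          (\<forall>z. (\<forall>i\<in>I. Im (z i) = y' i) \<longrightarrow> norm (F z) \<le> M') \<longrightarrow>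
          norm (c t) \<le> M' * exp (2 * pi * (\<Sum>i\<in>I. of_int (t i) * y' i))) \<and>
      (\<forall>z\<in>tube I y r. ((\<lambda>t. c t * ee (\<Sum>i\<in>I. of_int (t i) * z i)) has_sum F z) (PiE I (\<lambda>_. UNIV)))"
  using assms(1,3-)
proof (induction I arbitrary: F M rule: finite_induct)
  case empty
  define a where "a = F (\<lambda>_. 0)"
  have "F z = a" for z unfolding a_def by (rule empty.prems) simp
  then show ?case
    by (intro exI[of _ "\<lambda>_. a"]) (auto intro!: has_sum_finiteI)
next
  case (insert j I)
  note dep = insert.prems(1) and per = insert.prems(2) and hol = insert.prems(3) and bd = insert.prems(4)
  let ?J = "insert j I"
  define C where "C s z = fcoef (y j) (\<lambda>w. F (z(j := w))) s" for s z
  have tube_upd: "z(j := w) \<in> tube ?J y r" if "z \<in> tube I y r" "w \<in> strip (y j) r" for z w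
    using that insert.hyps by (auto simp: tube_def strip_def)
  have tube_I: "z \<in> tube I y r" "z j \<in> strip (y j) r" if "z \<in> tube ?J y r" for z
    using that by (auto simp: tube_def strip_def)
  have holj: "(\<lambda>w. F (z(j := w))) holomorphic_on strip (y j) r" if z: "z \<in> tube I y r" for z
  proof -
    have "z(j := \<i> * of_real (y j)) \<in> tube ?J y r" using tube_upd[OF z] r by (auto simp: strip_def)
    from hol[OF this, of j] show ?thesis by (simp only: fun_upd_upd insertI1)
  qed
  have perj: "F (z(j := w + 1)) = F (z(j := w))" if z: "z \<in> tube I y r" and w: "w \<in> strip (y j) r" for z w
    using per[OF tube_upd[OF z w], of j] by (simp only: fun_upd_upd fun_upd_same insertI1)
  have C_le: "norm (C s z) \<le> M' * exp (2 * pi * of_int s * v)"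
    if "z \<in> tube I y r" "\<bar>v - y j\<bar> < r" "\<And>w. Im w = v \<Longrightarrow> norm (F (z(j := w))) \<le> M'" for s z v M'
    unfolding C_def using that by (intro norm_fcoef_le[OF holj perj]) auto
  define P where "P s c \<longleftrightarrow> (\<forall>t\<in>PiE I (\<lambda>_. UNIV). \<forall>y' M'. (\<forall>i\<in>I. \<bar>y' i - y i\<bar> < r) \<longrightarrow>
          (\<forall>z. (\<forall>i\<in>I. Im (z i) = y' i) \<longrightarrow> norm (C s z) \<le> M') \<longrightarrow>
          norm (c t) \<le> M' * exp (2 * pi * (\<Sum>i\<in>I. of_int (t i) * y' i))) \<and>
      (\<forall>z\<in>tube I y r. ((\<lambda>t. c t * ee (\<Sum>i\<in>I. of_int (t i) * z i)) has_sum C s z) (PiE I (\<lambda>_. UNIV)))"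
    for s and c :: "('i \<Rightarrow> int) \<Rightarrow> complex"
  have "\<exists>c. P s c" for s
    unfolding P_def
  proof (rule insert.IH)
    fix z z' :: "'i \<Rightarrow> complex" assume "\<And>i. i \<in> I \<Longrightarrow> z i = z' i"
    then have "F (z(j := w)) = F (z'(j := w))" for w by (intro dep) auto
    then show "C s z = C s z'" by (simp add: C_def)
  next
    fix z i assume z: "z \<in> tube I y r" and i: "i \<in> I"
    then have ij: "i \<noteq> j" using insert.hyps by auto
    let ?w = "\<lambda>x. of_real x + \<i> * of_real (y j)"
    have "F (z(i := z i + 1, j := ?w x)) = F (z(j := ?w x))" for x
    proof -
      have "?w x \<in> strip (y j) r" using r by (simp add: strip_def)
      moreover have "z(i := z i + 1, j := ?w x) = (z(j := ?w x))(i := (z(j := ?w x)) i + 1)"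
        using ij by (intro ext) simp
      ultimately show ?thesis using per[OF tube_upd[OF z], of "?w x" i] i by (simp only: insertI2)
    qed
    then show "C s (z(i := z i + 1)) = C s z" by (simp add: C_def fcoef_def)
  next
    fix z i assume z: "z \<in> tube I y r" and i: "i \<in> I"
    then have ij: "i \<noteq> j" using insert.hyps by auto
    have zi: "z(i := w) \<in> tube I y r" if "w \<in> strip (y i) r" for w
      using z that by (auto simp: tube_def strip_def)
    show "(\<lambda>w. C s (z(i := w))) holomorphic_on strip (y i) r"
      unfolding C_def
    proof (rule holomorphic_fcoef_param[OF r open_strip, where M = M])
      fix v assume "v \<in> strip (y j) r"
      moreover have "z(i := w, j := v) = (z(j := v))(i := w)" for w
        using ij by (intro ext) simp
      ultimately show "(\<lambda>w. F (z(i := w, j := v))) holomorphic_on strip (y i) r"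
        using hol[OF tube_upd[OF z], of v i] i by (simp only: insertI2)
    qed (use bd tube_upd holj zi in blast)+
  next
    fix z assume z: "z \<in> tube I y r"
    show "norm (C s z) \<le> M * exp (2 * pi * of_int s * y j)"
      by (intro C_le bd tube_upd z) (use r in \<open>auto simp: strip_def\<close>)
  qed
  then obtain c where c: "\<And>s. P s (c s)"
    by metis
  have c1: "norm (c s t) \<le> M' * exp (2 * pi * (\<Sum>i\<in>I. of_int (t i) * y' i))"
    if "t \<in> PiE I (\<lambda>_. UNIV)" "\<forall>i\<in>I. \<bar>y' i - y i\<bar> < r"
      "\<forall>z. (\<forall>i\<in>I. Im (z i) = y' i) \<longrightarrow> norm (C s z) \<le> M'" for s t y' M'
    using c[of s] that unfolding P_def by simp
  have c2: "((\<lambda>t. c s t * ee (\<Sum>i\<in>I. of_int (t i) * z i)) has_sum C s z) (PiE I (\<lambda>_. UNIV))"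
    if "z \<in> tube I y r" for s z
    using c[of s] that unfolding P_def by simp
  define c' where "c' t = c (t j) (restrict t I)" for t :: "'i \<Rightarrow> int"
  have c'1: "norm (c' t) \<le> M' * exp (2 * pi * (\<Sum>i\<in>?J. of_int (t i) * y' i))"
    if y': "\<forall>i\<in>?J. \<bar>y' i - y i\<bar> < r" and M': "\<forall>z. (\<forall>i\<in>?J. Im (z i) = y' i) \<longrightarrow> norm (F z) \<le> M'" for t y' M'
  proof -
    have "norm (c' t) \<le> (M' * exp (2 * pi * of_int (t j) * y' j)) * exp (2 * pi * (\<Sum>i\<in>I. of_int (restrict t I i) * y' i))"
      unfolding c'_def
    proof (rule c1)
      show "\<forall>z. (\<forall>i\<in>I. Im (z i) = y' i) \<longrightarrow> norm (C (t j) z) \<le> M' * exp (2 * pi * of_int (t j) * y' j)"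
      proof (intro allI impI C_le)
        fix z w assume z: "\<forall>i\<in>I. Im (z i) = y' i" and "Im w = y' j"
        then show "norm (F (z(j := w))) \<le> M'" using M' insert.hyps by simp
      qed (use y' in \<open>auto simp: tube_def\<close>)
    qed (use y' in auto)
    also have "(\<Sum>i\<in>I. of_int (restrict t I i) * y' i) = (\<Sum>i\<in>I. of_int (t i) * y' i)"
      by (intro sum.cong) auto
    finally show ?thesis using insert.hyps by (simp add: distrib_left exp_add mult_ac)
  qed
  have c'2: "((\<lambda>t. c' t * ee (\<Sum>i\<in>?J. of_int (t i) * z i)) has_sum F z) (PiE ?J (\<lambda>_. UNIV))"
    if z: "z \<in> tube ?J y r" for z
  proof -
    let ?h = "\<lambda>(s, t). t(j := s) :: 'i \<Rightarrow> int"
    let ?f = "\<lambda>t. c' t * ee (\<Sum>i\<in>?J. of_int (t i) * z i)"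
    have img: "PiE ?J (\<lambda>_. UNIV) = ?h ` (UNIV \<times> PiE I (\<lambda>_. UNIV))"
      by (simp add: PiE_insert_eq)
    have inj: "inj_on ?h (UNIV \<times> PiE I (\<lambda>_. UNIV))"
      using inj_combinator[of j I "\<lambda>_. UNIV"] insert.hyps by simp
    \<comment> \<open>Summability over all index vectors comes first; only then may the iterated sum
      be read as a sum over pairs.\<close>
    have "(\<lambda>t. norm (?f t)) summable_on (PiE ?J (\<lambda>_. UNIV))"
    proof (rule tube_summable[OF _ z])
      fix t :: "'i \<Rightarrow> int" and y' assume y': "\<And>i. i \<in> ?J \<Longrightarrow> \<bar>y' i - y i\<bar> < r"
      show "norm (c' t) \<le> M * exp (2 * pi * (\<Sum>i\<in>?J. of_int (t i) * y' i))"
        using y' by (intro c'1 allI impI bd) (auto simp: tube_def)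
    qed (use insert.hyps in auto)
    then have "?f summable_on (PiE ?J (\<lambda>_. UNIV))" by (rule abs_summable_summable)
    then have sm: "(?f \<circ> ?h) summable_on (UNIV \<times> PiE I (\<lambda>_. UNIV))"
      unfolding img using summable_on_reindex[OF inj] by blast
    have val: "(?f \<circ> ?h) (s, t) = (c s t * ee (\<Sum>i\<in>I. of_int (t i) * z i)) * ee (of_int s * z j)"
      if t: "t \<in> PiE I (\<lambda>_. UNIV)" for s t
    proof -
      have "restrict (t(j := s)) I = t"
        using t insert.hyps by (auto simp: restrict_def PiE_def extensional_def fun_eq_iff)
      moreover have "(\<Sum>i\<in>I. of_int ((t(j := s)) i) * z i) = (\<Sum>i\<in>I. of_int (t i) * z i)"
        using insert.hyps by (intro sum.cong) auto
      ultimately show ?thesis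
        using insert.hyps by (simp add: c'_def ee_add)
    qed
    have "((?f \<circ> ?h) has_sum F z) (Sigma UNIV (\<lambda>_. PiE I (\<lambda>_. UNIV)))"
    proof (rule has_sum_SigmaI[OF _ _ sm])
      fix s :: int
      have "((\<lambda>t. (c s t * ee (\<Sum>i\<in>I. of_int (t i) * z i)) * ee (of_int s * z j))
          has_sum (C s z * ee (of_int s * z j))) (PiE I (\<lambda>_. UNIV))"
        by (intro has_sum_cmult_left c2 tube_I z)
      then show "((\<lambda>t. (?f \<circ> ?h) (s, t)) has_sum (C s z * ee (of_int s * z j))) (PiE I (\<lambda>_. UNIV))"
        by (rule has_sum_cong[THEN iffD1, rotated]) (use val in simp)
    next
      have "((\<lambda>s. C s z * ee (of_int s * z j)) has_sum F (z(j := z j))) UNIV"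
        unfolding C_def by (rule fourier_strip[OF holj perj]) (use tube_I[OF z] in auto)
      then show "((\<lambda>s. C s z * ee (of_int s * z j)) has_sum F z) UNIV" by simp
    qed
    then show ?thesis unfolding img has_sum_reindex[OF inj] .
  qed
  show ?case
    by (intro exI[of _ c'] conjI ballI allI impI c'1 c'2) auto
qed

section \<open>Series of exponentials\<close>

text \<open>Averaging over the two translates by \<open>0\<close> and \<open>x\<close>, twisted by the character at \<open>t0\<close>, kills
  the terms with \<open>ch t x = - ch t0 x\<close> without enlarging the others.\<close>

lemma character_sum_zero:
  fixes c :: "'a \<Rightarrow> complex" and ch :: "'a \<Rightarrow> 'x \<Rightarrow> complex" and pl :: "'x \<Rightarrow> 'x \<Rightarrow> 'x"
  assumes norm: "\<And>t x. t \<in> S \<Longrightarrow> norm (ch t x) = 1"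
    and hom: "\<And>t x y. t \<in> S \<Longrightarrow> ch t (pl x y) = ch t x * ch t y"
    and sum: "\<And>x. ((\<lambda>t. c t * ch t x) has_sum 0) S"
    and t0: "t0 \<in> S" and sep: "\<And>t. t \<in> S \<Longrightarrow> t \<noteq> t0 \<Longrightarrow> \<exists>x. ch t x = - ch t0 x"
  shows "c t0 = 0"
proof -
  define m where "m X t = (\<Prod>x\<in>X. (ch t0 x + ch t x) / 2)" for X t
  have avg: "((\<lambda>t. c t * m X t * ch t y) has_sum 0) S" if "finite X" for X y
    using that
  proof (induction X arbitrary: y)
    case empty
    then show ?case using sum by (simp add: m_def)
  next
    case (insert x X)
    have "((\<lambda>t. (ch t0 x / 2) * (c t * m X t * ch t y) + (1 / 2) * (c t * m X t * ch t (pl x y)))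
        has_sum ((ch t0 x / 2) * 0 + (1 / 2) * 0)) S"
      by (intro has_sum_add has_sum_cmult_right insert.IH)
    then have "((\<lambda>t. (ch t0 x / 2) * (c t * m X t * ch t y) + (1 / 2) * (c t * m X t * ch t (pl x y)))
        has_sum 0) S" by simp
    then show ?case
      by (rule has_sum_cong[THEN iffD1, rotated]) (use insert.hyps in \<open>simp add: m_def hom field_simps\<close>)
  qed
  have m_le: "norm (m X t) \<le> 1" if "t \<in> S" for X t
    unfolding m_def prod_norm[symmetric]
  proof (rule prod_le_1)
    fix x assume "x \<in> X"
    show "0 \<le> norm ((ch t0 x + ch t x) / 2) \<and> norm ((ch t0 x + ch t x) / 2) \<le> 1"
      using norm_triangle_ineq[of "ch t0 x" "ch t x"] norm[OF that, of x] norm[OF t0, of x]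
      by (simp add: norm_divide)
  qed
  have m_t0: "norm (m X t0) = 1" for X
    unfolding m_def prod_norm[symmetric] by (intro prod.neutral ballI) (simp add: norm[OF t0])
  have summ: "(\<lambda>t. norm (c t)) summable_on S"
  proof -
    \<comment> \<open>Any element of the type will do: a character value of norm 1 leaves absolute
      values unchanged.\<close>
    obtain x0 :: 'x where True by simp
    have "(\<lambda>t. c t * ch t x0) summable_on S" using sum summable_on_def by blast
    then have "(\<lambda>t. norm (c t * ch t x0)) summable_on S" by (rule summable_on_iff_abs_summable_on_complex[THEN iffD1])
    then show ?thesis
      by (rule summable_on_cong[THEN iffD1, rotated]) (simp add: norm_mult norm)
  qed
  \<comment> \<open>Outside a finite set \<open>F\<close> containing \<open>t0\<close> the norms add
    up to at most \<open>\<epsilon>\<close>. One separating point for each other element of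
    \<open>F\<close> makes the averaged series vanish on \<open>F\<close> except at
    \<open>t0\<close>, so the term at \<open>t0\<close> is balanced by the tail.\<close>
  have "norm (c t0) \<le> \<epsilon>" if \<epsilon>: "\<epsilon> > 0" for \<epsilon>
  proof -
    have "eventually (\<lambda>F. dist (sum (\<lambda>t. norm (c t)) F) (infsum (\<lambda>t. norm (c t)) S) < \<epsilon>) (finite_subsets_at_top S)"
      using has_sum_infsum[OF summ] \<epsilon> unfolding has_sum_def tendsto_iff by blast
    then obtain F0 where F0: "finite F0" "F0 \<subseteq> S"
        "\<And>F. finite F \<Longrightarrow> F0 \<subseteq> F \<Longrightarrow> F \<subseteq> S \<Longrightarrow> dist (sum (\<lambda>t. norm (c t)) F) (infsum (\<lambda>t. norm (c t)) S) < \<epsilon>"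
      unfolding eventually_finite_subsets_at_top by metis
    define F where "F = insert t0 F0"
    have F: "finite F" "F \<subseteq> S" "t0 \<in> F" using F0 t0 by (auto simp: F_def)
    have tail: "(\<Sum>\<^sub>\<infinity>t\<in>S - F. norm (c t)) \<le> \<epsilon>"
    proof -
      have "(\<Sum>\<^sub>\<infinity>t\<in>S - F. norm (c t)) = infsum (\<lambda>t. norm (c t)) S - sum (\<lambda>t. norm (c t)) F"
        using infsum_Diff[OF summ _ F(2)] F by simp
      moreover have "F0 \<subseteq> F" by (auto simp: F_def)
      ultimately show ?thesis
        using F0(3)[OF F(1) _ F(2)] unfolding dist_real_def by linarith
    qed
    have "\<forall>t\<in>F - {t0}. \<exists>x. ch t x = - ch t0 x" using sep F by blast
    then obtain p where p: "\<And>t. t \<in> F - {t0} \<Longrightarrow> ch t (p t) = - ch t0 (p t)"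
      by metis
    define X where "X = p ` (F - {t0})"
    have X: "finite X" using F by (simp add: X_def)
    have m_F: "m X t = 0" if "t \<in> F - {t0}" for t
      unfolding m_def using that p[OF that] X by (intro prod_zero bexI[of _ "p t"]) (auto simp: X_def)
    obtain x0 :: 'x where True by simp
    let ?f = "\<lambda>t. c t * m X t * ch t x0"
    have f0: "(?f has_sum 0) S" using avg[OF X] .
    have "(?f has_sum (?f t0)) F"
      by (rule has_sum_finiteI) (use F m_F in \<open>simp_all add: sum.remove[of F t0]\<close>)
    then have "(?f has_sum (0 - ?f t0)) (S - F)"
      by (intro has_sum_Diff f0 F(2))
    then have "norm (0 - ?f t0) \<le> (\<Sum>\<^sub>\<infinity>t\<in>S - F. norm (c t))"
    proof (rule norm_infsum_le)
      show "((\<lambda>t. norm (c t)) has_sum (\<Sum>\<^sub>\<infinity>t\<in>S - F. norm (c t))) (S - F)"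
        by (intro has_sum_infsum summable_on_subset_banach[OF summ]) auto
      fix t assume "t \<in> S - F"
      then have t: "t \<in> S" by simp
      show "norm (?f t) \<le> norm (c t)"
        using mult_left_mono[OF m_le[OF t, of X] norm_ge_zero[of "c t"]] by (simp add: norm_mult norm[OF t])
    qed
    then show ?thesis using tail by (simp add: norm_mult m_t0 norm[OF t0])
  qed
  then have "norm (c t0) \<le> 0" by (rule field_le_epsilon[of _ 0, simplified])
  then show ?thesis by simp
qed

text \<open>Exponents with a nonzero coefficient are nonnegative, so for \<open>y \<ge> y0\<close>
  the series at \<open>y0\<close> is a majorant and the limit may be taken term by term. Terms with
  \<open>l t > 0\<close> tend to zero and those with \<open>l t = 0\<close> do not depend on
  \<open>y\<close>.\<close>

lemma tendsto_exp_series: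
  fixes a :: "'a \<Rightarrow> complex" and l :: "'a \<Rightarrow> real"
  assumes summ: "(\<lambda>t. norm (a t * exp (- of_real (l t * y0)))) summable_on S"
    and l: "\<And>t. t \<in> S \<Longrightarrow> a t \<noteq> 0 \<Longrightarrow> l t \<ge> 0"
    and g: "\<And>y. y \<ge> y0 \<Longrightarrow> ((\<lambda>t. a t * exp (- of_real (l t * y))) has_sum g y) S"
  shows "(g \<longlongrightarrow> infsum a {t \<in> S. l t = 0}) at_top"
    and "a summable_on {t \<in> S. l t = 0}"
proof -
  let ?S0 = "{t \<in> S. l t = 0}"
  have "(\<lambda>t. norm (a t * exp (- of_real (l t * y0)))) summable_on ?S0"
    by (rule summable_on_subset_banach[OF summ]) auto
  then have "(\<lambda>t. norm (a t)) summable_on ?S0"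
    by (rule summable_on_cong[THEN iffD1, rotated]) auto
  then show S0: "a summable_on ?S0" by (rule abs_summable_summable)
  let ?b = "\<lambda>t. if l t = 0 then a t else 0"
  have b: "(?b has_sum (infsum a ?S0)) S"
    using has_sum_infsum[OF S0] by (rule has_sum_cong_neutral[THEN iffD1, rotated -1]) auto
  have ul: "uniform_limit {y0..} (\<lambda>F y. \<Sum>t\<in>F. a t * exp (- of_real (l t * y))) g (finite_subsets_at_top S)"
  proof (rule Weierstrass_m_test_general'[OF _ _ summ])
    fix t y assume t: "t \<in> S" and y: "y \<in> {y0..}"
    show "norm (a t * exp (- of_real (l t * y))) \<le> norm (a t * exp (- of_real (l t * y0)))"
    proof (cases "a t = 0")
      case False
      have "l t * y0 \<le> l t * y" using l[OF t False] y by (intro mult_left_mono) auto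
      then show ?thesis
        by (simp add: norm_mult norm_exp_eq_Re mult_left_mono)
    qed simp
  qed (use g in auto)
  show "(g \<longlongrightarrow> infsum a ?S0) at_top"
  proof (rule swap_uniform_limit'[OF _ _ ul])
    show "\<forall>\<^sub>F F in finite_subsets_at_top S.
        ((\<lambda>y. \<Sum>t\<in>F. a t * exp (- of_real (l t * y))) \<longlongrightarrow> sum ?b F) at_top"
    proof (rule eventually_finite_subsets_at_top_weakI, rule tendsto_sum)
      fix F t assume "finite F" "F \<subseteq> S" "t \<in> F"
      then have t: "t \<in> S" by auto
      show "((\<lambda>y. a t * exp (- of_real (l t * y))) \<longlongrightarrow> ?b t) at_top"
      proof (cases "a t = 0 \<or> l t = 0")
        case True
        then show ?thesis by (cases "a t = 0") auto
      next
        case False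
        then have lt: "l t > 0" using l[OF t] by force
        have "((\<lambda>y. exp (- (l t * y))) \<longlongrightarrow> 0) at_top"
          by (intro filterlim_compose[OF exp_at_bot] filterlim_compose[OF filterlim_uminus_at_bot_at_top]
              filterlim_tendsto_pos_mult_at_top[OF tendsto_const lt] filterlim_ident)
        then have "((\<lambda>y. a t * of_real (exp (- (l t * y)))) \<longlongrightarrow> a t * of_real 0) at_top"
          by (intro tendsto_intros)
        moreover have "exp (- complex_of_real (l t * y)) = of_real (exp (- (l t * y)))" for y
          by (simp flip: exp_of_real)
        ultimately show ?thesis using False by simp
      qed
    qed
    show "(sum ?b \<longlongrightarrow> infsum a ?S0) (finite_subsets_at_top S)"
      using b by (simp add: has_sum_def)
    show "\<forall>\<^sub>F y in at_top. y \<in> {y0..}"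
      by (simp add: eventually_ge_at_top)
  qed simp
qed

section \<open>Arithmetic of the quadratic field\<close>

definition rt :: "nat \<Rightarrow> complex" where
  "rt m = csqrt (- of_nat m)"

lemma rt_eq: "rt m = \<i> * of_real (sqrt (of_nat m))"
  using csqrt_of_real_nonpos[of "- real m"] by (simp add: rt_def)

lemma rt_simps:
  "rt m * rt m = - of_nat m" "rt m * (rt m * z) = - of_nat m * z"
  "cnj (rt m) = - rt m" "Re (rt m) = 0" "Im (rt m) = sqrt (of_nat m)"
proof -
  show 1: "rt m * rt m = - of_nat m"
    unfolding rt_def using power2_csqrt[of "- of_nat m"] by (simp only: power2_eq_square)
  show "rt m * (rt m * z) = - of_nat m * z"
    unfolding mult.assoc[symmetric] 1 ..
qed (simp_all add: rt_eq)

lemma of_real_of_rat_complex: "complex_of_real (of_rat a) = of_rat a"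
proof -
  obtain p q where "quotient_of a = (p, q)" by fastforce
  then have "a = of_int p / of_int q" "q > 0"
    using quotient_of_div quotient_of_denom_pos by auto
  then show ?thesis by (simp add: of_rat_divide)
qed

lemma complex_of_rat_simps [simp]:
  "cnj (of_rat a) = of_rat a" "Re (of_rat a) = of_rat a" "Im (of_rat a) = 0"
  by (simp_all flip: of_real_of_rat_complex)

lemma quad_fieldI: "of_rat a + of_rat b * rt m \<in> quad_field m"
  unfolding quad_field_def rt_def by blast

lemma quad_fieldE:
  assumes "x \<in> quad_field m"
  obtains a b where "x = of_rat a + of_rat b * rt m"
  using assms unfolding quad_field_def rt_def by blast

lemma of_rat_in_quad_field [simp, intro]: "of_rat a \<in> quad_field m"
  using quad_fieldI[of a 0 m] by simp

lemma of_int_in_quad_field [simp, intro]: "of_int a \<in> quad_field m"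
  using of_rat_in_quad_field[of "of_int a" m] by simp

lemma rt_in_quad_field [simp, intro]: "rt m \<in> quad_field m"
  using quad_fieldI[of 0 1 m] by simp

lemma zero_one_in_quad_field [simp, intro]: "0 \<in> quad_field m" "1 \<in> quad_field m"
  using of_int_in_quad_field[of 0 m] of_int_in_quad_field[of 1 m] by simp_all

lemma quad_field_add [intro]:
  assumes "x \<in> quad_field m" "y \<in> quad_field m" shows "x + y \<in> quad_field m"
proof -
  obtain a b c d where "x = of_rat a + of_rat b * rt m"
    "y = of_rat c + of_rat d * rt m" using assms by (meson quad_fieldE)
  then have "x + y = of_rat (a + c) + of_rat (b + d) * rt m"
    by (simp add: of_rat_add algebra_simps)
  then show ?thesis using quad_fieldI by metis
qed

lemma quad_field_mult [intro]:
  assumes "x \<in> quad_field m" "y \<in> quad_field m" shows "x * y \<in> quad_field m"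
proof -
  obtain a b c d where "x = of_rat a + of_rat b * rt m"
    "y = of_rat c + of_rat d * rt m" using assms by (meson quad_fieldE)
  then have "x * y = of_rat (a * c - of_nat m * b * d) + of_rat (a * d + b * c) * rt m"
    by (simp add: of_rat_add of_rat_mult of_rat_diff algebra_simps rt_simps)
  then show ?thesis using quad_fieldI by metis
qed

lemma quad_field_minus [intro]: "x \<in> quad_field m \<Longrightarrow> - x \<in> quad_field m"
  using quad_field_mult[OF of_int_in_quad_field[of "-1" m], of x] by simp

lemma quad_field_diff [intro]: "x \<in> quad_field m \<Longrightarrow> y \<in> quad_field m \<Longrightarrow> x - y \<in> quad_field m"
  using quad_field_add[of x m "- y"] quad_field_minus by simp

lemma quad_field_cnj [intro]:
  assumes "x \<in> quad_field m" shows "cnj x \<in> quad_field m"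
proof -
  obtain a b where x: "x = of_rat a + of_rat b * rt m"
    using assms by (meson quad_fieldE)
  have "cnj x = of_rat a + of_rat (- b) * rt m"
    by (simp add: x rt_simps of_rat_minus)
  then show ?thesis using quad_fieldI by metis
qed

lemma quad_field_trace_norm_Rats:
  assumes "x \<in> quad_field m"
  obtains t n where "x + cnj x = of_rat t" "x * cnj x = of_rat n"
proof -
  obtain a b where x: "x = of_rat a + of_rat b * rt m"
    using assms by (meson quad_fieldE)
  have "x + cnj x = of_rat (2 * a)"
    by (simp add: x rt_simps of_rat_mult)
  moreover have "x * cnj x = of_rat (a * a + of_nat m * b * b)"
    by (simp add: x rt_simps of_rat_mult of_rat_add algebra_simps)
  ultimately show ?thesis using that by blast
qed

lemma quad_field_inverse [intro]:
  assumes "x \<in> quad_field m" shows "inverse x \<in> quad_field m"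
proof (cases "x = 0")
  case False
  obtain n where n: "x * cnj x = of_rat n" using quad_field_trace_norm_Rats[OF assms] by metis
  have "x * cnj x \<noteq> 0" using False by simp
  then have "inverse x = cnj x * of_rat (inverse n)"
    using False by (simp add: of_rat_inverse flip: n)
  then show ?thesis using assms by (metis of_rat_in_quad_field quad_field_cnj quad_field_mult)
qed simp

lemma quad_field_divide [intro]: "x \<in> quad_field m \<Longrightarrow> y \<in> quad_field m \<Longrightarrow> x / y \<in> quad_field m"
  unfolding divide_inverse by blast

lemma quad_field_dense:
  assumes m: "m > 0" and e: "e > 0"
  obtains q where "q \<in> quad_field m" "norm (z - q) < e"
proof -
  have s: "sqrt (of_nat m) > 0" using m by simp
  obtain a where a: "Re z - e / 2 < of_rat a" "of_rat a < Re z + e / 2"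
    using of_rat_dense[of "Re z - e / 2" "Re z + e / 2"] e by auto
  have "(Im z - e / 2) / sqrt (of_nat m) < (Im z + e / 2) / sqrt (of_nat m)"
    using s e by (simp add: divide_strict_right_mono)
  then obtain b where b: "(Im z - e / 2) / sqrt (of_nat m) < of_rat b" "of_rat b < (Im z + e / 2) / sqrt (of_nat m)"
    using of_rat_dense by blast
  define q where "q = of_rat a + of_rat b * rt m"
  have "Re q = of_rat a" "Im q = of_rat b * sqrt (of_nat m)"
    by (simp_all add: q_def rt_simps)
  moreover have "Im z - e / 2 < of_rat b * sqrt (of_nat m)" "of_rat b * sqrt (of_nat m) < Im z + e / 2"
    using b s by (simp_all add: field_simps)
  ultimately have "\<bar>Re z - Re q\<bar> < e / 2" "\<bar>Im z - Im q\<bar> < e / 2"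
    using a by linarith+
  then have "\<bar>Re (z - q)\<bar> < e / 2" "\<bar>Im (z - q)\<bar> < e / 2" by simp_all
  then have "norm (z - q) < e" using cmod_le[of "z - q"] by linarith
  then show ?thesis using that[of q] quad_fieldI by (simp add: q_def)
qed

text \<open>A \<open>\<rat>\<close>-linear coordinate function \<open>p\<close> on the complex numbers yields the \<open>K\<close>-linear map
  \<open>\<lambda>z. p (s z) + s p z\<close> with \<open>s = sqrt (- m)\<close>.\<close>

lemma quad_field_linear_functional:
  fixes v :: complex
  assumes m: "m > 0" and v: "v \<noteq> 0"
  obtains \<phi> :: "complex \<Rightarrow> complex" where "\<And>z. \<phi> z \<in> quad_field m" "\<And>z w. \<phi> (z + w) = \<phi> z + \<phi> w"
    "\<And>k z. k \<in> quad_field m \<Longrightarrow> \<phi> (k * z) = k * \<phi> z" "\<phi> v \<noteq> 0"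
proof -
  interpret Q: vector_space "\<lambda>(q::rat) (z::complex). of_rat q * z"
    by standard (simp_all add: algebra_simps of_rat_add of_rat_mult)
  have "Q.independent {v}" using v by (simp add: Q.dependent_single)
  define B where "B = Q.extend_basis {v}"
  have B: "Q.independent B" "Q.span B = UNIV" "v \<in> B"
    using Q.independent_extend_basis[OF \<open>Q.independent {v}\<close>] Q.span_extend_basis[OF \<open>Q.independent {v}\<close>]
      Q.extend_basis_superset[OF \<open>Q.independent {v}\<close>] by (auto simp: B_def)
  define p where "p z = Q.representation B z v" for z
  have p_add: "p (z + w) = p z + p w" for z w
    unfolding p_def using B Q.representation_add[OF B(1), of w z] by (simp add: add.commute)
  have p_scale: "p (of_rat q * z) = q * p z" for q z
    unfolding p_def using B Q.representation_scale[OF B(1), of z q] by simp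
  have p_v: "p v = 1" unfolding p_def using Q.representation_basis[OF B(1,3)] by simp
  let ?s = "rt m"
  define \<phi> where "\<phi> z = of_rat (p (?s * z)) + of_rat (p z) * ?s" for z
  have add: "\<phi> (z + w) = \<phi> z + \<phi> w" for z w
    by (simp add: \<phi>_def p_add of_rat_add algebra_simps)
  have scale: "\<phi> (of_rat q * z) = of_rat q * \<phi> z" for q z
    using p_scale[of q "?s * z"] p_scale[of q z] by (simp add: \<phi>_def of_rat_mult algebra_simps)
  have s: "\<phi> (?s * z) = ?s * \<phi> z" for z
  proof -
    have "p (- of_nat m * z) = - of_nat m * p z"
      using p_scale[of "- of_nat m" z] by (simp add: of_rat_minus)
    then show ?thesis
      by (simp add: \<phi>_def rt_simps of_rat_minus of_rat_mult algebra_simps)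
  qed
  show ?thesis
  proof
    show "\<phi> z \<in> quad_field m" for z unfolding \<phi>_def by (rule quad_fieldI)
    show "\<phi> (k * z) = k * \<phi> z" if "k \<in> quad_field m" for k z
    proof -
      obtain a b where k: "k = of_rat a + of_rat b * ?s" using \<open>k \<in> quad_field m\<close> by (rule quad_fieldE)
      have "\<phi> (k * z) = \<phi> (of_rat a * z) + \<phi> (of_rat b * (?s * z))"
        by (simp add: k add[symmetric] algebra_simps)
      also have "\<dots> = k * \<phi> z"
        unfolding scale s by (simp add: k algebra_simps)
      finally show ?thesis .
    qed
    \<comment> \<open>The coefficient of \<open>rt m\<close> in \<open>\<phi> v\<close> is the
      coordinate \<open>p v = 1\<close>.\<close>
    have "Im (\<phi> v) = sqrt (of_nat m)"
      by (simp add: \<phi>_def p_v rt_simps)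
    then show "\<phi> v \<noteq> 0" using m by auto
  qed (rule add)
qed

text \<open>If \<open>b\<close> is the reduced denominator of \<open>q\<close>, every power of
  \<open>b\<close> divides \<open>d\<close>. Already the exponent \<open>d\<close> is too large
  unless \<open>b = 1\<close>, because \<open>2 ^ d > d\<close>.\<close>

lemma Rats_bounded_denominator_power_imp_int:
  fixes q :: rat and d :: int
  assumes d: "d > 0" and *: "\<And>k. of_int d * q ^ k \<in> \<int>"
  shows "q \<in> \<int>"
proof -
  obtain a b where ab: "quotient_of q = (a, b)" by fastforce
  then have b: "b > 0" and cop: "coprime a b" and q: "q = of_int a / of_int b"
    using quotient_of_denom_pos quotient_of_coprime quotient_of_div by auto
  have dvd: "b ^ k dvd d" for k
  proof -
    obtain z where "of_int d * q ^ k = of_int z" using *[of k] Ints_cases by blast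
    then have "of_int (d * a ^ k) = (of_int (z * b ^ k) :: rat)"
      using b by (simp add: q power_divide field_simps)
    then have "d * a ^ k = z * b ^ k" by (simp only: of_int_eq_iff)
    then have "b ^ k dvd d * a ^ k" by simp
    then show ?thesis
      using cop by (metis coprime_commute coprime_dvd_mult_left_iff coprime_power_left_iff coprime_power_right_iff)
  qed
  have "b = 1"
  proof (rule ccontr)
    assume "b \<noteq> 1"
    then have "b \<ge> 2" using b by simp
    then have "2 ^ nat d \<le> b ^ nat d" by (intro power_mono) auto
    moreover have "b ^ nat d \<le> d" using dvd[of "nat d"] d by (rule zdvd_imp_le)
    moreover have "int (nat d) < 2 ^ nat d"
      by (metis of_nat_less_two_power)
    ultimately show False using d by simp
  qed
  then show ?thesis by (simp add: q)
qed

text \<open>Taking norms turns a common denominator \<open>d\<close> of the powers of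
  \<open>x\<close> into the denominator \<open>d * d\<close> of the powers of the rational number
  \<open>x * cnj x\<close>.\<close>

lemma bounded_denominators_imp_norm_int:
  assumes x: "x \<in> quad_field m" and d: "d > (0::int)"
    and *: "\<And>k. \<exists>a b. of_int d * x ^ k = of_int a + of_int b * rt m"
  shows "x * cnj x \<in> \<int>"
proof -
  obtain n where n: "x * cnj x = of_rat n" using quad_field_trace_norm_Rats[OF x] by metis
  have "n \<in> \<int>"
  proof (rule Rats_bounded_denominator_power_imp_int)
    show "d * d > 0" using d by simp
    fix k
    obtain a b where ab: "of_int d * x ^ k = of_int a + of_int b * rt m" using * by blast
    have "(of_rat (of_int (d * d) * n ^ k) :: complex) = (of_int d * x ^ k) * cnj (of_int d * x ^ k)"
      by (simp add: of_rat_mult of_rat_power power_mult_distrib flip: n)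
    also have "\<dots> = of_rat (of_int (a * a + of_nat m * b * b))"
      unfolding ab by (simp add: rt_simps of_rat_add of_rat_mult algebra_simps)
    finally have "of_int (d * d) * n ^ k = of_int (a * a + of_nat m * b * b)"
      by (simp only: of_rat_eq_iff)
    then show "of_int (d * d) * n ^ k \<in> \<int>" by simp
  qed
  then obtain z where "n = of_int z" by (rule Ints_cases)
  then show ?thesis by (simp add: n)
qed

text \<open>A monic integral equation bounds the denominators of all powers of \<open>x\<close>,
  which settles the norm. By the binomial theorem the same denominator serves \<open>x + 1\<close>,
  and the trace is the norm of \<open>x + 1\<close> minus the norm of \<open>x\<close> minus
  1.\<close>

lemma ring_ints_trace_norm:
  assumes "x \<in> ring_ints m"
  shows "x + cnj x \<in> \<int>" "x * cnj x \<in> \<int>"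
proof -
  let ?s = "rt m"
  define R where "R = {of_int a + of_int b * ?s | a b :: int. True}"
  have RI: "of_int a + of_int b * ?s \<in> R" for a b unfolding R_def by blast
  have R_add: "y + z \<in> R" if yz: "y \<in> R" "z \<in> R" for y z
  proof -
    obtain a b c d where "y = of_int a + of_int b * ?s" "z = of_int c + of_int d * ?s"
      using yz unfolding R_def by blast
    then have "y + z = of_int (a + c) + of_int (b + d) * ?s" by (simp add: algebra_simps)
    then show ?thesis using RI by metis
  qed
  have R_mult: "y * z \<in> R" if yz: "y \<in> R" "z \<in> R" for y z
  proof -
    obtain a b c d where "y = of_int a + of_int b * ?s" "z = of_int c + of_int d * ?s"
      using yz unfolding R_def by blast
    then have "y * z = of_int (a * c - of_nat m * b * d) + of_int (a * d + b * c) * ?s"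
      by (simp add: algebra_simps rt_simps)
    then show ?thesis using RI by metis
  qed
  have R_int: "of_int a \<in> R" for a using RI[of a 0] by simp
  have R_sum: "sum g A \<in> R" if "\<And>i. i \<in> A \<Longrightarrow> g i \<in> R" for g and A :: "nat set"
    using that by (induction A rule: infinite_finite_induct) (use R_int[of 0] R_add in auto)
  have R_power: "y ^ k \<in> R" if "y \<in> R" for y k
    by (induction k) (use R_int[of 1] R_mult that in auto)
  have xK: "x \<in> quad_field m" and alg: "algebraic_int x"
    using assms by (auto simp: ring_ints_def)
  obtain a b where ab: "x = of_rat a + of_rat b * ?s" using xK by (rule quad_fieldE)
  obtain a1 a2 where a: "quotient_of a = (a1, a2)" by fastforce
  obtain b1 b2 where b: "quotient_of b = (b1, b2)" by fastforce
  have pos: "a2 > 0" "b2 > 0" using a b quotient_of_denom_pos by auto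
  define d0 where "d0 = a2 * b2"
  have d0: "d0 > 0" using pos by (simp add: d0_def)
  have qab: "(of_rat a :: complex) = of_int a1 / of_int a2" "(of_rat b :: complex) = of_int b1 / of_int b2"
    by (simp_all add: quotient_of_div[OF a] quotient_of_div[OF b] of_rat_divide)
  have "of_int d0 * x = of_int (a1 * b2) + of_int (b1 * a2) * ?s"
    unfolding ab qab d0_def using pos by (simp add: field_simps)
  then have d0x: "of_int d0 * x \<in> R" using RI by metis
  obtain p where p: "lead_coeff p = 1" "\<And>i. coeff p i \<in> \<int>" "poly p x = 0"
    using alg by (auto elim: algebraic_int.cases)
  define D where "D = degree p"
  have xD: "x ^ D = - (\<Sum>i<D. coeff p i * x ^ i)"
  proof -
    have "(\<Sum>i\<le>D. coeff p i * x ^ i) = 0" using p(3) by (simp add: poly_altdef D_def)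
    moreover have "(\<Sum>i\<le>D. coeff p i * x ^ i) = (\<Sum>i<D. coeff p i * x ^ i) + coeff p D * x ^ D"
      by (simp add: lessThan_Suc_atMost[symmetric])
    ultimately show ?thesis using p(1) by (simp add: D_def eq_neg_iff_add_eq_0 add.commute)
  qed
  \<comment> \<open>This clears the powers below the degree \<open>D\<close>; the equation reduces
    each higher power to smaller ones.\<close>
  define d where "d = d0 ^ D"
  have d: "d > 0" using d0 by (simp add: d_def)
  have dx: "of_int d * x ^ k \<in> R" for k
  proof (induction k rule: less_induct)
    case (less k)
    show ?case
    proof (cases "k < D")
      case True
      then have "of_int d * x ^ k = of_int (d0 ^ (D - k)) * (of_int d0 * x) ^ k"
        by (simp add: d_def power_mult_distrib mult.assoc[symmetric] flip: power_add)
      then show ?thesis using R_mult R_int R_power d0x by metis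
    next
      case False
      have "of_int d * x ^ k = of_int d * x ^ (k - D) * x ^ D"
        using False by (simp add: mult.assoc flip: power_add)
      also have "\<dots> = (\<Sum>i<D. - coeff p i * (of_int d * x ^ (k - D + i)))"
        unfolding xD by (simp add: sum_distrib_left sum_negf power_add mult_ac)
      also have "\<dots> \<in> R"
      proof (rule R_sum)
        fix i assume "i \<in> {..<D}"
        then have "of_int d * x ^ (k - D + i) \<in> R" using less False by auto
        moreover have "- coeff p i \<in> R"
          using p(2)[of i] R_int by (metis Ints_cases of_int_minus)
        ultimately show "- coeff p i * (of_int d * x ^ (k - D + i)) \<in> R" by (rule R_mult[rotated])
      qed
      finally show ?thesis .
    qed
  qed
  show N: "x * cnj x \<in> \<int>"
    using dx by (intro bounded_denominators_imp_norm_int[OF xK d]) (auto simp: R_def)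
  have "of_int d * (x + 1) ^ k \<in> R" for k
  proof -
    have "of_int d * (x + 1) ^ k = (\<Sum>i\<le>k. of_int (int (k choose i)) * (of_int d * x ^ i))"
      by (simp add: binomial_ring sum_distrib_left mult_ac)
    also have "\<dots> \<in> R" by (intro R_sum R_mult R_int dx)
    finally show ?thesis .
  qed
  then have "(x + 1) * cnj (x + 1) \<in> \<int>"
    using xK by (intro bounded_denominators_imp_norm_int[OF _ d]) (auto simp: R_def)
  then have "(x + 1) * cnj (x + 1) - x * cnj x - 1 \<in> \<int>"
    using N by (intro Ints_diff) auto
  then show "x + cnj x \<in> \<int>" by (simp add: algebra_simps)
qed

lemma ring_intsI:
  assumes "x \<in> quad_field m" "x + cnj x \<in> \<int>" "x * cnj x \<in> \<int>"
  shows "x \<in> ring_ints m"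
proof -
  have "algebraic_int x"
  proof (rule algebraic_int.intros)
    show "lead_coeff [:x * cnj x, - (x + cnj x), 1:] = 1" by simp
    show "\<forall>i. coeff [:x * cnj x, - (x + cnj x), 1:] i \<in> \<int>"
      using assms(2,3) Ints_minus[OF assms(2)] by (auto simp: coeff_pCons split: nat.splits)
    show "poly [:x * cnj x, - (x + cnj x), 1:] x = 0" by (simp add: algebra_simps)
  qed
  then show ?thesis using assms by (simp add: ring_ints_def)
qed


section \<open>Integral basis of the ring of integers\<close>

definition om :: "nat \<Rightarrow> complex" where
  "om m = (if m mod 4 = 3 then (1 + rt m) / 2 else rt m)"

lemma om_in_quad_field [simp, intro]: "om m \<in> quad_field m"
proof -
  have "(1 + rt m) / of_int 2 \<in> quad_field m"
    by (intro quad_field_divide quad_field_add of_int_in_quad_field) auto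
  then show ?thesis by (simp add: om_def)
qed

text \<open>The link between the basis \<open>1\<close>, \<open>om m\<close> and the Fourier
  indices: the determinant of the system for the two basis coordinates is the square root in the
  denominators of those indices.\<close>

lemma om_diff_cnj: "om m - cnj (om m) = csqrt (of_int (quad_disc m))"
proof (cases "m mod 4 = 3")
  case True
  then have "om m - cnj (om m) = rt m" by (simp add: om_def rt_simps field_simps)
  then show ?thesis using True by (simp add: rt_def quad_disc_def)
next
  case False
  then have "om m - cnj (om m) = 2 * rt m" by (simp add: om_def rt_simps)
  moreover have "csqrt (of_real (- (4 * real m))) = \<i> * of_real (sqrt \<bar>- (4 * real m)\<bar>)"
    using csqrt_of_real_nonpos[of "of_real (- (4 * real m))"] by simp
  ultimately show ?thesis using False by (simp add: rt_eq quad_disc_def real_sqrt_mult)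
qed

lemma om_nonreal:
  assumes "m > 0" shows "Im (om m) \<noteq> 0" "csqrt (of_int (quad_disc m)) \<noteq> 0"
proof -
  show 1: "Im (om m) \<noteq> 0" using assms by (simp add: om_def rt_simps)
  then show "csqrt (of_int (quad_disc m)) \<noteq> 0"
    unfolding om_diff_cnj[symmetric] by (auto simp: complex_eq_iff)
qed

lemma cnj_csqrt_disc: "cnj (csqrt (of_int (quad_disc m))) = - csqrt (of_int (quad_disc m))"
  unfolding om_diff_cnj[symmetric] by simp

text \<open>The division by 4 is exact, as \<open>m mod 4 = 3\<close> in that branch.\<close>

definition om_norm :: "nat \<Rightarrow> int" where
  "om_norm m = (if m mod 4 = 3 then (1 + int m) div 4 else int m)"

definition om_trace :: "nat \<Rightarrow> int" where
  "om_trace m = (if m mod 4 = 3 then 1 else 0)"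

lemma om_cnj: "cnj (om m) = of_int (om_trace m) - om m"
  by (simp add: om_def om_trace_def rt_simps field_simps)

lemma om_mult_self: "om m * om m = of_int (om_trace m) * om m - of_int (om_norm m)"
proof (cases "m mod 4 = 3")
  case True
  have "4 * ((1 + int m) div 4) = 1 + int m" using True by presburger
  then have "complex_of_int (4 * ((1 + int m) div 4)) = of_int (1 + int m)" by (rule arg_cong)
  then have n: "4 * of_int (om_norm m) = (1 + of_nat m :: complex)"
    using True by (simp add: om_norm_def)
  have "4 * (om m * om m) = 1 + 2 * rt m - of_nat m"
  proof -
    have "2 * om m = 1 + rt m" using True by (simp add: om_def)
    then have "(2 * om m) * (2 * om m) = (1 + rt m) * (1 + rt m)" by simp
    then show ?thesis by (simp add: rt_simps algebra_simps)
  qed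
  moreover have "4 * (of_int (om_trace m) * om m - of_int (om_norm m)) = 2 + 2 * rt m - 4 * of_int (om_norm m)"
    using True by (simp add: om_def om_trace_def algebra_simps)
  ultimately have "4 * (om m * om m) = 4 * (of_int (om_trace m) * om m - of_int (om_norm m))"
    unfolding n by simp
  then show ?thesis by (metis mult_cancel_left zero_neq_numeral)
qed (simp add: om_def om_norm_def om_trace_def rt_simps)

lemma ring_ints_of_basis [simp, intro]: "of_int a + of_int b * om m \<in> ring_ints m"
proof (rule ring_intsI)
  let ?x = "of_int a + of_int b * om m"
  show "?x \<in> quad_field m" by (intro quad_field_add quad_field_mult) auto
  have "?x + cnj ?x = of_int (2 * a + b * om_trace m)" by (simp add: om_cnj algebra_simps)
  then show "?x + cnj ?x \<in> \<int>" by (metis Ints_of_int)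
  have "?x * cnj ?x = of_int (a * a + a * b * om_trace m) + of_int (b * b * om_trace m) * om m - of_int (b * b) * (om m * om m)"
    by (simp add: om_cnj algebra_simps)
  also have "\<dots> = of_int (a * a + a * b * om_trace m + b * b * om_norm m)"
    unfolding om_mult_self by (simp add: algebra_simps)
  finally show "?x * cnj ?x \<in> \<int>" by (metis Ints_of_int)
qed

text \<open>Twice \<open>x\<close> is \<open>t + c * rt m\<close> with \<open>t\<close> the trace.
  The square of the denominator of \<open>c\<close> divides \<open>m\<close>, so squarefreeness
  makes \<open>c\<close> an integer. Integrality of the norm says that 4 divides
  \<open>t\<^sup>2 + m * c\<^sup>2\<close>, and the residue of \<open>m\<close> then decides whether
  \<open>t\<close> and \<open>c\<close> have equal parity or are both even.\<close>

lemma ring_ints_basisE: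
  assumes m: "squarefree m" and x: "x \<in> ring_ints m"
  obtains a b :: int where "x = of_int a + of_int b * om m"
proof -
  have m0: "m > 0" using m by (metis not_squarefree_0 gr0I)
  obtain p q where pq: "x = of_rat p + of_rat q * rt m"
    using x by (auto simp: ring_ints_def elim: quad_fieldE)
  obtain t where "x + cnj x = of_int t"
    using ring_ints_trace_norm(1)[OF x] by (rule Ints_cases)
  then have "of_rat (2 * p) = (of_rat (of_int t) :: complex)"
    by (simp add: pq rt_simps of_rat_mult)
  then have t: "2 * p = of_int t" by (simp only: of_rat_eq_iff)
  obtain n where "x * cnj x = of_int n"
    using ring_ints_trace_norm(2)[OF x] by (rule Ints_cases)
  then have "of_rat (p * p + of_nat m * (q * q)) = (of_rat (of_int n) :: complex)"
    by (simp add: pq rt_simps of_rat_mult of_rat_add algebra_simps)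
  then have n: "p * p + of_nat m * (q * q) = of_int n" by (simp only: of_rat_eq_iff)
  obtain c d where cd: "quotient_of (2 * q) = (c, d)" by fastforce
  then have d: "d > 0" and cop: "coprime c d" and q: "2 * q = of_int c / of_int d"
    using quotient_of_denom_pos quotient_of_coprime quotient_of_div by auto
  have "of_int t * of_int t + of_nat m * (of_int c / of_int d) * (of_int c / of_int d) = (4 * of_int n :: rat)"
    using n unfolding t[symmetric] q[symmetric] by (simp add: algebra_simps)
  then have "of_int (t * t * (d * d) + int m * c * c) = (of_int (4 * n * (d * d)) :: rat)"
    using d by (simp add: field_simps)
  then have eq: "t * t * (d * d) + int m * c * c = 4 * n * (d * d)"
    by (simp only: of_int_eq_iff)
  then have "int m * (c * c) = (4 * n - t * t) * (d * d)" by (simp add: algebra_simps)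
  then have "d * d dvd int m * (c * c)" by simp
  moreover have "coprime (d * d) (c * c)" using cop by (simp add: coprime_commute)
  ultimately have "d * d dvd int m" by (simp add: coprime_dvd_mult_left_iff)
  then have "nat d * nat d dvd m"
    using d by (metis int_dvd_int_iff int_nat_eq less_imp_le of_nat_mult)
  then have "(nat d)\<^sup>2 dvd m" by (simp only: power2_eq_square)
  then have "nat d dvd 1" using m unfolding squarefree_def by blast
  then have d1: "d = 1" using d by simp
  have eq': "t * t + int m * (c * c) = 4 * n" using eq d1 by simp
  have q': "2 * q = of_int c" using q d1 by simp
  have nm4: "m mod 4 \<noteq> 0"
  proof
    assume "m mod 4 = 0"
    then have "2\<^sup>2 dvd m" by (simp add: dvd_eq_mod_eq_0)
    then have "(2::nat) dvd 1" using m unfolding squarefree_def by blast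
    then show False by simp
  qed
  have x2: "2 * x = of_int t + of_int c * rt m"
  proof -
    have "2 * x = of_rat (2 * p) + of_rat (2 * q) * rt m" by (simp add: pq of_rat_mult algebra_simps)
    then show ?thesis by (simp only: t q' of_rat_of_int_eq)
  qed
  have mod_eq: "(t * t + int m * (c * c)) mod 4 = 0" unfolding eq' by simp
  have sq: "(t * t) mod 4 = (if even t then 0 else 1)" for t :: int
  proof (cases "even t")
    case True
    then obtain s where "t = 2 * s" by blast
    then show ?thesis by simp
  next
    case False
    then obtain s where "t = 2 * s + 1" by (blast elim: oddE)
    then have "t * t = 4 * (s * s + s) + 1" by (simp add: algebra_simps)
    then show ?thesis using False by presburger
  qed
  \<comment> \<open>Squares are 0 or 1 modulo 4 and \<open>m\<close> has residue at most 3, so this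
    multiple of 4 does not exceed 4.\<close>
  have tc: "(t * t) mod 4 + (int m mod 4) * ((c * c) mod 4) = 0 \<or>
      (t * t) mod 4 + (int m mod 4) * ((c * c) mod 4) = 4"
  proof -
    have "((t * t) mod 4 + (int m mod 4) * ((c * c) mod 4)) mod 4 = 0"
      using mod_eq by (metis (no_types) mod_add_left_eq mod_add_right_eq mod_mult_left_eq mod_mult_right_eq)
    moreover have "int m mod 4 = 1 \<or> int m mod 4 = 2 \<or> int m mod 4 = 3" using nm4 by presburger
    ultimately show ?thesis unfolding sq by (auto split: if_splits)
  qed
  have m4: "int m mod 4 = 1 \<or> int m mod 4 = 2 \<or> int m mod 4 = 3" using nm4 by presburger
  show ?thesis
  proof (cases "m mod 4 = 3")
    case True
    then have "int m mod 4 = 3" by presburger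
    then have "even t = even c" using tc unfolding sq by (auto split: if_splits)
    then have "even (t - c)" by simp
    then obtain a where a: "t - c = 2 * a" by (rule evenE)
    have "2 * x = 2 * (of_int a + of_int c * om m)"
    proof -
      have "of_int (t - c) = (of_int (2 * a) :: complex)" using a by simp
      then show ?thesis unfolding x2 using True by (simp add: om_def algebra_simps)
    qed
    then have "x = of_int a + of_int c * om m" by (metis mult_cancel_left zero_neq_numeral)
    then show ?thesis by (rule that)
  next
    case False
    then have "int m mod 4 \<noteq> 3" by presburger
    then have "int m mod 4 = 1 \<or> int m mod 4 = 2" using m4 by blast
    then have "even t \<and> even c" using tc unfolding sq by (auto split: if_splits)
    then obtain a b where "t = 2 * a" "c = 2 * b" by blast
    then have "2 * x = 2 * (of_int a + of_int b * om m)"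
      unfolding x2 using False by (simp add: om_def)
    then have "x = of_int a + of_int b * om m" by (metis mult_cancel_left zero_neq_numeral)
    then show ?thesis by (rule that)
  qed
qed

lemma ring_ints_of_int [simp, intro]: "of_int a \<in> ring_ints m"
  using ring_ints_of_basis[of a 0 m] by simp

lemma ring_ints_0_1 [simp, intro]: "0 \<in> ring_ints m" "1 \<in> ring_ints m"
  using ring_ints_of_int[of 0 m] ring_ints_of_int[of 1 m] by simp_all

lemma om_in_ring_ints [simp, intro]: "om m \<in> ring_ints m"
  using ring_ints_of_basis[of 0 1 m] by simp

lemma ring_ints_subset_quad_field: "x \<in> ring_ints m \<Longrightarrow> x \<in> quad_field m"
  by (simp add: ring_ints_def)

lemma ring_ints_cnj [intro]: "x \<in> ring_ints m \<Longrightarrow> cnj x \<in> ring_ints m"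
  by (auto simp: ring_ints_def)

section \<open>Ring operations, units and denominators\<close>

context
  fixes m :: nat
  assumes m: "squarefree m"
begin

lemma ring_ints_add [intro]:
  assumes "x \<in> ring_ints m" "y \<in> ring_ints m" shows "x + y \<in> ring_ints m"
proof -
  obtain a b c d where "x = of_int a + of_int b * om m" "y = of_int c + of_int d * om m"
    using assms ring_ints_basisE[OF m] by metis
  then have "x + y = of_int (a + c) + of_int (b + d) * om m" by (simp add: algebra_simps)
  then show ?thesis by (metis ring_ints_of_basis)
qed

lemma ring_ints_mult [intro]:
  assumes "x \<in> ring_ints m" "y \<in> ring_ints m" shows "x * y \<in> ring_ints m"
proof -
  obtain a b c d where xy: "x = of_int a + of_int b * om m" "y = of_int c + of_int d * om m"
    using assms ring_ints_basisE[OF m] by metis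
  have "x * y = of_int (a * c) + of_int (a * d + b * c) * om m + of_int (b * d) * (om m * om m)"
    unfolding xy by (simp add: algebra_simps)
  also have "\<dots> = of_int (a * c - b * d * om_norm m) + of_int (a * d + b * c + b * d * om_trace m) * om m"
    unfolding om_mult_self by (simp add: algebra_simps)
  finally show ?thesis by (metis ring_ints_of_basis)
qed

lemma ring_ints_minus [intro]: "x \<in> ring_ints m \<Longrightarrow> - x \<in> ring_ints m"
  using ring_ints_mult[OF ring_ints_of_int[of "-1" m], of x] by simp

lemma ring_ints_diff [intro]: "x \<in> ring_ints m \<Longrightarrow> y \<in> ring_ints m \<Longrightarrow> x - y \<in> ring_ints m"
  using ring_ints_add[of x "- y"] ring_ints_minus by simp

lemma ring_ints_sum [intro]: "(\<And>i. i \<in> A \<Longrightarrow> g i \<in> ring_ints m) \<Longrightarrow> sum g A \<in> ring_ints m"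
  by (induction A rule: infinite_finite_induct) auto

lemma ring_ints_prod [intro]: "(\<And>i. i \<in> A \<Longrightarrow> g i \<in> ring_ints m) \<Longrightarrow> prod g A \<in> ring_ints m"
  by (induction A rule: infinite_finite_induct) auto

text \<open>A nonzero integer of the field has a positive rational integer as square of its absolute
  value, hence absolute value at least 1; this applies to \<open>x\<close> and to its inverse
  \<open>y\<close>. It makes the automorphy factors of unimodular matrices have absolute value
  1.\<close>

lemma ring_ints_unit_norm:
  assumes "x \<in> ring_ints m" "y \<in> ring_ints m" "x * y = 1"
  shows "norm x = 1"
proof -
  have ge: "norm z \<ge> 1" if z: "z \<in> ring_ints m" "z \<noteq> 0" for z
  proof -
    obtain n where n: "z * cnj z = of_int n"
      using ring_ints_trace_norm(2)[OF z(1)] by (rule Ints_cases)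
    then have "complex_of_real ((norm z)\<^sup>2) = of_real (of_int n)"
      using complex_norm_square[of z] by simp
    then have n': "(norm z)\<^sup>2 = of_int n" by (simp only: of_real_eq_iff)
    moreover have "(norm z)\<^sup>2 > 0" using z by simp
    ultimately have "n \<ge> 1" by (metis of_int_0_less_iff zless_imp_add1_zle add_0)
    then have "(norm z)\<^sup>2 \<ge> 1\<^sup>2" unfolding n' by simp
    then show ?thesis by (rule power2_le_imp_le) simp
  qed
  have "x \<noteq> 0" "y \<noteq> 0" using assms by auto
  then have "norm x \<ge> 1" "norm y \<ge> 1" using ge assms by auto
  moreover have "norm x * norm y = 1" using assms by (simp flip: norm_mult)
  ultimately show ?thesis
    by (smt (verit) mult_le_cancel_left1 mult_le_cancel_right1)
qed

lemma quad_field_denominator: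
  assumes "x \<in> quad_field m"
  obtains d :: int where "d > 0" "of_int d * x \<in> ring_ints m"
proof -
  obtain a b where ab: "x = of_rat a + of_rat b * rt m"
    using assms by (rule quad_fieldE)
  obtain a1 a2 where a: "quotient_of a = (a1, a2)" by fastforce
  obtain b1 b2 where b: "quotient_of b = (b1, b2)" by fastforce
  have pos: "a2 > 0" "b2 > 0" using a b quotient_of_denom_pos by auto
  have qab: "(of_rat a :: complex) = of_int a1 / of_int a2" "(of_rat b :: complex) = of_int b1 / of_int b2"
    by (simp_all add: quotient_of_div[OF a] quotient_of_div[OF b] of_rat_divide)
  have "of_int (a2 * b2) * x = of_int (a1 * b2) + of_int (b1 * a2) * rt m"
    unfolding ab qab using pos by (simp add: field_simps)
  moreover have "rt m \<in> ring_ints m"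
  proof (rule ring_intsI)
    show "rt m * cnj (rt m) \<in> \<int>" by (simp add: rt_simps)
  qed (simp_all add: rt_simps)
  ultimately have "of_int (a2 * b2) * x \<in> ring_ints m" by (auto simp del: of_int_mult)
  then show ?thesis using that[of "a2 * b2"] pos by simp
qed

text \<open>Invertibility of the ideal generated by \<open>\<alpha>\<close> and \<open>\<beta>\<close>: its product with the conjugate ideal is
  generated by the greatest common divisor of the rational integers \<open>N \<alpha>\<close>, \<open>N \<beta>\<close> and \<open>Tr (\<alpha> \<beta>')\<close>,
  since \<open>\<alpha> \<beta>' / g\<close> has integral trace and norm.\<close>

lemma two_generated_ideal_invertible:
  assumes a: "\<alpha> \<in> ring_ints m" and b: "\<beta> \<in> ring_ints m" and nz: "\<alpha> \<noteq> 0 \<or> \<beta> \<noteq> 0"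
  obtains x y where "\<alpha> * x + \<beta> * y = 1" "x * \<alpha> \<in> ring_ints m" "x * \<beta> \<in> ring_ints m"
    "y * \<alpha> \<in> ring_ints m" "y * \<beta> \<in> ring_ints m"
proof -
  obtain A where A: "\<alpha> * cnj \<alpha> = of_int A" using ring_ints_trace_norm(2)[OF a] by (rule Ints_cases)
  obtain B where B: "\<beta> * cnj \<beta> = of_int B" using ring_ints_trace_norm(2)[OF b] by (rule Ints_cases)
  have ab: "\<alpha> * cnj \<beta> \<in> ring_ints m" using a b by auto
  obtain T where T: "\<alpha> * cnj \<beta> + cnj \<alpha> * \<beta> = of_int T"
    using ring_ints_trace_norm(1)[OF ab] by (auto elim: Ints_cases)
  define g where "g = gcd (gcd A B) T"
  have "A \<noteq> 0 \<or> B \<noteq> 0"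
    using nz A B by (metis complex_cnj_zero_iff mult_eq_0_iff of_int_0)
  then have g0: "g \<noteq> 0" by (auto simp: g_def)
  obtain A' where A': "A = g * A'" unfolding g_def by (meson dvdE dvd_trans gcd_dvd1)
  obtain B' where B': "B = g * B'" unfolding g_def by (meson dvdE dvd_trans gcd_dvd1 gcd_dvd2)
  obtain T' where T': "T = g * T'" unfolding g_def by (meson dvdE gcd_dvd2)
  obtain u v where uv: "u * gcd A B + v * T = g" unfolding g_def using bezout_int by blast
  obtain p q where "p * A + q * B = gcd A B" using bezout_int by blast
  then have "(u * p) * A + (u * q) * B + v * T = g" using uv by (metis distrib_left mult.assoc)
  then obtain p q r where pqr: "p * A + q * B + r * T = g" by blast
  have gc: "complex_of_int g \<noteq> 0" using g0 by simp
  have e: "\<alpha> * cnj \<beta> / of_int g \<in> ring_ints m"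
  proof (rule ring_intsI)
    show "\<alpha> * cnj \<beta> / of_int g \<in> quad_field m"
      using ab by (intro quad_field_divide of_int_in_quad_field) (rule ring_ints_subset_quad_field)
    have "\<alpha> * cnj \<beta> / of_int g + cnj (\<alpha> * cnj \<beta> / of_int g) = (\<alpha> * cnj \<beta> + cnj \<alpha> * \<beta>) / of_int g"
      by (simp add: add_divide_distrib)
    also have "\<dots> = of_int T'" unfolding T T' using gc by simp
    finally show "\<alpha> * cnj \<beta> / of_int g + cnj (\<alpha> * cnj \<beta> / of_int g) \<in> \<int>" by simp
    have "\<alpha> * cnj \<beta> / of_int g * cnj (\<alpha> * cnj \<beta> / of_int g) = ((\<alpha> * cnj \<alpha>) / of_int g) * ((\<beta> * cnj \<beta>) / of_int g)"
      by simp
    also have "\<dots> = of_int (A' * B')" unfolding A B A' B' using gc by simp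
    finally show "\<alpha> * cnj \<beta> / of_int g * cnj (\<alpha> * cnj \<beta> / of_int g) \<in> \<int>" by (metis Ints_of_int)
  qed
  have e': "cnj \<alpha> * \<beta> / of_int g \<in> ring_ints m" using ring_ints_cnj[OF e] by simp
  \<comment> \<open>The coefficients are those of the Bezout relation for \<open>g\<close>: with
    this choice \<open>\<alpha> * x + \<beta> * y\<close> is \<open>p * A + q * B + r * T\<close>
    divided by \<open>g\<close>.\<close>
  define x where "x = (of_int p * cnj \<alpha> + of_int r * cnj \<beta>) / of_int g"
  define y where "y = (of_int q * cnj \<beta> + of_int r * cnj \<alpha>) / of_int g"
  have "\<alpha> * x + \<beta> * y = (of_int p * (\<alpha> * cnj \<alpha>) + of_int q * (\<beta> * cnj \<beta>) + of_int r * (\<alpha> * cnj \<beta> + cnj \<alpha> * \<beta>)) / of_int g"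
    by (simp add: x_def y_def add_divide_distrib[symmetric] algebra_simps)
  also have "\<dots> = 1" unfolding A B T using gc pqr by (simp flip: of_int_mult of_int_add)
  finally have 1: "\<alpha> * x + \<beta> * y = 1" .
  have Ag: "\<alpha> * cnj \<alpha> / of_int g = of_int A'" unfolding A A' using gc by simp
  have Bg: "\<beta> * cnj \<beta> / of_int g = of_int B'" unfolding B B' using gc by simp
  have "x * \<alpha> = of_int p * (\<alpha> * cnj \<alpha> / of_int g) + of_int r * (\<alpha> * cnj \<beta> / of_int g)"
    by (simp add: x_def add_divide_distrib algebra_simps)
  then have 2: "x * \<alpha> \<in> ring_ints m" unfolding Ag using e
    by (auto intro!: ring_ints_add ring_ints_mult simp del: times_divide_eq_right)
  have "x * \<beta> = of_int p * (cnj \<alpha> * \<beta> / of_int g) + of_int r * (\<beta> * cnj \<beta> / of_int g)"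
    by (simp add: x_def add_divide_distrib algebra_simps)
  then have 3: "x * \<beta> \<in> ring_ints m" unfolding Bg using e'
    by (auto intro!: ring_ints_add ring_ints_mult simp del: times_divide_eq_right)
  have "y * \<alpha> = of_int q * (\<alpha> * cnj \<beta> / of_int g) + of_int r * (\<alpha> * cnj \<alpha> / of_int g)"
    by (simp add: y_def add_divide_distrib algebra_simps)
  then have 4: "y * \<alpha> \<in> ring_ints m" unfolding Ag using e
    by (auto intro!: ring_ints_add ring_ints_mult simp del: times_divide_eq_right)
  have "y * \<beta> = of_int q * (\<beta> * cnj \<beta> / of_int g) + of_int r * (cnj \<alpha> * \<beta> / of_int g)"
    by (simp add: y_def add_divide_distrib algebra_simps)
  then have 5: "y * \<beta> \<in> ring_ints m" unfolding Bg using e'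
    by (auto intro!: ring_ints_add ring_ints_mult simp del: times_divide_eq_right)
  show ?thesis using that 1 2 3 4 5 by blast
qed

section \<open>Ideals with two generators\<close>

definition gen2 :: "complex \<Rightarrow> complex \<Rightarrow> complex set" where
  "gen2 \<alpha> \<beta> = {a * \<alpha> + b * \<beta> | a b. a \<in> ring_ints m \<and> b \<in> ring_ints m}"

text \<open>The matrix with rows \<open>(\<gamma> * x, \<gamma> * y)\<close> and
  \<open>(\<delta> * x, \<delta> * y)\<close> sends \<open>(\<alpha>, \<beta>)\<close> to
  \<open>(\<gamma>, \<delta>)\<close> but has rank one. Adding rows
  \<open>(w * \<beta>, - w * \<alpha>)\<close> and \<open>(- z * \<beta>, z * \<alpha>)\<close>,
  which annihilate \<open>(\<alpha>, \<beta>)\<close>, makes the determinant the product of the two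
  partitions of 1. Entries are integral as products from the ideal and its inverse.\<close>

lemma SL2_transitive_on_generators:
  assumes "\<alpha> \<in> ring_ints m" "\<beta> \<in> ring_ints m" "\<alpha> \<noteq> 0 \<or> \<beta> \<noteq> 0"
    and "\<gamma> \<in> gen2 \<alpha> \<beta>" "\<delta> \<in> gen2 \<alpha> \<beta>" "\<alpha> \<in> gen2 \<gamma> \<delta>" "\<beta> \<in> gen2 \<gamma> \<delta>"
  obtains a b c d where "a \<in> ring_ints m" "b \<in> ring_ints m" "c \<in> ring_ints m" "d \<in> ring_ints m"
    "a * d - b * c = 1" "a * \<alpha> + b * \<beta> = \<gamma>" "c * \<alpha> + d * \<beta> = \<delta>"
proof -
  have gd: "\<gamma> \<in> ring_ints m" "\<delta> \<in> ring_ints m" using assms by (auto simp: gen2_def)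
  have "\<gamma> \<noteq> 0 \<or> \<delta> \<noteq> 0" using assms(3,6,7) by (auto simp: gen2_def)
  obtain x y where x: "\<alpha> * x + \<beta> * y = 1" "x * \<alpha> \<in> ring_ints m" "x * \<beta> \<in> ring_ints m"
    "y * \<alpha> \<in> ring_ints m" "y * \<beta> \<in> ring_ints m"
    using two_generated_ideal_invertible[OF assms(1-3)] by metis
  obtain z w where z: "\<gamma> * z + \<delta> * w = 1" "z * \<gamma> \<in> ring_ints m" "z * \<delta> \<in> ring_ints m"
    "w * \<gamma> \<in> ring_ints m" "w * \<delta> \<in> ring_ints m"
    using two_generated_ideal_invertible[OF gd \<open>\<gamma> \<noteq> 0 \<or> \<delta> \<noteq> 0\<close>] by metis
  have inv: "t * s \<in> ring_ints m" if t: "t * \<alpha> \<in> ring_ints m" "t * \<beta> \<in> ring_ints m" and s: "s \<in> gen2 \<alpha> \<beta>" for t s \<alpha> \<beta>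
  proof -
    obtain a b where "s = a * \<alpha> + b * \<beta>" "a \<in> ring_ints m" "b \<in> ring_ints m"
      using s by (auto simp: gen2_def)
    moreover from this have "t * s = a * (t * \<alpha>) + b * (t * \<beta>)" by (simp add: algebra_simps)
    ultimately show ?thesis using t by auto
  qed
  have I: "x * \<gamma> \<in> ring_ints m" "x * \<delta> \<in> ring_ints m" "y * \<gamma> \<in> ring_ints m" "y * \<delta> \<in> ring_ints m"
    "z * \<alpha> \<in> ring_ints m" "z * \<beta> \<in> ring_ints m" "w * \<alpha> \<in> ring_ints m" "w * \<beta> \<in> ring_ints m"
    using inv x z assms by blast+
  have "(\<gamma> * x + w * \<beta>) * (\<delta> * y + z * \<alpha>) - (\<gamma> * y - w * \<alpha>) * (\<delta> * x - z * \<beta>)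
      = (\<alpha> * x + \<beta> * y) * (\<gamma> * z + \<delta> * w)" by (simp add: algebra_simps)
  also have "\<dots> = 1" using x z by simp
  finally have 1: "(\<gamma> * x + w * \<beta>) * (\<delta> * y + z * \<alpha>) - (\<gamma> * y - w * \<alpha>) * (\<delta> * x - z * \<beta>) = 1" .
  have "(\<gamma> * x + w * \<beta>) * \<alpha> + (\<gamma> * y - w * \<alpha>) * \<beta> = \<gamma> * (\<alpha> * x + \<beta> * y)" by (simp add: algebra_simps)
  then have 2: "(\<gamma> * x + w * \<beta>) * \<alpha> + (\<gamma> * y - w * \<alpha>) * \<beta> = \<gamma>" using x by simp
  have "(\<delta> * x - z * \<beta>) * \<alpha> + (\<delta> * y + z * \<alpha>) * \<beta> = \<delta> * (\<alpha> * x + \<beta> * y)" by (simp add: algebra_simps)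
  then have 3: "(\<delta> * x - z * \<beta>) * \<alpha> + (\<delta> * y + z * \<alpha>) * \<beta> = \<delta>" using x by simp
  show ?thesis
    by (rule that[OF _ _ _ _ 1 2 3]) (use I in \<open>auto simp: mult.commute\<close>)
qed

lemma gen2_fractional:
  assumes ab: "\<alpha> \<in> ring_ints m" "\<beta> \<in> ring_ints m" "\<alpha> \<noteq> 0 \<or> \<beta> \<noteq> 0"
  shows "gen2 \<alpha> \<beta> \<in> fractional_ideals m"
proof -
  have 1: "gen2 \<alpha> \<beta> \<subseteq> ring_ints m" using ab by (auto simp: gen2_def)
  have mem: "\<alpha> \<in> gen2 \<alpha> \<beta>" "\<beta> \<in> gen2 \<alpha> \<beta>"
  proof -
    have "1 * \<alpha> + 0 * \<beta> \<in> gen2 \<alpha> \<beta>" "0 * \<alpha> + 1 * \<beta> \<in> gen2 \<alpha> \<beta>" unfolding gen2_def by blast+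
    then show "\<alpha> \<in> gen2 \<alpha> \<beta>" "\<beta> \<in> gen2 \<alpha> \<beta>" by simp_all
  qed
  have zero: "0 \<in> gen2 \<alpha> \<beta>"
  proof -
    have "0 * \<alpha> + 0 * \<beta> \<in> gen2 \<alpha> \<beta>" unfolding gen2_def by blast
    then show ?thesis by simp
  qed
  have add: "x + y \<in> gen2 \<alpha> \<beta>" if xy: "x \<in> gen2 \<alpha> \<beta>" "y \<in> gen2 \<alpha> \<beta>" for x y
  proof -
    obtain a b c d where *: "x = a * \<alpha> + b * \<beta>" "y = c * \<alpha> + d * \<beta>" "a \<in> ring_ints m" "b \<in> ring_ints m"
      "c \<in> ring_ints m" "d \<in> ring_ints m" using xy unfolding gen2_def by blast
    then have "x + y = (a + c) * \<alpha> + (b + d) * \<beta>" by (simp add: algebra_simps)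
    then show ?thesis unfolding gen2_def using * by blast
  qed
  have mult: "r * x \<in> gen2 \<alpha> \<beta>" if rx: "r \<in> ring_ints m" "x \<in> gen2 \<alpha> \<beta>" for r x
  proof -
    obtain a b where *: "x = a * \<alpha> + b * \<beta>" "a \<in> ring_ints m" "b \<in> ring_ints m"
      using rx unfolding gen2_def by blast
    then have "r * x = (r * a) * \<alpha> + (r * b) * \<beta>" by (simp add: algebra_simps)
    then show ?thesis unfolding gen2_def using * rx by blast
  qed
  show ?thesis
    unfolding fractional_ideals_def
    using 1 ring_ints_subset_quad_field mem zero add mult ab by (auto intro!: bexI[of _ 1])
qed

text \<open>Equality of classes means that the two ideals differ by a factor
  \<open>\<kappa>\<close>, so \<open>(\<alpha>, \<beta>)\<close> and
  \<open>(\<kappa> * u, \<kappa>)\<close> generate the same ideal and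
  \<open>SL2_transitive_on_generators\<close> applies.\<close>

lemma gen2_ideal_class:
  assumes ab: "\<alpha> \<in> ring_ints m" "\<beta> \<in> ring_ints m" "\<alpha> \<noteq> 0 \<or> \<beta> \<noteq> 0"
    and cl: "ideal_class m (gen2 \<alpha> \<beta>) = ideal_class m (ideal_gen1 m u)"
  obtains \<kappa> a b c d where "\<kappa> \<in> quad_field m" "\<kappa> \<noteq> 0"
    "a \<in> ring_ints m" "b \<in> ring_ints m" "c \<in> ring_ints m" "d \<in> ring_ints m"
    "a * d - b * c = 1" "a * \<alpha> + b * \<beta> = \<kappa> * u" "c * \<alpha> + d * \<beta> = \<kappa>"
proof -
  let ?I = "gen2 \<alpha> \<beta>" and ?J = "ideal_gen1 m u"
  \<comment> \<open>Reflexivity puts \<open>?I\<close> into its own class, hence into the class of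
    \<open>?J\<close>.\<close>
  have "?I = (\<lambda>x. 1 * x) ` ?I" by simp
  then have "(?I, ?I) \<in> ideal_equiv m"
    using gen2_fractional[OF ab] unfolding ideal_equiv_def by (auto intro!: bexI[of _ 1])
  then have "(?J, ?I) \<in> ideal_equiv m" using cl by (auto simp: ideal_class_def)
  then obtain \<kappa> where \<kappa>: "\<kappa> \<in> quad_field m" "\<kappa> \<noteq> 0" "?I = (\<lambda>x. \<kappa> * x) ` ?J"
    unfolding ideal_equiv_def by blast
  have "1 * u + 0 \<in> ?J" "0 * u + 1 \<in> ?J" unfolding ideal_gen1_def by blast+
  then have J: "u \<in> ?J" "1 \<in> ?J" by simp_all
  have 1: "\<kappa> * u \<in> ?I" "\<kappa> \<in> ?I" using J \<kappa>(3) by (auto intro: image_eqI[of _ _ 1])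
  have I: "z \<in> gen2 (\<kappa> * u) \<kappa>" if zI: "z \<in> ?I" for z
  proof -
    obtain a b where z: "z = \<kappa> * (a * u + b)" and ab: "a \<in> ring_ints m" "b \<in> ring_ints m"
      using zI unfolding \<kappa>(3) ideal_gen1_def by blast
    have "z = a * (\<kappa> * u) + b * \<kappa>" unfolding z by (simp add: algebra_simps)
    then show ?thesis unfolding gen2_def using ab by blast
  qed
  have "1 * \<alpha> + 0 * \<beta> \<in> ?I" "0 * \<alpha> + 1 * \<beta> \<in> ?I" unfolding gen2_def by blast+
  then have "\<alpha> \<in> gen2 (\<kappa> * u) \<kappa>" "\<beta> \<in> gen2 (\<kappa> * u) \<kappa>" using I by simp_all
  then show ?thesis
    using SL2_transitive_on_generators[OF ab 1] that[OF \<kappa>(1,2)] by metis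
qed


end

section \<open>Hermitian forms\<close>

lemma mat_adjoint_dim [simp]:
  "dim_row (mat_adjoint A) = dim_col A" "dim_col (mat_adjoint A) = dim_row A"
  by (simp_all add: mat_adjoint_def)

lemma mat_adjoint_carrier [simp, intro]: "A \<in> carrier_mat n k \<Longrightarrow> mat_adjoint A \<in> carrier_mat k n"
  by (auto intro: carrier_matI)

lemma mat_adjoint_index [simp]:
  "i < dim_col A \<Longrightarrow> j < dim_row A \<Longrightarrow> mat_adjoint (A :: complex mat) $$ (i, j) = cnj (A $$ (j, i))"
  by (simp add: mat_adjoint_def mat_of_rows_index)

lemma mat_adjoint_adjoint [simp]: "mat_adjoint (mat_adjoint (A :: complex mat)) = A"
  by (intro eq_matI) auto

lemma mat_adjoint_one [simp]: "mat_adjoint (1\<^sub>m n :: complex mat) = 1\<^sub>m n"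
  by (intro eq_matI) auto

lemma mat_adjoint_add:
  "A \<in> carrier_mat n k \<Longrightarrow> B \<in> carrier_mat n k \<Longrightarrow>
    mat_adjoint (A + B :: complex mat) = mat_adjoint A + mat_adjoint B"
  by (intro eq_matI) auto

lemma mat_mult_index:
  "A \<in> carrier_mat n k \<Longrightarrow> B \<in> carrier_mat k l \<Longrightarrow> i < n \<Longrightarrow> j < l \<Longrightarrow>
    (A * B) $$ (i, j) = (\<Sum>r<k. A $$ (i, r) * B $$ (r, j))"
  by (auto simp: scalar_prod_def lessThan_atLeast0 intro!: sum.cong)

lemma mat_adjoint_mult:
  assumes "A \<in> carrier_mat n k" "B \<in> carrier_mat k l"
  shows "mat_adjoint (A * B :: complex mat) = mat_adjoint B * mat_adjoint A"
proof (intro eq_matI)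
  fix i j assume "i < dim_row (mat_adjoint B * mat_adjoint A)" "j < dim_col (mat_adjoint B * mat_adjoint A)"
  then have ij: "i < l" "j < n" using assms by auto
  have "mat_adjoint (A * B) $$ (i, j) = cnj (\<Sum>r<k. A $$ (j, r) * B $$ (r, i))"
    using assms ij by (subst mat_adjoint_index) (auto simp: mat_mult_index[OF assms] simp del: index_mult_mat(1))
  also have "\<dots> = (\<Sum>r<k. mat_adjoint B $$ (i, r) * mat_adjoint A $$ (r, j))"
    using assms ij by (simp add: mult.commute)
  also have "\<dots> = (mat_adjoint B * mat_adjoint A) $$ (i, j)"
    using mat_mult_index[of "mat_adjoint B" l k "mat_adjoint A" n i j] assms ij by simp
  finally show "mat_adjoint (A * B) $$ (i, j) = (mat_adjoint B * mat_adjoint A) $$ (i, j)" .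
qed (use assms in auto)

lemma cscalar_adjoint:
  fixes A :: "complex mat"
  assumes "A \<in> carrier_mat n k" "x \<in> carrier_vec k" "y \<in> carrier_vec n"
  shows "(A *\<^sub>v x) \<bullet>c y = x \<bullet>c (mat_adjoint A *\<^sub>v y)"
proof -
  have "(A *\<^sub>v x) \<bullet>c y = (\<Sum>i<n. \<Sum>j<k. A $$ (i, j) * x $ j * cnj (y $ i))"
    using assms by (simp add: scalar_prod_def sum_distrib_right lessThan_atLeast0)
  also have "\<dots> = (\<Sum>j<k. \<Sum>i<n. A $$ (i, j) * x $ j * cnj (y $ i))"
    by (rule sum.swap)
  also have "\<dots> = x \<bullet>c (mat_adjoint A *\<^sub>v y)"
    using assms by (simp add: scalar_prod_def sum_distrib_left lessThan_atLeast0 mult_ac)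
  finally show ?thesis .
qed

lemma mat_trace_comm:
  assumes "A \<in> carrier_mat n k" "B \<in> carrier_mat k n"
  shows "mat_trace (A * B) = mat_trace (B * A)"
proof -
  have "mat_trace (A * B) = (\<Sum>i<n. \<Sum>r<k. A $$ (i, r) * B $$ (r, i))"
    using assms by (simp add: mat_trace_def mat_mult_index[OF assms] del: index_mult_mat(1))
  also have "\<dots> = (\<Sum>r<k. \<Sum>i<n. B $$ (r, i) * A $$ (i, r))"
    by (subst sum.swap) (simp add: mult.commute)
  also have "\<dots> = mat_trace (B * A)"
    using assms by (simp add: mat_trace_def mat_mult_index[OF assms(2,1)] del: index_mult_mat(1))
  finally show ?thesis .
qed

lemma mat_trace_mult:
  assumes "A \<in> carrier_mat n k" "B \<in> carrier_mat k n"
  shows "mat_trace (A * B) = (\<Sum>i<n. \<Sum>r<k. A $$ (i, r) * B $$ (r, i))"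
  using assms by (simp add: mat_trace_def mat_mult_index[OF assms] del: index_mult_mat(1))

section \<open>Values of Hermitian forms\<close>

definition hform :: "complex mat \<Rightarrow> complex vec \<Rightarrow> complex vec \<Rightarrow> complex" where
  "hform A x y = (A *\<^sub>v x) \<bullet>c y"

definition sqnorm :: "complex vec \<Rightarrow> real" where
  "sqnorm x = (\<Sum>i<dim_vec x. (cmod (x $ i))\<^sup>2)"

lemma hform_sum:
  assumes "A \<in> carrier_mat n n" "x \<in> carrier_vec n" "y \<in> carrier_vec n"
  shows "hform A x y = (\<Sum>i<n. \<Sum>j<n. A $$ (i, j) * x $ j * cnj (y $ i))"
  using assms by (simp add: hform_def scalar_prod_def sum_distrib_right lessThan_atLeast0)

lemma cscalar_self: "x \<bullet>c x = of_real (sqnorm x)"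
  by (simp add: scalar_prod_def sqnorm_def lessThan_atLeast0 complex_norm_square[symmetric] del: of_real_power)

lemma sqnorm_nonneg: "sqnorm x \<ge> 0"
  by (simp add: sqnorm_def sum_nonneg)

lemma sqnorm_eq_0_iff:
  assumes "x \<in> carrier_vec n" shows "sqnorm x = 0 \<longleftrightarrow> x = 0\<^sub>v n"
proof -
  have "sqnorm x = 0 \<longleftrightarrow> (\<forall>i<n. x $ i = 0)"
    using assms by (auto simp: sqnorm_def sum_nonneg_eq_0_iff)
  also have "\<dots> \<longleftrightarrow> x = 0\<^sub>v n" using assms by (auto intro: eq_vecI)
  finally show ?thesis .
qed

lemma hform_add_mat:
  assumes "A \<in> carrier_mat n n" "B \<in> carrier_mat n n" "x \<in> carrier_vec n" "y \<in> carrier_vec n"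
  shows "hform (A + B) x y = hform A x y + hform B x y"
  using assms by (simp add: hform_sum[of _ n] algebra_simps sum.distrib)

lemma hform_smult_mat:
  assumes "A \<in> carrier_mat n n" "x \<in> carrier_vec n" "y \<in> carrier_vec n"
  shows "hform (c \<cdot>\<^sub>m A) x y = c * hform A x y"
  using assms by (simp add: hform_sum[of _ n] sum_distrib_left mult_ac)

lemma hform_add_left:
  assumes "A \<in> carrier_mat n n" "x \<in> carrier_vec n" "x' \<in> carrier_vec n" "y \<in> carrier_vec n"
  shows "hform A (x + x') y = hform A x y + hform A x' y"
  using assms by (simp add: hform_sum[of _ n] algebra_simps sum.distrib)

lemma hform_add_right:
  assumes "A \<in> carrier_mat n n" "x \<in> carrier_vec n" "y \<in> carrier_vec n" "y' \<in> carrier_vec n"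
  shows "hform A x (y + y') = hform A x y + hform A x y'"
  using assms by (simp add: hform_sum[of _ n] algebra_simps sum.distrib)

lemma hform_smult_left:
  assumes "A \<in> carrier_mat n n" "x \<in> carrier_vec n" "y \<in> carrier_vec n"
  shows "hform A (c \<cdot>\<^sub>v x) y = c * hform A x y"
  using assms by (simp add: hform_sum[of _ n] sum_distrib_left mult_ac)

lemma hform_smult_right:
  assumes "A \<in> carrier_mat n n" "x \<in> carrier_vec n" "y \<in> carrier_vec n"
  shows "hform A x (c \<cdot>\<^sub>v y) = cnj c * hform A x y"
  using assms by (simp add: hform_sum[of _ n] sum_distrib_left mult_ac)

lemma hermitian_index:
  assumes "hermitian_mat n A" "i < n" "j < n" shows "cnj (A $$ (i, j)) = A $$ (j, i)"
  using assms mat_adjoint_index[of j A i] by (auto simp: hermitian_mat_def)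

lemma hform_hermitian:
  assumes "hermitian_mat n A" "x \<in> carrier_vec n" "y \<in> carrier_vec n"
  shows "hform A y x = cnj (hform A x y)"
proof -
  have A: "A \<in> carrier_mat n n" using assms(1) by (simp add: hermitian_mat_def)
  have "cnj (hform A x y) = (\<Sum>i<n. \<Sum>j<n. A $$ (j, i) * cnj (x $ j) * y $ i)"
    using assms by (simp add: hform_sum[OF A] hermitian_index)
  also have "\<dots> = hform A y x"
    by (subst sum.swap) (simp add: hform_sum[OF A assms(3,2)] mult_ac)
  finally show ?thesis by simp
qed

lemma hform_conj:
  assumes "A \<in> carrier_mat n n" "U \<in> carrier_mat n n" "x \<in> carrier_vec n" "y \<in> carrier_vec n"
  shows "hform (U * A * mat_adjoint U) x y = hform A (mat_adjoint U *\<^sub>v x) (mat_adjoint U *\<^sub>v y)"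
proof -
  have "(U * A * mat_adjoint U) *\<^sub>v x = U *\<^sub>v (A *\<^sub>v (mat_adjoint U *\<^sub>v x))"
    using assms mult_mat_vec_carrier[of "mat_adjoint U" n n x] assoc_mult_mat_vec[of "U * A" n n "mat_adjoint U" n x]
      assoc_mult_mat_vec[of U n n A n "mat_adjoint U *\<^sub>v x"] by simp
  then show ?thesis
    unfolding hform_def
    using assms cscalar_adjoint[of U n n "A *\<^sub>v (mat_adjoint U *\<^sub>v x)" y]
      mult_mat_vec_carrier[of A n n "mat_adjoint U *\<^sub>v x"] mult_mat_vec_carrier[of "mat_adjoint U" n n x] by simp
qed

lemma norm_hform_le:
  assumes "A \<in> carrier_mat n n" "x \<in> carrier_vec n"
  shows "norm (hform A x x) \<le> mat_norm1 A * sqnorm x"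
proof -
  have le: "cmod (x $ j) * cmod (x $ i) \<le> sqnorm x" if "i < n" "j < n" for i j
  proof -
    have 1: "(cmod (x $ i))\<^sup>2 \<le> sqnorm x" if "i < n" for i
      unfolding sqnorm_def using that assms by (intro member_le_sum) auto
    have "2 * (cmod (x $ j) * cmod (x $ i)) \<le> (cmod (x $ j))\<^sup>2 + (cmod (x $ i))\<^sup>2"
      using sum_squares_bound[of "cmod (x $ j)" "cmod (x $ i)"] by simp
    then show ?thesis using 1[OF that(1)] 1[OF that(2)] by linarith
  qed
  have "norm (hform A x x) \<le> (\<Sum>i<n. \<Sum>j<n. cmod (A $$ (i, j)) * sqnorm x)"
    unfolding hform_sum[OF assms assms(2)]
  proof (intro sum_norm_le)
    fix i j assume "i \<in> {..<n}" "j \<in> {..<n}"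
    then show "norm (A $$ (i, j) * x $ j * cnj (x $ i)) \<le> cmod (A $$ (i, j)) * sqnorm x"
      using mult_left_mono[OF le[of i j], of "cmod (A $$ (i, j))"] by (simp add: norm_mult mult.assoc)
  qed
  also have "\<dots> = mat_norm1 A * sqnorm x"
    using assms by (simp add: mat_norm1_def sum_distrib_right)
  finally show ?thesis .
qed

lemma pos_def_alt: "pos_def n A \<longleftrightarrow> hermitian_mat n A \<and> (\<forall>v\<in>carrier_vec n. v \<noteq> 0\<^sub>v n \<longrightarrow> Re (hform A v v) > 0)"
  by (simp add: pos_def_def hform_def)

lemma pos_semidef_alt: "pos_semidef n A \<longleftrightarrow> hermitian_mat n A \<and> (\<forall>v\<in>carrier_vec n. Re (hform A v v) \<ge> 0)"
  by (simp add: pos_semidef_def hform_def)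

lemma pos_def_imp_semidef: "pos_def n A \<Longrightarrow> pos_semidef n A"
proof -
  assume A: "pos_def n A"
  have "Re (hform A v v) \<ge> 0" if "v \<in> carrier_vec n" for v
  proof (cases "v = 0\<^sub>v n")
    case True
    have "A \<in> carrier_mat n n" using A by (simp add: pos_def_def hermitian_mat_def)
    then show ?thesis using True by (simp add: hform_sum[of _ n])
  next
    case False
    then show ?thesis using A that by (auto simp: pos_def_alt intro: less_imp_le)
  qed
  then show ?thesis using A by (simp add: pos_def_alt pos_semidef_alt)
qed

lemma hform_expand:
  assumes A: "hermitian_mat n A" and x: "x \<in> carrier_vec n" and y: "y \<in> carrier_vec n"
  shows "Re (hform A (x + of_real s \<cdot>\<^sub>v y) (x + of_real s \<cdot>\<^sub>v y)) =
    Re (hform A x x) + 2 * s * Re (hform A x y) + s\<^sup>2 * Re (hform A y y)"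
proof -
  have A': "A \<in> carrier_mat n n" using A by (simp add: hermitian_mat_def)
  have "hform A (x + of_real s \<cdot>\<^sub>v y) (x + of_real s \<cdot>\<^sub>v y) =
     hform A x x + s * hform A x y + (s * hform A y x + s * s * hform A y y)"
    using A' x y by (simp add: hform_add_left[of _ n] hform_add_right[of _ n] hform_smult_left[of _ n] hform_smult_right[of _ n] algebra_simps)
  moreover have "Re (hform A y x) = Re (hform A x y)"
    using hform_hermitian[OF A x y] by simp
  ultimately show ?thesis by (simp add: power2_eq_square)
qed

lemma quadratic_nonneg_linear_zero:
  fixes a b :: real
  assumes "\<And>s. 2 * s * a + s\<^sup>2 * b \<ge> 0"
  shows "a = 0"
proof (rule ccontr)
  assume a: "a \<noteq> 0"
  \<comment> \<open>At \<open>s = - t * a\<close> the polynomial equals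
    \<open>(t * a\<^sup>2) * (t * b - 2)\<close>; a step with \<open>t * \<bar>b\<bar> < 1\<close>
    is short enough for the linear term to win.\<close>
  define t where "t = 1 / (\<bar>b\<bar> + 1)"
  have t: "t > 0" "t * \<bar>b\<bar> < 1" by (simp_all add: t_def field_simps)
  have "2 * (- t * a) * a + (- t * a)\<^sup>2 * b \<ge> 0" by (rule assms)
  moreover have "2 * (- t * a) * a + (- t * a)\<^sup>2 * b = (t * a\<^sup>2) * (t * b - 2)"
    by (simp add: power2_eq_square algebra_simps)
  moreover have "t * a\<^sup>2 > 0" using t a by simp
  moreover have "t * b \<le> t * \<bar>b\<bar>" using t by (intro mult_left_mono) auto
  ultimately show False using t by (smt (verit) mult_pos_neg)
qed

text \<open>The form attains its minimum 0 at \<open>x\<close>, so its derivative in the direction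
  \<open>A *\<^sub>v x\<close> vanishes; up to a factor 2 that derivative is the squared norm of
  \<open>A *\<^sub>v x\<close>.\<close>

lemma pos_semidef_null_vector:
  assumes A: "pos_semidef n A" and x: "x \<in> carrier_vec n" and 0: "Re (hform A x x) = 0"
  shows "A *\<^sub>v x = 0\<^sub>v n"
proof -
  have A': "A \<in> carrier_mat n n" "hermitian_mat n A" using A by (auto simp: pos_semidef_def hermitian_mat_def)
  define y where "y = A *\<^sub>v x"
  have y: "y \<in> carrier_vec n" using A' x by (simp add: y_def)
  have "2 * s * Re (hform A x y) + s\<^sup>2 * Re (hform A y y) \<ge> 0" for s
    using A x y hform_expand[OF A'(2) x y, of s] 0 unfolding pos_semidef_alt by (metis add_0 add_carrier_vec smult_carrier_vec)
  then have "Re (hform A x y) = 0" by (rule quadratic_nonneg_linear_zero)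
  moreover have "hform A x y = of_real (sqnorm y)"
    by (simp add: hform_def y_def[symmetric] cscalar_self)
  ultimately show ?thesis using sqnorm_eq_0_iff[OF y] by (simp add: y_def)
qed

lemma pos_def_det_nonzero:
  assumes A: "pos_def n A" shows "Determinant.det A \<noteq> 0"
proof
  assume "Determinant.det A = 0"
  moreover have A': "A \<in> carrier_mat n n" using A by (auto simp: pos_def_def hermitian_mat_def)
  ultimately obtain v where v: "v \<in> carrier_vec n" "v \<noteq> 0\<^sub>v n" "A *\<^sub>v v = 0\<^sub>v n"
    using det_0_iff_vec_prod_zero by blast
  then have "hform A v v = 0" by (simp add: hform_def)
  then show False using A v by (auto simp: pos_def_alt)
qed

lemma mat_inverse_exists:
  fixes A :: "complex mat"
  assumes A: "A \<in> carrier_mat n n" and "Determinant.det A \<noteq> 0"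
  obtains B where "B \<in> carrier_mat n n" "A * B = 1\<^sub>m n" "B * A = 1\<^sub>m n"
proof -
  have "A \<in> Units (ring_mat TYPE(complex) n ())"
    by (rule det_non_zero_imp_unit[OF assms])
  then obtain B where "mat_inverse A = Some B"
    using mat_inverse(1)[OF A, of "()"] by (cases "mat_inverse A") auto
  then show ?thesis using mat_inverse(2)[OF A] that by blast
qed

lemma mat_inv_eqI:
  assumes A: "A \<in> carrier_mat n n" and B: "B \<in> carrier_mat n n" and AB: "A * B = 1\<^sub>m n"
  shows "mat_inv A = B"
proof -
  have "Determinant.det A * Determinant.det B = 1"
    using det_mult[OF A B] AB by simp
  then have "Determinant.det A \<noteq> 0" by auto
  then have "A \<in> Units (ring_mat TYPE(complex) n ())"
    by (rule det_non_zero_imp_unit[OF A])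
  then obtain C where C: "mat_inverse A = Some C"
    using mat_inverse(1)[OF A, of "()"] by (cases "mat_inverse A") auto
  then have C': "C * A = 1\<^sub>m n" "C \<in> carrier_mat n n" using mat_inverse(2)[OF A] by auto
  have "C = C * (A * B)" using AB C' by simp
  also have "\<dots> = (C * A) * B" using A B C'(2) by (simp add: assoc_mult_mat[of _ n n _ n _ n])
  also have "\<dots> = B" using C' B by simp
  finally show ?thesis by (simp add: mat_inv_def C)
qed

text \<open>The Cauchy-Schwarz inequality for the form of \<open>A\<close>, applied to \<open>v\<close> and \<open>A\<inverse> v\<close>.\<close>

lemma pos_def_lower_bound:
  assumes A: "pos_def n A"
  obtains \<epsilon> where "\<epsilon> > 0" "\<And>v. v \<in> carrier_vec n \<Longrightarrow> Re (hform A v v) \<ge> \<epsilon> * sqnorm v"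
proof -
  have A': "A \<in> carrier_mat n n" "hermitian_mat n A" using A by (auto simp: pos_def_def hermitian_mat_def)
  obtain B where B: "B \<in> carrier_mat n n" "A * B = 1\<^sub>m n"
    using mat_inverse_exists[OF A'(1) pos_def_det_nonzero[OF A]] by blast
  \<comment> \<open>The norm bounds the form of the inverse \<open>B\<close>; the summand 1 keeps
    \<open>K\<close> positive.\<close>
  define K where "K = mat_norm1 B + 1"
  have K: "K > 0" unfolding K_def mat_norm1_def by (intro add_nonneg_pos sum_nonneg) auto
  have "Re (hform A v v) \<ge> (1 / K) * sqnorm v" if v: "v \<in> carrier_vec n" for v
  proof (cases "v = 0\<^sub>v n")
    case True
    then show ?thesis using A' sqnorm_eq_0_iff[OF v] by (simp add: hform_sum[of _ n])
  next
    case False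
    then have q: "Re (hform A v v) > 0" "sqnorm v > 0"
      using A v sqnorm_eq_0_iff[OF v] sqnorm_nonneg[of v] by (auto simp: pos_def_alt)
    define w where "w = B *\<^sub>v v"
    have w: "w \<in> carrier_vec n" using B v by (simp add: w_def)
    have Aw: "A *\<^sub>v w = v" unfolding w_def using A' B v by (simp flip: assoc_mult_mat_vec[of _ n n _ n])
    have wv: "hform A w v = of_real (sqnorm v)" by (simp add: hform_def Aw cscalar_self)
    have "hform A w w = cnj (hform B v v)"
    proof -
      have "hform A w w = v \<bullet>c w" by (simp add: hform_def Aw)
      also have "\<dots> = cnj (w \<bullet>c v)"
        using v w by (simp add: scalar_prod_def mult.commute)
      finally show ?thesis by (simp add: hform_def w_def)
    qed
    then have ww: "Re (hform A w w) \<le> K * sqnorm v"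
      using norm_hform_le[OF B(1) v] complex_Re_le_cmod[of "hform B v v"] sqnorm_nonneg[of v]
      by (simp add: K_def algebra_simps)
    \<comment> \<open>The minimum of the quadratic polynomial in \<open>s\<close> given by the form
      at \<open>w + s v\<close>.\<close>
    define s where "s = - sqnorm v / Re (hform A v v)"
    have "0 \<le> Re (hform A (w + of_real s \<cdot>\<^sub>v v) (w + of_real s \<cdot>\<^sub>v v))"
      using pos_def_imp_semidef[OF A] w v by (simp add: pos_semidef_alt)
    also have "\<dots> = Re (hform A w w) + 2 * s * sqnorm v + s\<^sup>2 * Re (hform A v v)"
      using hform_expand[OF A'(2) w v, of s] by (simp add: wv)
    also have "\<dots> = Re (hform A w w) - (sqnorm v)\<^sup>2 / Re (hform A v v)"
      using q by (simp add: s_def power2_eq_square field_simps)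
    finally have "(sqnorm v)\<^sup>2 / Re (hform A v v) \<le> K * sqnorm v" using ww by linarith
    then have "sqnorm v \<le> K * Re (hform A v v)"
      using q by (simp add: power2_eq_square field_simps)
    then show ?thesis using K by (simp add: field_simps)
  qed
  then show ?thesis using that[of "1 / K"] K by simp
qed

lemma pos_def_perturb:
  fixes A E :: "complex mat"
  assumes \<epsilon>: "\<And>v :: complex Matrix.vec. v \<in> carrier_vec n \<Longrightarrow> Re (hform A v v) \<ge> \<epsilon> * sqnorm v"
    and A: "A \<in> carrier_mat n n" and E: "E \<in> carrier_mat n n" "mat_norm1 E < \<epsilon>"
    and h: "hermitian_mat n (A + E)"
  shows "pos_def n (A + E)"
  unfolding pos_def_alt
proof (intro conjI ballI impI h)
  fix v :: "complex Matrix.vec" assume v: "v \<in> carrier_vec n" "v \<noteq> 0\<^sub>v n"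
  have sq: "sqnorm v > 0" using sqnorm_eq_0_iff[OF v(1)] sqnorm_nonneg[of v] v by simp
  have "hform (A + E) v v = hform A v v + hform E v v"
    using A E v by (simp add: hform_add_mat[of _ n])
  moreover have "norm (hform E v v) \<le> mat_norm1 E * sqnorm v" by (rule norm_hform_le[OF E(1) v(1)])
  moreover have "mat_norm1 E * sqnorm v < \<epsilon> * sqnorm v" using E sq by simp
  moreover have "- norm (hform E v v) \<le> Re (hform E v v)"
    by (metis abs_Re_le_cmod abs_le_D2 minus_le_iff)
  ultimately show "Re (hform (A + E) v v) > 0" using \<epsilon>[OF v(1)] by simp
qed

section \<open>Coordinates on the half-space\<close>

definition idx :: "nat \<Rightarrow> (nat \<times> nat) set" where
  "idx n = {..<n} \<times> {..<n}"

lemma finite_idx [simp]: "finite (idx n)"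
  by (simp add: idx_def)

text \<open>Coordinates with respect to a \<open>\<int>\<close>-basis of the lattice of integral Hermitian matrices: the
  entry above the diagonal is \<open>z (i, j) + z (j, i) \<omega>\<close>, its mirror image \<open>z (i, j) + z (j, i) \<omega>'\<close>.\<close>

definition zmat :: "nat \<Rightarrow> nat \<Rightarrow> (nat \<times> nat \<Rightarrow> complex) \<Rightarrow> complex mat" where
  "zmat m n z = Matrix.mat n n (\<lambda>(i, j). if i = j then z (i, i)
     else if i < j then z (i, j) + z (j, i) * om m else z (j, i) + z (i, j) * cnj (om m))"

text \<open>Coordinates dual to those of \<open>zmat\<close> under the trace pairing, see
  \<open>trace_tmat_zmat\<close>. Solving for the dual basis divides by
  \<open>om m - cnj (om m)\<close>, which is the square root of the discriminant.\<close>

definition tmat :: "nat \<Rightarrow> nat \<Rightarrow> (nat \<times> nat \<Rightarrow> int) \<Rightarrow> complex mat" where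
  "tmat m n t = Matrix.mat n n (\<lambda>(i, j). if i = j then of_int (t (i, i))
     else if i < j then (of_int (t (i, j)) * om m - of_int (t (j, i))) / csqrt (of_int (quad_disc m))
     else (of_int (t (i, j)) - of_int (t (j, i)) * cnj (om m)) / csqrt (of_int (quad_disc m)))"

lemma zmat_carrier [simp, intro]: "zmat m n z \<in> carrier_mat n n"
  by (simp add: zmat_def)

lemma zmat_dim [simp]: "dim_row (zmat m n z) = n" "dim_col (zmat m n z) = n"
  by (simp_all add: zmat_def)

lemma tmat_carrier [simp, intro]: "tmat m n t \<in> carrier_mat n n"
  by (simp add: tmat_def)

lemma tmat_dim [simp]: "dim_row (tmat m n t) = n" "dim_col (tmat m n t) = n"
  by (simp_all add: tmat_def)

lemma zmat_cong: "(\<And>p. p \<in> idx n \<Longrightarrow> z p = z' p) \<Longrightarrow> zmat m n z = zmat m n z'"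
  by (intro eq_matI) (auto simp: zmat_def idx_def)

lemma zmat_add: "zmat m n (\<lambda>p. z p + w p) = zmat m n z + zmat m n w"
  by (intro eq_matI) (auto simp: zmat_def algebra_simps)

lemma zmat_smult: "zmat m n (\<lambda>p. c * z p) = c \<cdot>\<^sub>m zmat m n z"
  by (intro eq_matI) (auto simp: zmat_def algebra_simps)

lemma zmat_adjoint: "mat_adjoint (zmat m n z) = zmat m n (\<lambda>p. cnj (z p))"
  by (intro eq_matI) (auto simp: zmat_def)

lemma zmat_diff: "zmat m n (\<lambda>p. z p - w p) = zmat m n z - zmat m n w"
  by (intro eq_matI) (auto simp: zmat_def algebra_simps)

lemma zmat_real_hermitian: "hermitian_mat n (zmat m n (\<lambda>p. of_real (y p)))"
  by (simp add: hermitian_mat_def zmat_adjoint)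

text \<open>An entry and its mirror image are two linear equations for two coordinates, with
  determinant \<open>om m - cnj (om m)\<close> up to sign.\<close>

lemma zmat_surj:
  assumes m: "m > 0" and Z: "Z \<in> carrier_mat n n"
  obtains z where "Z = zmat m n z"
proof -
  have nz: "om m - cnj (om m) \<noteq> 0" using om_nonreal[OF m] om_diff_cnj by metis
  define b where "b i j = (Z $$ (i, j) - Z $$ (j, i)) / (om m - cnj (om m))" for i j
  define z where "z = (\<lambda>(i, j). if i = j then Z $$ (i, i)
    else if i < j then Z $$ (i, j) - b i j * om m else b j i)"
  have b: "Z $$ (i, j) - b i j * om m + b i j * cnj (om m) = Z $$ (j, i)" for i j
  proof -
    have "b i j * (om m - cnj (om m)) = Z $$ (i, j) - Z $$ (j, i)" using nz by (simp add: b_def)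
    then show ?thesis by (simp add: algebra_simps)
  qed
  have "Z = zmat m n z"
    by (rule eq_matI) (use Z b in \<open>auto simp: zmat_def z_def\<close>)
  then show ?thesis using that by blast
qed

text \<open>The basis matrices are Hermitian, so taking adjoints conjugates the coordinates and the
  imaginary part of the matrix is formed coordinatewise.\<close>

lemma half_space_zmat_iff:
  "zmat m n z \<in> half_space n \<longleftrightarrow> pos_def n (zmat m n (\<lambda>p. of_real (Im (z p))))"
proof -
  have "(1 / (2 * \<i>)) \<cdot>\<^sub>m (zmat m n z - mat_adjoint (zmat m n z)) = zmat m n (\<lambda>p. (1 / (2 * \<i>)) * (z p - cnj (z p)))"
    by (simp only: zmat_adjoint zmat_diff zmat_smult)
  also have "\<dots> = zmat m n (\<lambda>p. of_real (Im (z p)))"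
    by (intro zmat_cong) (simp add: complex_eq_iff)
  finally show ?thesis by (simp add: half_space_def)
qed

lemma tmat_hermitian: "hermitian_mat n (tmat m n t)"
  unfolding hermitian_mat_def
proof
  show "mat_adjoint (tmat m n t) = tmat m n t"
    by (intro eq_matI) (auto simp: tmat_def cnj_csqrt_disc divide_simps)
qed simp

lemma sum_antisym_zero:
  fixes g :: "nat \<Rightarrow> nat \<Rightarrow> complex"
  assumes "\<And>i j. i < n \<Longrightarrow> j < n \<Longrightarrow> g i j = - g j i"
  shows "(\<Sum>i<n. \<Sum>j<n. g i j) = 0"
proof -
  have "(\<Sum>i<n. \<Sum>j<n. g i j) = (\<Sum>i<n. \<Sum>j<n. - g j i)"
    by (intro sum.cong refl assms) auto
  also have "\<dots> = - (\<Sum>i<n. \<Sum>j<n. g i j)"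
    by (subst sum.swap) (simp add: sum_negf)
  finally show ?thesis by (simp add: eq_neg_iff_add_eq_0 flip: mult_2)
qed

text \<open>The terms at \<open>(i, j)\<close> and \<open>(j, i)\<close> agree with the right-hand
  side only when added together. The termwise differences are therefore antisymmetric, and
  \<open>sum_antisym_zero\<close> removes them.\<close>

lemma trace_tmat_zmat:
  assumes m: "m > 0"
  shows "mat_trace (tmat m n t * zmat m n z) = (\<Sum>p\<in>idx n. of_int (t p) * z p)"
proof -
  let ?T = "\<lambda>i j. tmat m n t $$ (i, j)" and ?Z = "\<lambda>i j. zmat m n z $$ (i, j)"
  let ?d = "csqrt (of_int (quad_disc m))"
  have d: "?d \<noteq> 0" using om_nonreal[OF m] by simp
  have od: "om m = cnj (om m) + ?d" unfolding om_diff_cnj[symmetric] by simp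
  have up: "?T i j * ?Z j i - of_int (t (i, j)) * z (i, j) = - (?T j i * ?Z i j - of_int (t (j, i)) * z (j, i))"
    if ij: "i < n" "j < n" "i < j" for i j
  proof -
    define w where "w = cnj (om m)"
    have T: "?T i j = (of_int (t (i, j)) * (w + ?d) - of_int (t (j, i))) / ?d"
      "?T j i = (of_int (t (j, i)) - of_int (t (i, j)) * w) / ?d"
      using ij unfolding w_def by (auto simp: tmat_def od[symmetric])
    have Z: "?Z i j = z (i, j) + z (j, i) * (w + ?d)" "?Z j i = z (i, j) + z (j, i) * w"
      using ij unfolding w_def by (auto simp: zmat_def od[symmetric])
    have "?T i j * ?Z j i + ?T j i * ?Z i j = of_int (t (i, j)) * z (i, j) + of_int (t (j, i)) * z (j, i)"
      unfolding T Z using d by (simp add: field_simps)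
    then show ?thesis by (simp add: algebra_simps)
  qed
  have "(\<Sum>i<n. \<Sum>j<n. ?T i j * ?Z j i - of_int (t (i, j)) * z (i, j)) = 0"
  proof (rule sum_antisym_zero)
    fix i j assume ij: "i < n" "j < n"
    consider "i < j" | "i = j" | "j < i" by linarith
    then show "?T i j * ?Z j i - of_int (t (i, j)) * z (i, j) = - (?T j i * ?Z i j - of_int (t (j, i)) * z (j, i))"
    proof cases
      case 1
      then show ?thesis using up ij by blast
    next
      case 2
      then show ?thesis using ij by (simp add: tmat_def zmat_def)
    next
      case 3
      then show ?thesis using up[of j i] ij by simp
    qed
  qed
  then have "(\<Sum>i<n. \<Sum>j<n. ?T i j * ?Z j i) = (\<Sum>i<n. \<Sum>j<n. of_int (t (i, j)) * z (i, j))"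
    by (simp add: sum_subtractf)
  then show ?thesis
    by (simp add: mat_trace_mult[of _ n n] idx_def sum.cartesian_product)
qed

text \<open>The dual lattice of the integral Hermitian matrices: \<open>fourier_index\<close> before
  semidefiniteness is known.\<close>

definition herm_lattice :: "nat \<Rightarrow> nat \<Rightarrow> complex mat set" where
  "herm_lattice m n = {T. hermitian_mat n T \<and> (\<forall>i<n. T $$ (i, i) \<in> \<int>)
     \<and> (\<forall>i<n. \<forall>j<n. i \<noteq> j \<longrightarrow>
          (\<exists>a\<in>ring_ints m. T $$ (i, j) = a / csqrt (of_int (quad_disc m))))}"

lemma fourier_index_eq: "fourier_index m n = {T \<in> herm_lattice m n. pos_semidef n T}"
  by (auto simp: fourier_index_def herm_lattice_def pos_semidef_def)

lemma bij_betw_tmat: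
  assumes m: "squarefree m"
  shows "bij_betw (tmat m n) (PiE (idx n) (\<lambda>_. UNIV)) (herm_lattice m n)"
proof -
  have m0: "m > 0" using m by (metis not_squarefree_0 gr0I)
  let ?d = "csqrt (of_int (quad_disc m))"
  have d: "?d \<noteq> 0" using om_nonreal[OF m0] by simp
  have "inj_on (tmat m n) (PiE (idx n) (\<lambda>_. UNIV))"
  proof (rule inj_onI)
    fix t t' assume t: "t \<in> PiE (idx n) (\<lambda>_. UNIV)" "t' \<in> PiE (idx n) (\<lambda>_. UNIV)" and eq: "tmat m n t = tmat m n t'"
    show "t = t'"
    proof (rule PiE_ext[OF t])
      fix p assume p: "p \<in> idx n"
      \<comment> \<open>Pairing with the basis matrix at \<open>p\<close> recovers the coordinate at
        \<open>p\<close>.\<close>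
      have *: "(\<Sum>q\<in>idx n. of_int (t q) * (if q = p then 1 else 0 :: complex)) = of_int (t p)" for t
        using p by (simp add: if_distrib[of "(*) _"] cong: if_cong)
      have "of_int (t p) = (of_int (t' p) :: complex)"
        using trace_tmat_zmat[OF m0, of n t "\<lambda>q. if q = p then 1 else 0"]
          trace_tmat_zmat[OF m0, of n t' "\<lambda>q. if q = p then 1 else 0"] eq by (simp only: *)
      then show "t p = t' p" by simp
    qed
  qed
  moreover have "tmat m n t \<in> herm_lattice m n" for t
  proof -
    have "\<exists>a\<in>ring_ints m. tmat m n t $$ (i, j) = a / ?d" if "i < n" "j < n" "i \<noteq> j" for i j
    proof (cases "i < j")
      case True
      have "of_int (t (i, j)) * om m - of_int (t (j, i)) \<in> ring_ints m" using m by auto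
      then show ?thesis using that True by (auto simp: tmat_def)
    next
      case False
      have "of_int (t (i, j)) - of_int (t (j, i)) * cnj (om m) \<in> ring_ints m" using m by auto
      then show ?thesis using that False by (auto simp: tmat_def)
    qed
    moreover have "tmat m n t $$ (i, i) \<in> \<int>" if "i < n" for i using that by (simp add: tmat_def)
    ultimately show ?thesis using tmat_hermitian unfolding herm_lattice_def by blast
  qed
  moreover have "T \<in> tmat m n ` (PiE (idx n) (\<lambda>_. UNIV))" if T: "T \<in> herm_lattice m n" for T
  proof -
    have TH: "hermitian_mat n T" "T \<in> carrier_mat n n" using T by (auto simp: herm_lattice_def hermitian_mat_def)
    have "\<forall>i\<in>{..<n}. \<exists>k. T $$ (i, i) = of_int k"
      using T unfolding herm_lattice_def by (auto elim!: Ints_cases)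
    then obtain k where k: "\<And>i. i < n \<Longrightarrow> T $$ (i, i) = of_int (k i)" by (metis lessThan_iff)
    have "\<exists>a b. T $$ (i, j) = (of_int b * om m - of_int a) / ?d" if ij: "i < n" "j < n" "i < j" for i j
    proof -
      have "\<exists>x\<in>ring_ints m. T $$ (i, j) = x / ?d"
        using T ij unfolding herm_lattice_def by auto
      then obtain x where x: "x \<in> ring_ints m" "T $$ (i, j) = x / ?d" by blast
      then obtain a b where "x = of_int a + of_int b * om m" using ring_ints_basisE[OF m] by metis
      then have "T $$ (i, j) = (of_int b * om m - of_int (- a)) / ?d" using x by simp
      then show ?thesis by blast
    qed
    then obtain a b where ab: "\<And>i j. i < n \<Longrightarrow> j < n \<Longrightarrow> i < j \<Longrightarrow> T $$ (i, j) = (of_int (b i j) * om m - of_int (a i j)) / ?d"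
      by metis
    define t where "t = restrict (\<lambda>(i, j). if i = j then k i else if i < j then b i j else a j i) (idx n)"
    have "T = tmat m n t"
    proof (rule eq_matI)
      fix i j assume "i < dim_row (tmat m n t)" "j < dim_col (tmat m n t)"
      then have ij: "i < n" "j < n" by auto
      consider "i < j" | "i = j" | "j < i" by linarith
      then show "T $$ (i, j) = tmat m n t $$ (i, j)"
      proof cases
        case 1
        then show ?thesis using ij ab[OF ij 1] by (simp add: tmat_def t_def idx_def)
      next
        case 2
        then show ?thesis using ij k by (simp add: tmat_def t_def idx_def)
      next
        case 3
        have "T $$ (i, j) = cnj (T $$ (j, i))" using hermitian_index[OF TH(1)] ij by simp
        also have "\<dots> = (of_int (a j i) - of_int (b j i) * cnj (om m)) / ?d"
          unfolding ab[OF ij(2,1) 3] using d by (simp add: cnj_csqrt_disc field_simps)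
        finally show ?thesis using ij 3 by (simp add: tmat_def t_def idx_def)
      qed
    qed (use TH in auto)
    moreover have "t \<in> PiE (idx n) (\<lambda>_. UNIV)" by (auto simp: t_def)
    ultimately show ?thesis by blast
  qed
  ultimately show ?thesis unfolding bij_betw_def by blast
qed

section \<open>Block triangular elements of the modular group\<close>

lemma split_four_block:
  assumes "A \<in> carrier_mat n n" "B \<in> carrier_mat n n" "C \<in> carrier_mat n n" "D \<in> carrier_mat n n"
  shows "split_block (four_block_mat A B C D) n n = (A, B, C, D)"
  using assms by (auto simp: split_block_def Let_def intro!: eq_matI)

lemma slash_four_block:
  assumes "A \<in> carrier_mat n n" "B \<in> carrier_mat n n" "C \<in> carrier_mat n n" "D \<in> carrier_mat n n"
  shows "slash n k (four_block_mat A B C D) f Z =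
    Determinant.det (C * Z + D) powi (- k) * f ((A * Z + B) * mat_inv (C * Z + D))"
  by (simp add: slash_def split_four_block[OF assms])

lemma adjoint_four_block:
  fixes A B C D :: "complex mat"
  assumes "A \<in> carrier_mat n n" "B \<in> carrier_mat n n" "C \<in> carrier_mat n n" "D \<in> carrier_mat n n"
  shows "mat_adjoint (four_block_mat A B C D) =
    four_block_mat (mat_adjoint A) (mat_adjoint C) (mat_adjoint B) (mat_adjoint D)"
proof (rule eq_matI)
  note d = assms[THEN carrier_matD(1)] assms[THEN carrier_matD(2)]
  fix i j assume "i < dim_row (four_block_mat (mat_adjoint A) (mat_adjoint C) (mat_adjoint B) (mat_adjoint D))"
    "j < dim_col (four_block_mat (mat_adjoint A) (mat_adjoint C) (mat_adjoint B) (mat_adjoint D))"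
  then have ij: "i < n + n" "j < n + n" by (simp_all add: d)
  have "mat_adjoint (four_block_mat A B C D) $$ (i, j) = cnj (four_block_mat A B C D $$ (j, i))"
    using ij by (intro mat_adjoint_index) (simp_all add: d)
  also have "\<dots> = four_block_mat (mat_adjoint A) (mat_adjoint C) (mat_adjoint B) (mat_adjoint D) $$ (i, j)"
    using ij by (simp add: d)
  finally show "mat_adjoint (four_block_mat A B C D) $$ (i, j) =
    four_block_mat (mat_adjoint A) (mat_adjoint C) (mat_adjoint B) (mat_adjoint D) $$ (i, j)" .
qed (use assms in auto)

lemma upper_block_in_modular_group:
  assumes c: "P \<in> carrier_mat n n" "B \<in> carrier_mat n n" "V \<in> carrier_mat n n"
    and O: "\<And>i j. i < n \<Longrightarrow> j < n \<Longrightarrow> P $$ (i, j) \<in> ring_ints m"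
      "\<And>i j. i < n \<Longrightarrow> j < n \<Longrightarrow> B $$ (i, j) \<in> ring_ints m"
      "\<And>i j. i < n \<Longrightarrow> j < n \<Longrightarrow> V $$ (i, j) \<in> ring_ints m"
    and PV: "mat_adjoint P * V = 1\<^sub>m n" and VB: "mat_adjoint V * B = mat_adjoint B * V"
  shows "four_block_mat P B (0\<^sub>m n n) V \<in> hermitian_modular_group m n"
proof -
  let ?M = "four_block_mat P B (0\<^sub>m n n) V"
  have M: "?M \<in> carrier_mat (2 * n) (2 * n)" using c by (simp add: mult_2)
  have el: "elements_mat ?M \<subseteq> ring_ints m"
  proof
    fix x assume "x \<in> elements_mat ?M"
    then obtain i j where "i < n + n" "j < n + n" "x = ?M $$ (i, j)"
      using elements_matD[of x ?M] carrier_matD[OF c(1)] carrier_matD[OF c(3)] by (auto simp del: index_mat_four_block(1))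
    then show "x \<in> ring_ints m"
      using O carrier_matD[OF c(1)] carrier_matD[OF c(2)] carrier_matD[OF c(3)] by (auto simp: not_less)
  qed
  have ca: "mat_adjoint P \<in> carrier_mat n n" "mat_adjoint B \<in> carrier_mat n n" "mat_adjoint V \<in> carrier_mat n n"
    using c by auto
  have VP: "mat_adjoint V * P = 1\<^sub>m n"
    using mat_adjoint_mult[OF ca(1) c(3)] PV by simp
  have ad0: "mat_adjoint (0\<^sub>m n n :: complex mat) = 0\<^sub>m n n" by (intro eq_matI) auto
  have "mat_adjoint ?M * J_mat n = four_block_mat (0\<^sub>m n n) (- mat_adjoint P) (mat_adjoint V) (- mat_adjoint B)"
    unfolding J_mat_def using c ca
    by (subst adjoint_four_block, auto simp: ad0, subst mult_four_block_mat[of _ n n _ n _ n _ _ n _ n], auto)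
  also have "\<dots> * ?M = four_block_mat (0\<^sub>m n n) (- 1\<^sub>m n) (1\<^sub>m n) (0\<^sub>m n n)"
    using c ca by (subst mult_four_block_mat[of _ n n _ n _ n _ _ n _ n]) (auto simp: PV VP VB)
  finally have "mat_adjoint ?M * J_mat n * ?M = J_mat n" by (simp add: J_mat_def)
  then show ?thesis using M el by (simp add: hermitian_modular_group_def)
qed

text \<open>This covers translations, where \<open>U\<close> and \<open>V\<close> are the identity
  and \<open>B\<close> is Hermitian, and unimodular substitutions, where \<open>B\<close> is
  zero.\<close>

lemma modular_form_upper_block:
  assumes f: "f \<in> modular_forms m n k" and Z: "Z \<in> half_space n"
    and c: "U \<in> carrier_mat n n" "B \<in> carrier_mat n n" "V \<in> carrier_mat n n"
    and O: "\<And>i j. i < n \<Longrightarrow> j < n \<Longrightarrow> U $$ (i, j) \<in> ring_ints m"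
      "\<And>i j. i < n \<Longrightarrow> j < n \<Longrightarrow> B $$ (i, j) \<in> ring_ints m"
      "\<And>i j. i < n \<Longrightarrow> j < n \<Longrightarrow> V $$ (i, j) \<in> ring_ints m"
    and UV: "U * V = 1\<^sub>m n" and VB: "mat_adjoint V * B = mat_adjoint B * V"
  shows "Determinant.det V powi (- k) * f ((mat_adjoint U * Z + B) * U) = f Z"
proof -
  have Zc: "Z \<in> carrier_mat n n" using Z by (simp add: half_space_def)
  have VU: "V * U = 1\<^sub>m n" using mat_mult_left_right_inverse[OF c(1,3) UV] .
  have aU: "mat_adjoint U \<in> carrier_mat n n" using c by auto
  have M: "four_block_mat (mat_adjoint U) B (0\<^sub>m n n) V \<in> hermitian_modular_group m n"
    using c O UV VB by (intro upper_block_in_modular_group) auto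
  have "slash n k (four_block_mat (mat_adjoint U) B (0\<^sub>m n n) V) f Z = f Z"
    using f M Z by (auto simp: modular_forms_def)
  moreover have "0\<^sub>m n n * Z + V = V" using Zc c by simp
  moreover have "mat_inv V = U" by (rule mat_inv_eqI[OF c(3,1) VU])
  ultimately show ?thesis
    using slash_four_block[OF aU c(2) zero_carrier_mat c(3), of k f Z] by simp
qed

section \<open>Fourier expansion of a modular form\<close>

lemma mat_trace_add:
  assumes "A \<in> carrier_mat n n" "B \<in> carrier_mat n n" "C \<in> carrier_mat n n"
  shows "mat_trace (A * (B + C)) = mat_trace (A * B) + mat_trace (A * C)"
  unfolding mat_trace_mult[OF assms(1,2)] mat_trace_mult[OF assms(1,3)] mat_trace_mult[OF assms(1) add_carrier_mat[OF assms(3)]]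
  using assms by (simp add: distrib_left sum.distrib)

lemma mat_trace_smult:
  assumes "A \<in> carrier_mat n n" "B \<in> carrier_mat n n"
  shows "mat_trace (A * (c \<cdot>\<^sub>m B)) = c * mat_trace (A * B)"
  using assms by (simp add: mat_trace_mult[of _ n n] algebra_simps sum_distrib_left)

lemma mat_trace_hermitian_real:
  assumes "hermitian_mat n A" "hermitian_mat n B"
  shows "Im (mat_trace (A * B)) = 0"
proof -
  have c: "A \<in> carrier_mat n n" "B \<in> carrier_mat n n" using assms by (auto simp: hermitian_mat_def)
  have "cnj (mat_trace (A * B)) = (\<Sum>i<n. \<Sum>r<n. A $$ (r, i) * B $$ (i, r))"
    using assms by (simp add: mat_trace_mult[OF c] hermitian_index)
  also have "\<dots> = mat_trace (A * B)" by (subst sum.swap) (simp add: mat_trace_mult[OF c])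
  finally show ?thesis by (simp add: complex_eq_iff)
qed

lemma norm_mat_trace_le:
  assumes "A \<in> carrier_mat n n" "B \<in> carrier_mat n n"
  shows "norm (mat_trace (A * B)) \<le> mat_norm1 A * mat_norm1 B"
proof -
  have B: "cmod (B $$ (j, i)) \<le> mat_norm1 B" if "i < n" "j < n" for i j
  proof -
    have "cmod (B $$ (j, i)) \<le> (\<Sum>i<n. cmod (B $$ (j, i)))" using that by (intro member_le_sum) auto
    also have "\<dots> \<le> (\<Sum>j<n. \<Sum>i<n. cmod (B $$ (j, i)))"
      using that by (intro member_le_sum[of j _ "\<lambda>j. \<Sum>i<n. cmod (B $$ (j, i))"] sum_nonneg) auto
    finally show ?thesis using assms by (simp add: mat_norm1_def)
  qed
  have "norm (mat_trace (A * B)) \<le> (\<Sum>i<n. \<Sum>r<n. cmod (A $$ (i, r)) * mat_norm1 B)"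
    unfolding mat_trace_mult[OF assms] using B
    by (intro sum_norm_le) (auto simp: norm_mult intro!: mult_left_mono)
  also have "\<dots> = mat_norm1 A * mat_norm1 B" using assms by (simp add: mat_norm1_def sum_distrib_right)
  finally show ?thesis .
qed

lemma mat_norm1_nonneg: "mat_norm1 A \<ge> 0"
  by (simp add: mat_norm1_def sum_nonneg)

lemma mat_norm1_smult: "mat_norm1 (c \<cdot>\<^sub>m A) = cmod c * mat_norm1 A"
  by (simp add: mat_norm1_def norm_mult sum_distrib_left)

lemma mat_norm1_zmat_le:
  assumes "\<And>p. p \<in> idx n \<Longrightarrow> cmod (e p) \<le> r"
  shows "mat_norm1 (zmat m n e) \<le> real n * real n * (r * (1 + cmod (om m)))"
proof -
  have "cmod (zmat m n e $$ (i, j)) \<le> r * (1 + cmod (om m))" if ij: "i < n" "j < n" for i j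
  proof -
    have r: "cmod (e (i, j)) \<le> r" "cmod (e (j, i)) \<le> r" using assms ij by (auto simp: idx_def)
    then have r0: "0 \<le> r" using norm_ge_zero order_trans by blast
    have *: "cmod (a + b * w) \<le> r * (1 + cmod w)" if "cmod a \<le> r" "cmod b \<le> r" for a b w
      using norm_triangle_ineq[of a "b * w"] that mult_right_mono[of "cmod b" r "cmod w"]
      by (simp add: norm_mult algebra_simps)
    show ?thesis
      using *[OF r(1,2), of "om m"] *[OF r(2,1), of "cnj (om m)"] *[OF r(1), of 0 "om m"] r0 ij
      by (auto simp: zmat_def)
  qed
  then have "mat_norm1 (zmat m n e) \<le> (\<Sum>i<n. \<Sum>j<n. r * (1 + cmod (om m)))"
    unfolding mat_norm1_def by (simp del: sum_constant) (intro sum_mono, auto)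
  then show ?thesis by (simp add: mult.assoc)
qed

lemma hermitian_zmat_real:
  assumes m: "m > 0" and X: "hermitian_mat n X"
  obtains x where "X = zmat m n (\<lambda>p. of_real (x p))"
proof -
  have Xc: "X \<in> carrier_mat n n" using X by (simp add: hermitian_mat_def)
  obtain w where w: "X = zmat m n w" using zmat_surj[OF m Xc] by blast
  have "zmat m n (\<lambda>p. of_real (Re (w p))) = zmat m n (\<lambda>p. (1 / 2) * (w p + cnj (w p)))"
    by (intro zmat_cong) (simp add: complex_eq_iff)
  also have "\<dots> = (1 / 2) \<cdot>\<^sub>m (X + mat_adjoint X)"
    unfolding w zmat_adjoint by (simp only: zmat_smult zmat_add)
  also have "\<dots> = X" using X by (intro eq_matI) (auto simp: hermitian_mat_def)
  finally show ?thesis using that by metis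
qed

lemma ee_half: "ee (1 / 2) = -1"
  by (simp add: ee_def exp_eq_polar cis_conv_exp[symmetric] mult.commute)

text \<open>The characters at \<open>T\<close> and \<open>T'\<close> are separated at a multiple of \<open>T' - T\<close> itself.\<close>

lemma hermitian_series_unique:
  assumes m: "m > 0" and S: "\<And>T. T \<in> S \<Longrightarrow> hermitian_mat n T" and Z: "Z \<in> carrier_mat n n"
    and sum: "\<And>x. ((\<lambda>T. a T * ee (mat_trace (T * (Z + zmat m n (\<lambda>p. of_real (x p)))))) has_sum 0) S"
    and T: "T \<in> S"
  shows "a T = 0"
proof -
  define ch where "ch T x = ee (mat_trace (T * zmat m n (\<lambda>p. of_real (x p))))" for T and x :: "nat \<times> nat \<Rightarrow> real"
  have c: "T \<in> carrier_mat n n" if "T \<in> S" for T using S[OF that] by (simp add: hermitian_mat_def)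
  have aT: "a T * ee (mat_trace (T * Z)) = 0"
  proof (rule character_sum_zero[where ch = ch and S = S and ?t0.0 = T and c = "\<lambda>T. a T * ee (mat_trace (T * Z))" and pl = "\<lambda>x y p. x p + y p"])
    fix T x assume "T \<in> S"
    then show "norm (ch T x) = 1"
      unfolding ch_def norm_ee using mat_trace_hermitian_real[OF S zmat_real_hermitian] by simp
  next
    fix T x y assume T: "T \<in> S"
    show "ch T (\<lambda>p. x p + y p) = ch T x * ch T y"
      unfolding ch_def of_real_add zmat_add using c[OF T] by (simp add: mat_trace_add[of _ n] ee_add)
  next
    fix x
    show "((\<lambda>T. a T * ee (mat_trace (T * Z)) * ch T x) has_sum 0) S"
      by (rule has_sum_cong[THEN iffD1, OF _ sum[of x]])
         (use c Z in \<open>simp add: ch_def mat_trace_add[of _ n] ee_add\<close>)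
  next
    fix T' assume T': "T' \<in> S" "T' \<noteq> T"
    define X where "X = T' - T"
    have cc: "T' \<in> carrier_mat n n" "T \<in> carrier_mat n n" using c T' T by auto
    have X: "hermitian_mat n X" "X \<in> carrier_mat n n"
    proof -
      have "mat_adjoint X = X"
        using S[OF T'(1)] S[OF T] cc hermitian_index[OF S[OF T'(1)]] hermitian_index[OF S[OF T]]
        by (intro eq_matI) (auto simp: X_def)
      then show "hermitian_mat n X" "X \<in> carrier_mat n n" using cc by (auto simp: hermitian_mat_def X_def)
    qed
    obtain x where x: "X = zmat m n (\<lambda>p. of_real (x p))" using hermitian_zmat_real[OF m X(1)] by blast
    define q where "q = (\<Sum>i<n. \<Sum>j<n. (cmod (X $$ (i, j)))\<^sup>2)"
    have trX: "mat_trace (X * X) = of_real q"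
      using hermitian_index[OF X(1)]
      by (simp add: mat_trace_mult[OF X(2,2)] q_def complex_norm_square del: of_real_power)
    have "q \<noteq> 0"
    proof
      assume "q = 0"
      then have "X $$ (i, j) = 0" if "i < n" "j < n" for i j
        using that unfolding q_def by (simp add: sum_nonneg_eq_0_iff sum_nonneg)
      then have "T' $$ (i, j) = T $$ (i, j)" if "i < n" "j < n" for i j
        using that cc by (auto simp: X_def)
      then have "T' = T" using cc by (intro eq_matI) auto
      then show False using T' by simp
    qed
    \<comment> \<open>\<open>q\<close> is the trace of \<open>X * X\<close>, so this scaling changes
      the trace by one half between \<open>T\<close> and \<open>T'\<close>, and
      \<open>ee (1 / 2) = -1\<close>.\<close>
    define y where "y p = x p / (2 * q)" for p
    have "zmat m n (\<lambda>p. of_real (y p)) = (1 / (2 * of_real q)) \<cdot>\<^sub>m X"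
      unfolding x zmat_smult[symmetric] by (rule arg_cong[where f = "zmat m n"]) (simp add: y_def)
    then have chy: "ch A y = ee (1 / (2 * of_real q) * mat_trace (A * X))" if "A \<in> carrier_mat n n" for A
      unfolding ch_def using that X by (simp only: mat_trace_smult)
    have "mat_trace (T' * X) = mat_trace (T * X) + mat_trace (X * X)"
      unfolding mat_trace_mult[OF cc(1) X(2)] mat_trace_mult[OF cc(2) X(2)] mat_trace_mult[OF X(2) X(2)] sum.distrib[symmetric]
      by (intro sum.cong refl) (use cc in \<open>auto simp: X_def ring_distribs\<close>)
    then have "ch T' y = ee (1 / (2 * of_real q) * mat_trace (T * X) + 1 / 2)"
      using \<open>q \<noteq> 0\<close> by (simp add: chy[OF cc(1)] trX field_simps)
    then have "ch T' y = - ch T y" by (simp add: ee_add ee_half chy[OF cc(2)])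
    then show "\<exists>x. ch T' x = - ch T x" by blast
  qed (rule T)
  show ?thesis using aT by simp
qed

lemma pos_def_convex:
  assumes A: "pos_def n A" and B: "pos_def n B" and s: "0 \<le> s" "s \<le> 1"
  shows "pos_def n (of_real (1 - s) \<cdot>\<^sub>m A + of_real s \<cdot>\<^sub>m B)"
proof -
  have c: "A \<in> carrier_mat n n" "B \<in> carrier_mat n n" using A B by (auto simp: pos_def_def hermitian_mat_def)
  have hA: "hermitian_mat n A" and hB: "hermitian_mat n B" using A B by (auto simp: pos_def_def)
  have "mat_adjoint (of_real (1 - s) \<cdot>\<^sub>m A + of_real s \<cdot>\<^sub>m B) = of_real (1 - s) \<cdot>\<^sub>m A + of_real s \<cdot>\<^sub>m B"
    using c hermitian_index[OF hA] hermitian_index[OF hB] by (intro eq_matI) auto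
  moreover have "Re (hform (of_real (1 - s) \<cdot>\<^sub>m A + of_real s \<cdot>\<^sub>m B) v v) > 0"
    if v: "v \<in> carrier_vec n" "v \<noteq> 0\<^sub>v n" for v
  proof -
    have "Re (hform (of_real (1 - s) \<cdot>\<^sub>m A + of_real s \<cdot>\<^sub>m B) v v) = (1 - s) * Re (hform A v v) + s * Re (hform B v v)"
      using c v by (simp add: hform_add_mat[of _ n] hform_smult_mat[of _ n] del: of_real_diff)
    moreover have "Re (hform A v v) > 0" "Re (hform B v v) > 0" using A B v by (auto simp: pos_def_alt)
    moreover have "(1 - s) * a + s * b > 0" if "a > 0" "b > 0" for a b :: real
      using s that by (cases "s = 0") (auto intro!: add_nonneg_pos)
    ultimately show ?thesis by simp
  qed
  ultimately show ?thesis using c by (auto simp: pos_def_alt hermitian_mat_def)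
qed

definition cone :: "nat \<Rightarrow> nat \<Rightarrow> (nat \<times> nat \<Rightarrow> real) \<Rightarrow> bool" where
  "cone m n y \<longleftrightarrow> pos_def n (zmat m n (\<lambda>p. of_real (y p)))"

lemma cone_open:
  assumes "cone m n y0"
  obtains r where "r > 0" "\<And>y. (\<And>p. p \<in> idx n \<Longrightarrow> \<bar>y p - y0 p\<bar> \<le> r) \<Longrightarrow> cone m n y"
proof -
  let ?Y = "\<lambda>y. zmat m n (\<lambda>p. of_real (y p))"
  obtain \<epsilon> where \<epsilon>: "\<epsilon> > 0" "\<And>v. v \<in> carrier_vec n \<Longrightarrow> Re (hform (?Y y0) v v) \<ge> \<epsilon> * sqnorm v"
    using pos_def_lower_bound assms unfolding cone_def by blast
  \<comment> \<open>Up to the summand 1, which keeps it positive and the last inequality strict, the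
    factor by which \<open>mat_norm1\<close> can exceed the largest coordinate.\<close>
  define K where "K = real n * real n * (1 + cmod (om m)) + 1"
  have K: "K > 0" unfolding K_def by (intro add_nonneg_pos mult_nonneg_nonneg) auto
  have "cone m n y" if y: "\<And>p. p \<in> idx n \<Longrightarrow> \<bar>y p - y0 p\<bar> \<le> \<epsilon> / K" for y
  proof -
    let ?E = "zmat m n (\<lambda>p. of_real (y p - y0 p))"
    have eq: "?Y y = ?Y y0 + ?E" by (simp flip: zmat_add)
    have "mat_norm1 ?E \<le> real n * real n * (\<epsilon> / K * (1 + cmod (om m)))"
      using y by (intro mat_norm1_zmat_le) (simp flip: of_real_diff)
    also have "\<dots> = \<epsilon> / K * (K - 1)" by (simp add: K_def algebra_simps)
    also have "\<dots> < \<epsilon>" using K \<epsilon> by (simp add: field_simps)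
    finally have lt: "mat_norm1 ?E < \<epsilon>" .
    have he: "hermitian_mat n (?Y y0 + ?E)" unfolding eq[symmetric] by (rule zmat_real_hermitian)
    show ?thesis
      unfolding cone_def eq by (rule pos_def_perturb[OF _ zmat_carrier zmat_carrier lt he]) (rule \<epsilon>(2))
  qed
  then show ?thesis using that[of "\<epsilon> / K"] \<epsilon> K by simp
qed

section \<open>The modular form in coordinates\<close>

context
  fixes m n :: nat and k :: int and f :: "complex mat \<Rightarrow> complex"
  assumes sq: "squarefree m" and f: "f \<in> modular_forms m n k"
begin

lemma m_pos: "m > 0"
  using sq by (metis not_squarefree_0 gr0I)

lemma half_space_cone: "zmat m n z \<in> half_space n \<longleftrightarrow> cone m n (\<lambda>p. Im (z p))"
  by (simp add: half_space_zmat_iff cone_def)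

lemma modular_form_periodic:
  assumes z: "zmat m n z \<in> half_space n"
  shows "f (zmat m n (\<lambda>p. z p + of_int (\<kappa> p))) = f (zmat m n z)"
proof -
  let ?H = "zmat m n (\<lambda>p. of_int (\<kappa> p))"
  have H: "mat_adjoint ?H = ?H" by (simp add: zmat_adjoint)
  have "?H $$ (i, j) \<in> ring_ints m" if "i < n" "j < n" for i j
    using that sq by (auto simp: zmat_def)
  then have "Determinant.det (1\<^sub>m n) powi (- k) * f ((mat_adjoint (1\<^sub>m n) * zmat m n z + ?H) * 1\<^sub>m n) = f (zmat m n z)"
    by (intro modular_form_upper_block[OF f z]) (auto simp: H)
  then show ?thesis by (simp add: zmat_add)
qed

lemma modular_form_locally_bounded:
  assumes "Z \<in> half_space n"
  obtains \<delta> B where "\<delta> > 0" "\<And>W. W \<in> half_space n \<Longrightarrow> mat_norm1 (W - Z) < \<delta> \<Longrightarrow> norm (f W) \<le> B"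
proof -
  obtain D where D: "D \<in> carrier_mat n n" "\<And>\<epsilon>. \<epsilon> > 0 \<Longrightarrow> \<exists>\<delta>>0. \<forall>W\<in>half_space n. mat_norm1 (W - Z) < \<delta> \<longrightarrow>
        cmod (f W - f Z - mat_trace (D * (W - Z))) \<le> \<epsilon> * mat_norm1 (W - Z)"
    using f assms unfolding modular_forms_def holomorphic_on_half_space_def by blast
  obtain \<delta> where \<delta>: "\<delta> > 0" "\<And>W. W \<in> half_space n \<Longrightarrow> mat_norm1 (W - Z) < \<delta> \<Longrightarrow>
        cmod (f W - f Z - mat_trace (D * (W - Z))) \<le> 1 * mat_norm1 (W - Z)"
    using D(2)[of 1] by auto
  have "norm (f W) \<le> cmod (f Z) + mat_norm1 D + 1" if W: "W \<in> half_space n" "mat_norm1 (W - Z) < min \<delta> 1" for W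
  proof -
    have c: "W - Z \<in> carrier_mat n n" using W assms by (auto simp: half_space_def)
    have "f W = f Z + (f W - f Z - mat_trace (D * (W - Z))) + mat_trace (D * (W - Z))" by simp
    then have "norm (f W) \<le> norm (f Z) + norm (f W - f Z - mat_trace (D * (W - Z))) + norm (mat_trace (D * (W - Z)))"
      by (metis norm_triangle_ineq norm_triangle_mono order_refl)
    moreover have "norm (mat_trace (D * (W - Z))) \<le> mat_norm1 D * 1"
      using norm_mat_trace_le[OF D(1) c] W mult_left_mono[of "mat_norm1 (W - Z)" 1 "mat_norm1 D"] mat_norm1_nonneg[of D] by simp
    ultimately show ?thesis using \<delta>(2)[OF W(1)] W(2) by simp
  qed
  then show ?thesis using that[of "min \<delta> 1"] \<delta>(1) by auto
qed

text \<open>Periodicity moves the real parts into \<open>{0..1}\<close>, and the imaginary parts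
  range over a closed box inside the cone. With the coordinates outside \<open>idx n\<close> frozen
  at 0 this is a product of compact sets, on which local bounds combine into one.\<close>

lemma modular_form_bounded_tube:
  assumes cone: "\<And>y. (\<And>p. p \<in> idx n \<Longrightarrow> \<bar>y p - y0 p\<bar> \<le> r) \<Longrightarrow> cone m n y"
  obtains M where "\<And>z. z \<in> tube (idx n) y0 r \<Longrightarrow> norm (f (zmat m n z)) \<le> M"
proof -
  define Q where "Q p = (if p \<in> idx n then {w. Re w \<in> {0..1} \<and> Im w \<in> {y0 p - r..y0 p + r}} else {0})" for p
  define K where "K = PiE UNIV Q"
  have "compact (Q p)" for p
  proof -
    have "{w. Re w \<in> {0..1} \<and> Im w \<in> {y0 p - r..y0 p + r}} = cbox (Complex 0 (y0 p - r)) (Complex 1 (y0 p + r))"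
      by (auto simp: in_cbox_complex_iff)
    then show ?thesis by (simp add: Q_def)
  qed
  then have "compact K"
    unfolding K_def using compactin_PiE[of "\<lambda>_. euclidean" UNIV Q]
    by (simp add: euclidean_product_topology)
  have KH: "zmat m n z \<in> half_space n" if "z \<in> K" for z
    unfolding half_space_cone
  proof (rule cone)
    fix p assume p: "p \<in> idx n"
    have "z p \<in> Q p" using that by (auto simp: K_def)
    then show "\<bar>Im (z p) - y0 p\<bar> \<le> r" using p by (auto simp: Q_def abs_le_iff)
  qed
  have "\<exists>A B. open A \<and> z \<in> A \<and> (\<forall>w\<in>A \<inter> K. norm (f (zmat m n w)) \<le> B)" if z: "z \<in> K" for z
  proof -
    obtain \<delta> B where \<delta>: "\<delta> > 0" "\<And>W. W \<in> half_space n \<Longrightarrow> mat_norm1 (W - zmat m n z) < \<delta> \<Longrightarrow> norm (f W) \<le> B"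
      using modular_form_locally_bounded[OF KH[OF z]] by blast
    define c where "c = real n * real n * (1 + cmod (om m)) + 1"
    have c: "c > 0" unfolding c_def by (intro add_nonneg_pos mult_nonneg_nonneg) auto
    define A where "A = PiE UNIV (\<lambda>p. if p \<in> idx n then ball (z p) (\<delta> / c) else UNIV)"
    have "open A"
      unfolding A_def by (intro open_PiE) (auto intro: finite_subset[OF _ finite_idx])
    moreover have "z \<in> A" using \<delta> c by (auto simp: A_def)
    moreover have "norm (f (zmat m n w)) \<le> B" if w: "w \<in> A \<inter> K" for w
    proof (rule \<delta>(2)[OF KH])
      have "mat_norm1 (zmat m n (\<lambda>p. w p - z p)) \<le> real n * real n * (\<delta> / c * (1 + cmod (om m)))"
      proof (rule mat_norm1_zmat_le)
        fix p assume p: "p \<in> idx n"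
        have "w p \<in> (if p \<in> idx n then ball (z p) (\<delta> / c) else UNIV)"
          by (rule PiE_mem[of w UNIV]) (use w in \<open>auto simp: A_def\<close>)
        then have "w p \<in> ball (z p) (\<delta> / c)" using p by simp
        then show "cmod (w p - z p) \<le> \<delta> / c" by (simp add: dist_norm norm_minus_commute)
      qed
      also have "\<dots> = \<delta> / c * (c - 1)" by (simp add: c_def algebra_simps)
      also have "\<dots> < \<delta>" using c \<delta> by (simp add: field_simps)
      finally show "mat_norm1 (zmat m n w - zmat m n z) < \<delta>" by (simp add: zmat_diff)
    qed (use w in auto)
    ultimately show ?thesis by blast
  qed
  then obtain A B where AB: "\<And>z. z \<in> K \<Longrightarrow> open (A z)" "\<And>z. z \<in> K \<Longrightarrow> z \<in> A z"
    "\<And>z w. z \<in> K \<Longrightarrow> w \<in> A z \<inter> K \<Longrightarrow> norm (f (zmat m n w)) \<le> B z"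
    by metis
  obtain C where C: "C \<subseteq> K" "finite C" "K \<subseteq> (\<Union>c\<in>C. A c)"
    using compactE_image[OF \<open>compact K\<close>, of K A] AB by blast
  define M where "M = (\<Sum>z\<in>C. \<bar>B z\<bar>)"
  have M: "norm (f (zmat m n w)) \<le> M" if w: "w \<in> K" for w
  proof -
    obtain z where z: "z \<in> C" "w \<in> A z" using C w by blast
    have "norm (f (zmat m n w)) \<le> \<bar>B z\<bar>" using AB(3)[of z w] z C w by force
    also have "\<dots> \<le> M" unfolding M_def using z C by (intro member_le_sum) auto
    finally show ?thesis .
  qed
  have "norm (f (zmat m n z)) \<le> M" if z: "z \<in> tube (idx n) y0 r" for z
  proof -
    define w where "w p = (if p \<in> idx n then z p + of_int (- \<lfloor>Re (z p)\<rfloor>) else 0)" for p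
    have zH: "zmat m n z \<in> half_space n"
      unfolding half_space_cone using z by (intro cone) (auto simp: tube_def intro: less_imp_le)
    have "zmat m n w = zmat m n (\<lambda>p. z p + of_int (- \<lfloor>Re (z p)\<rfloor>))"
      by (intro zmat_cong) (simp add: w_def)
    then have "f (zmat m n w) = f (zmat m n z)"
      using modular_form_periodic[OF zH, of "\<lambda>p. - \<lfloor>Re (z p)\<rfloor>"] by simp
    moreover have "w \<in> K"
      unfolding K_def
    proof (rule PiE_I)
      fix p
      have "\<bar>Im (z p) - y0 p\<bar> < r" if "p \<in> idx n" using z that by (auto simp: tube_def)
      then show "w p \<in> Q p" by (auto simp: w_def Q_def abs_less_iff) linarith+
    qed simp
    ultimately show ?thesis using M by metis
  qed
  then show ?thesis using that by blast
qed

lemma modular_form_separately_holomorphic: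
  assumes cone: "\<And>y. (\<And>p. p \<in> idx n \<Longrightarrow> \<bar>y p - y0 p\<bar> \<le> r) \<Longrightarrow> cone m n y"
    and z: "z \<in> tube (idx n) y0 r" and p: "p \<in> idx n"
  shows "(\<lambda>w. f (zmat m n (z(p := w)))) holomorphic_on strip (y0 p) r"
proof (rule holomorphic_onI)
  let ?z = "\<lambda>w. zmat m n (z(p := w))"
  have H: "?z w \<in> half_space n" if "w \<in> strip (y0 p) r" for w
    unfolding half_space_cone
    by (rule cone) (use z that in \<open>auto simp: tube_def strip_def intro: less_imp_le\<close>)
  fix w assume w: "w \<in> strip (y0 p) r"
  obtain D where D: "D \<in> carrier_mat n n" "\<And>\<epsilon>. \<epsilon> > 0 \<Longrightarrow> \<exists>\<delta>>0. \<forall>W\<in>half_space n. mat_norm1 (W - ?z w) < \<delta> \<longrightarrow>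
        cmod (f W - f (?z w) - mat_trace (D * (W - ?z w))) \<le> \<epsilon> * mat_norm1 (W - ?z w)"
    using f H[OF w] unfolding modular_forms_def holomorphic_on_half_space_def by blast
  define E where "E = zmat m n (\<lambda>q. if q = p then 1 else 0)"
  have E: "E \<in> carrier_mat n n" by (simp add: E_def)
  have diff: "?z v - ?z w = (v - w) \<cdot>\<^sub>m E" for v
    unfolding E_def zmat_smult[symmetric] zmat_diff[symmetric] by (intro zmat_cong) auto
  define c where "c = mat_norm1 E + 1"
  have c: "c > 0" using mat_norm1_nonneg[of E] by (simp add: c_def)
  have "((\<lambda>v. f (?z v)) has_field_derivative mat_trace (D * E)) (at w within strip (y0 p) r)"
    unfolding has_field_derivative_iff Lim_within
  proof (intro allI impI)
    fix e :: real assume e: "e > 0"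
    obtain \<delta> where \<delta>: "\<delta> > 0" "\<And>W. W \<in> half_space n \<Longrightarrow> mat_norm1 (W - ?z w) < \<delta> \<Longrightarrow>
        cmod (f W - f (?z w) - mat_trace (D * (W - ?z w))) \<le> e / (2 * c) * mat_norm1 (W - ?z w)"
      using D(2)[of "e / (2 * c)"] e c by auto
    show "\<exists>d>0. \<forall>v\<in>strip (y0 p) r. 0 < dist v w \<and> dist v w < d \<longrightarrow>
        dist ((f (?z v) - f (?z w)) / (v - w)) (mat_trace (D * E)) < e"
    proof (intro exI[of _ "\<delta> / c"] conjI ballI impI)
      show "\<delta> / c > 0" using \<delta> c by simp
      fix v assume v: "v \<in> strip (y0 p) r" "0 < dist v w \<and> dist v w < \<delta> / c"
      have nE: "mat_norm1 (?z v - ?z w) = cmod (v - w) * mat_norm1 E" by (simp add: diff mat_norm1_smult)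
      have lt: "cmod (v - w) * c < \<delta>" using v c by (simp add: dist_norm field_simps)
      have le: "mat_norm1 (?z v - ?z w) \<le> cmod (v - w) * c"
        unfolding nE c_def by (intro mult_left_mono) auto
      have "cmod (f (?z v) - f (?z w) - mat_trace (D * (?z v - ?z w))) \<le> e / (2 * c) * mat_norm1 (?z v - ?z w)"
        by (rule \<delta>(2)[OF H[OF v(1)]]) (use le lt in linarith)
      also have "\<dots> \<le> e / (2 * c) * (cmod (v - w) * c)" using le e c by (intro mult_left_mono) auto
      also have "\<dots> = e / 2 * cmod (v - w)" using c by simp
      finally have b: "cmod (f (?z v) - f (?z w) - (v - w) * mat_trace (D * E)) \<le> e / 2 * cmod (v - w)"
        by (simp only: diff mat_trace_smult[OF D(1) E])
      have vw: "v \<noteq> w" using v by auto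
      have "dist ((f (?z v) - f (?z w)) / (v - w)) (mat_trace (D * E)) =
          cmod ((f (?z v) - f (?z w) - (v - w) * mat_trace (D * E)) / (v - w))"
        using vw by (simp add: dist_norm diff_divide_distrib)
      also have "\<dots> \<le> e / 2" using b vw by (simp add: norm_divide divide_le_eq)
      also have "\<dots> < e" using e by simp
      finally show "dist ((f (?z v) - f (?z w)) / (v - w)) (mat_trace (D * E)) < e" .
    qed
  qed
  then show "(\<lambda>w. f (?z w)) field_differentiable at w within strip (y0 p) r"
    unfolding field_differentiable_def by blast
qed

text \<open>Only one value of the imaginary part is involved, so one can ask whether a given family
  of coefficients stays valid as \<open>y\<close> moves.\<close>

definition slice_expansion :: "(nat \<times> nat \<Rightarrow> real) \<Rightarrow> (complex mat \<Rightarrow> complex) \<Rightarrow> bool" where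
  "slice_expansion y \<alpha> \<longleftrightarrow> (\<forall>z. (\<forall>p\<in>idx n. Im (z p) = y p) \<longrightarrow>
     ((\<lambda>T. \<alpha> T * ee (mat_trace (T * zmat m n z))) has_sum f (zmat m n z)) (herm_lattice m n))"

lemma slice_expansion_local:
  assumes "cone m n y0"
  obtains r \<alpha> where "r > 0" "\<And>y. (\<And>p. p \<in> idx n \<Longrightarrow> \<bar>y p - y0 p\<bar> < r) \<Longrightarrow> slice_expansion y \<alpha>"
proof -
  obtain r where r: "r > 0" "\<And>y. (\<And>p. p \<in> idx n \<Longrightarrow> \<bar>y p - y0 p\<bar> \<le> r) \<Longrightarrow> cone m n y"
    using cone_open[OF assms] by blast
  obtain M where M: "\<And>z. z \<in> tube (idx n) y0 r \<Longrightarrow> norm (f (zmat m n z)) \<le> M"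
    using modular_form_bounded_tube[of y0 r] r(2) by blast
  have tH: "zmat m n z \<in> half_space n" if "z \<in> tube (idx n) y0 r" for z
    unfolding half_space_cone using that by (intro r(2)) (auto simp: tube_def intro: less_imp_le)
  have "\<exists>c. (\<forall>t\<in>PiE (idx n) (\<lambda>_. UNIV). \<forall>y' M'. (\<forall>i\<in>idx n. \<bar>y' i - y0 i\<bar> < r) \<longrightarrow>
          (\<forall>z. (\<forall>i\<in>idx n. Im (z i) = y' i) \<longrightarrow> norm (f (zmat m n z)) \<le> M') \<longrightarrow>
          norm (c t) \<le> M' * exp (2 * pi * (\<Sum>i\<in>idx n. of_int (t i) * y' i))) \<and>
      (\<forall>z\<in>tube (idx n) y0 r. ((\<lambda>t. c t * ee (\<Sum>i\<in>idx n. of_int (t i) * z i)) has_sum f (zmat m n z)) (PiE (idx n) (\<lambda>_. UNIV)))"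
  proof (rule fourier_tube[OF finite_idx r(1)])
    show "f (zmat m n z) = f (zmat m n z')" if "\<And>i. i \<in> idx n \<Longrightarrow> z i = z' i" for z z'
      using zmat_cong[OF that, where m = m] by simp
    show "f (zmat m n (z(i := z i + 1))) = f (zmat m n z)" if "z \<in> tube (idx n) y0 r" "i \<in> idx n" for z i
    proof -
      have "(\<lambda>p. z p + of_int (if p = i then 1 else 0)) = z(i := z i + 1)" by auto
      then show ?thesis using modular_form_periodic[OF tH[OF that(1)], of "\<lambda>p. if p = i then 1 else 0"] by simp
    qed
    show "(\<lambda>w. f (zmat m n (z(i := w)))) holomorphic_on strip (y0 i) r" if "z \<in> tube (idx n) y0 r" "i \<in> idx n" for z i
      by (rule modular_form_separately_holomorphic[OF r(2) that])
  qed (rule M)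
  then obtain c where "\<forall>z\<in>tube (idx n) y0 r.
      ((\<lambda>t. c t * ee (\<Sum>i\<in>idx n. of_int (t i) * z i)) has_sum f (zmat m n z)) (PiE (idx n) (\<lambda>_. UNIV))"
    by (elim exE conjE) (rule that)
  note c = bspec[OF this]
  \<comment> \<open>Translation from integer coordinates to lattice matrices;
    \<open>bij_betw_tmat\<close> makes the inverse meaningful.\<close>
  define \<alpha> where "\<alpha> T = c (the_inv_into (PiE (idx n) (\<lambda>_. UNIV)) (tmat m n) T)" for T
  have \<alpha>: "\<alpha> (tmat m n t) = c t" if "t \<in> PiE (idx n) (\<lambda>_. UNIV)" for t
    using bij_betw_tmat[OF sq, of n] that by (simp add: \<alpha>_def bij_betw_def the_inv_into_f_f)
  have "slice_expansion y \<alpha>" if y: "\<And>p. p \<in> idx n \<Longrightarrow> \<bar>y p - y0 p\<bar> < r" for y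
    unfolding slice_expansion_def
  proof (intro allI impI)
    fix z assume z: "\<forall>p\<in>idx n. Im (z p) = y p"
    have "z \<in> tube (idx n) y0 r" using z y by (auto simp: tube_def)
    from c[OF this] have "((\<lambda>t. \<alpha> (tmat m n t) * ee (mat_trace (tmat m n t * zmat m n z))) has_sum f (zmat m n z)) (PiE (idx n) (\<lambda>_. UNIV))"
      by (rule has_sum_cong[THEN iffD1, rotated]) (simp add: \<alpha> trace_tmat_zmat[OF m_pos])
    then show "((\<lambda>T. \<alpha> T * ee (mat_trace (T * zmat m n z))) has_sum f (zmat m n z)) (herm_lattice m n)"
      by (subst (asm) has_sum_reindex_bij_betw[OF bij_betw_tmat[OF sq]])
  qed
  then show ?thesis using that r(1) by blast
qed

lemma slice_expansion_unique:
  assumes "slice_expansion y \<alpha>" "slice_expansion y \<beta>" "T \<in> herm_lattice m n"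
  shows "\<alpha> T = \<beta> T"
proof -
  have "\<alpha> T - \<beta> T = 0"
  proof (rule hermitian_series_unique[OF m_pos _ _ _ assms(3), where Z = "zmat m n (\<lambda>p. \<i> * of_real (y p))"])
    fix x :: "nat \<times> nat \<Rightarrow> real"
    let ?Z = "zmat m n (\<lambda>p. \<i> * of_real (y p) + of_real (x p))"
    have "((\<lambda>T. \<alpha> T * ee (mat_trace (T * ?Z)) + - (\<beta> T * ee (mat_trace (T * ?Z)))) has_sum (f ?Z + - f ?Z)) (herm_lattice m n)"
      using assms(1,2) by (intro has_sum_add has_sum_uminusI) (simp_all add: slice_expansion_def)
    then show "((\<lambda>T. (\<alpha> T - \<beta> T) * ee (mat_trace (T * (zmat m n (\<lambda>p. \<i> * of_real (y p)) + zmat m n (\<lambda>p. of_real (x p)))))) has_sum 0) (herm_lattice m n)"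
      by (simp add: zmat_add left_diff_distrib)
  qed (auto simp: herm_lattice_def)
  then show ?thesis by simp
qed

text \<open>The segment from \<open>y0\<close> to \<open>y1\<close> stays in the convex cone. Near
  each of its points one family serves all slices, and by uniqueness every family valid on one of
  them agrees with it on the lattice. Validity of a family is thus locally constant along a
  connected interval.\<close>

lemma slice_expansion_transfer:
  assumes c: "cone m n y0" "cone m n y1" and \<alpha>: "slice_expansion y0 \<alpha>"
  shows "slice_expansion y1 \<alpha>"
proof -
  define y where "y s p = (1 - s) * y0 p + s * y1 p" for s p
  \<comment> \<open>Comparing all families at once makes \<open>R\<close> an equivalence
    relation.\<close>
  define R where "R a b \<longleftrightarrow> (\<forall>\<alpha>. slice_expansion (y a) \<alpha> \<longleftrightarrow> slice_expansion (y b) \<alpha>)" for a b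
  have eq: "slice_expansion y' \<alpha> = slice_expansion y' \<beta>" if "\<And>T. T \<in> herm_lattice m n \<Longrightarrow> \<alpha> T = \<beta> T" for y' \<alpha> \<beta>
    unfolding slice_expansion_def using that by (simp cong: has_sum_cong)
  have cone: "cone m n (y s)" if "s \<in> {0..1}" for s
  proof -
    have "zmat m n (\<lambda>p. of_real (y s p)) = of_real (1 - s) \<cdot>\<^sub>m zmat m n (\<lambda>p. of_real (y0 p)) + of_real s \<cdot>\<^sub>m zmat m n (\<lambda>p. of_real (y1 p))"
      unfolding zmat_smult[symmetric] zmat_add[symmetric] by (simp add: y_def)
    then show ?thesis using pos_def_convex[of n _ _ s] c that unfolding cone_def by simp
  qed
  have "R 0 1"
  proof (rule connected_equivalence_relation[of "{0..1::real}"])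
    fix a :: real assume a: "a \<in> {0..1}"
    obtain r \<beta> where r: "r > 0" "\<And>y'. (\<And>p. p \<in> idx n \<Longrightarrow> \<bar>y' p - y a p\<bar> < r) \<Longrightarrow> slice_expansion y' \<beta>"
      using slice_expansion_local[OF cone[OF a]] by blast
    \<comment> \<open>A bound for the speed of every coordinate along the segment; the parameter may
      move by \<open>r / C\<close>.\<close>
    define C where "C = (\<Sum>p\<in>idx n. \<bar>y1 p - y0 p\<bar>) + 1"
    have C: "C > 0" unfolding C_def by (intro add_nonneg_pos sum_nonneg) auto
    have loc: "slice_expansion (y b) \<beta>" if b: "b \<in> ball a (r / C)" for b
    proof (rule r(2))
      fix p assume p: "p \<in> idx n"
      have "\<bar>y1 p - y0 p\<bar> \<le> (\<Sum>p\<in>idx n. \<bar>y1 p - y0 p\<bar>)" using p by (intro member_le_sum) auto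
      then have pC: "\<bar>y1 p - y0 p\<bar> \<le> C" by (simp add: C_def)
      have "y b p - y a p = (b - a) * (y1 p - y0 p)" by (simp add: y_def algebra_simps)
      then have "\<bar>y b p - y a p\<bar> \<le> \<bar>b - a\<bar> * C" using pC by (simp add: abs_mult mult_left_mono)
      also have "\<dots> < r" using b C by (simp add: dist_real_def abs_minus_commute field_simps)
      finally show "\<bar>y b p - y a p\<bar> < r" .
    qed
    have "a \<in> ball a (r / C)" using r C by simp
    note a\<beta> = loc[OF this]
    have "R a b" if "b \<in> ball a (r / C)" for b
      unfolding R_def using eq slice_expansion_unique a\<beta> loc[OF that] by metis
    then show "\<exists>T. openin (top_of_set {0..1}) T \<and> a \<in> T \<and> (\<forall>b\<in>T. R a b)"
      using a r C by (intro exI[of _ "{0..1} \<inter> ball a (r / C)"]) (auto intro: openin_open_Int)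
  qed (auto simp: R_def)
  moreover have "y 0 = y0" "y 1 = y1" by (auto simp: y_def)
  ultimately show ?thesis using \<alpha> by (simp add: R_def)
qed

theorem hermitian_lattice_expansion:
  assumes "\<exists>Z. Z \<in> half_space n"
  obtains \<alpha> where "\<And>Z. Z \<in> half_space n \<Longrightarrow>
    ((\<lambda>T. \<alpha> T * ee (mat_trace (T * Z))) has_sum f Z) (herm_lattice m n)"
proof -
  have carr: "Z \<in> carrier_mat n n" if "Z \<in> half_space n" for Z using that by (simp add: half_space_def)
  obtain z0 where "zmat m n z0 \<in> half_space n" using assms zmat_surj[OF m_pos carr] by metis
  then have c0: "cone m n (\<lambda>p. Im (z0 p))" by (simp add: half_space_cone)
  obtain r \<alpha> where r: "r > 0" "\<And>y. (\<And>p. p \<in> idx n \<Longrightarrow> \<bar>y p - Im (z0 p)\<bar> < r) \<Longrightarrow> slice_expansion y \<alpha>"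
    using slice_expansion_local[OF c0] by metis
  have "((\<lambda>T. \<alpha> T * ee (mat_trace (T * Z))) has_sum f Z) (herm_lattice m n)" if Z: "Z \<in> half_space n" for Z
  proof -
    obtain z where z: "Z = zmat m n z" using zmat_surj[OF m_pos carr[OF Z]] by blast
    have "cone m n (\<lambda>p. Im (z p))" using Z unfolding z half_space_cone .
    moreover have "slice_expansion (\<lambda>p. Im (z0 p)) \<alpha>" using r by simp
    ultimately have "slice_expansion (\<lambda>p. Im (z p)) \<alpha>" by (rule slice_expansion_transfer[OF c0])
    then show ?thesis unfolding slice_expansion_def z by blast
  qed
  then show ?thesis using that by blast
qed

end

section \<open>Unimodular transformations\<close>

lemma hform_unit:
  assumes "A \<in> carrier_mat n n" "i < n"
  shows "hform A (unit_vec n i) (unit_vec n i) = A $$ (i, i)"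
proof -
  have "hform A (unit_vec n i) (unit_vec n i) = (\<Sum>a<n. \<Sum>b<n. if a = i \<and> b = i then A $$ (i, i) else 0)"
    unfolding hform_sum[OF assms(1) unit_vec_carrier unit_vec_carrier] using assms by (intro sum.cong) auto
  also have "\<dots> = (\<Sum>a<n. if a = i then A $$ (i, i) else 0)"
    using assms by (intro sum.cong) auto
  also have "\<dots> = A $$ (i, i)" using assms by simp
  finally show ?thesis .
qed

lemma hermitian_conj:
  assumes "hermitian_mat n A" "U \<in> carrier_mat n n"
  shows "hermitian_mat n (U * A * mat_adjoint U)"
proof -
  have A: "A \<in> carrier_mat n n" "mat_adjoint A = A" using assms by (auto simp: hermitian_mat_def)
  have UA: "U * A \<in> carrier_mat n n" and aU: "mat_adjoint U \<in> carrier_mat n n" using A assms by auto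
  have "mat_adjoint (U * A * mat_adjoint U) = U * (A * mat_adjoint U)"
    using mat_adjoint_mult[OF UA aU] mat_adjoint_mult[OF assms(2) A(1)] A(2) by simp
  also have "\<dots> = U * A * mat_adjoint U"
    by (rule assoc_mult_mat[symmetric, OF assms(2) A(1) aU])
  finally show ?thesis using UA aU by (auto simp: hermitian_mat_def)
qed

lemma adjoint_mult_vec_nonzero:
  fixes U V :: "complex mat"
  assumes "U \<in> carrier_mat n n" "V \<in> carrier_mat n n" "U * V = 1\<^sub>m n" "v \<in> carrier_vec n" "v \<noteq> 0\<^sub>v n"
  shows "mat_adjoint U *\<^sub>v v \<noteq> 0\<^sub>v n"
proof
  assume 0: "mat_adjoint U *\<^sub>v v = 0\<^sub>v n"
  have VU: "mat_adjoint V * mat_adjoint U = 1\<^sub>m n"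
    using mat_adjoint_mult[OF assms(1,2)] assms(3) by simp
  have aV: "mat_adjoint V \<in> carrier_mat n n" and aU: "mat_adjoint U \<in> carrier_mat n n" using assms by auto
  have "v = (mat_adjoint V * mat_adjoint U) *\<^sub>v v" using VU assms(4) by simp
  also have "\<dots> = mat_adjoint V *\<^sub>v (mat_adjoint U *\<^sub>v v)" by (rule assoc_mult_mat_vec[OF aV aU assms(4)])
  also have "\<dots> = 0\<^sub>v n" unfolding 0 using aV assms(2) by (intro eq_vecI) (auto simp: scalar_prod_def)
  finally show False using assms by simp
qed

lemma pos_def_conj:
  assumes A: "pos_def n A" and U: "U \<in> carrier_mat n n" "V \<in> carrier_mat n n" "U * V = 1\<^sub>m n"
  shows "pos_def n (U * A * mat_adjoint U)"
  unfolding pos_def_alt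
proof (intro conjI ballI impI)
  have Ac: "hermitian_mat n A" "A \<in> carrier_mat n n" using A by (auto simp: pos_def_def hermitian_mat_def)
  show "hermitian_mat n (U * A * mat_adjoint U)" by (rule hermitian_conj[OF Ac(1) U(1)])
  fix v :: "complex Matrix.vec" assume v: "v \<in> carrier_vec n" "v \<noteq> 0\<^sub>v n"
  have "mat_adjoint U *\<^sub>v v \<in> carrier_vec n" using U v by (intro mult_mat_vec_carrier[of _ n n]) auto
  then show "Re (hform (U * A * mat_adjoint U) v v) > 0"
    using A adjoint_mult_vec_nonzero[OF U v] unfolding hform_conj[OF Ac(2) U(1) v(1) v(1)] by (auto simp: pos_def_alt)
qed

lemma pos_semidef_conj:
  assumes A: "pos_semidef n A" and U: "U \<in> carrier_mat n n"
  shows "pos_semidef n (U * A * mat_adjoint U)"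
  unfolding pos_semidef_alt
proof (intro conjI ballI)
  have Ac: "hermitian_mat n A" "A \<in> carrier_mat n n" using A by (auto simp: pos_semidef_def hermitian_mat_def)
  show "hermitian_mat n (U * A * mat_adjoint U)" by (rule hermitian_conj[OF Ac(1) U(1)])
  fix v :: "complex Matrix.vec" assume v: "v \<in> carrier_vec n"
  have "mat_adjoint U *\<^sub>v v \<in> carrier_vec n" using U v by (intro mult_mat_vec_carrier[of _ n n]) auto
  then show "Re (hform (U * A * mat_adjoint U) v v) \<ge> 0"
    using A unfolding hform_conj[OF Ac(2) U(1) v v] by (auto simp: pos_semidef_alt)
qed

lemma half_space_carrier: "Z \<in> half_space n \<Longrightarrow> Z \<in> carrier_mat n n"
  by (simp add: half_space_def)

lemma half_space_conj:
  assumes Z: "Z \<in> half_space n" and U: "U \<in> carrier_mat n n" "V \<in> carrier_mat n n" "V * U = 1\<^sub>m n"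
  shows "mat_adjoint U * Z * U \<in> half_space n"
proof -
  have Zc: "Z \<in> carrier_mat n n" by (rule half_space_carrier[OF Z])
  have aU: "mat_adjoint U \<in> carrier_mat n n" and aV: "mat_adjoint V \<in> carrier_mat n n" using U by auto
  let ?Y = "(1 / (2 * \<i>)) \<cdot>\<^sub>m (Z - mat_adjoint Z)"
  have aUV: "mat_adjoint U * mat_adjoint V = 1\<^sub>m n" using mat_adjoint_mult[OF U(2,1)] U(3) by simp
  have aZ: "mat_adjoint Z \<in> carrier_mat n n" using Zc by auto
  have UZ: "mat_adjoint U * Z \<in> carrier_mat n n" "mat_adjoint U * mat_adjoint Z \<in> carrier_mat n n" using aU Zc aZ by auto
  have "mat_adjoint (mat_adjoint U * Z * U) = mat_adjoint U * (mat_adjoint Z * U)"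
    using mat_adjoint_mult[OF UZ(1) U(1)] mat_adjoint_mult[OF aU Zc] by simp
  also have "\<dots> = mat_adjoint U * mat_adjoint Z * U" by (rule assoc_mult_mat[symmetric, OF aU aZ U(1)])
  finally have 1: "mat_adjoint (mat_adjoint U * Z * U) = mat_adjoint U * mat_adjoint Z * U" .
  have "mat_adjoint U * ?Y * U = (1 / (2 * \<i>)) \<cdot>\<^sub>m (mat_adjoint U * Z * U - mat_adjoint U * mat_adjoint Z * U)"
  proof -
    have "mat_adjoint U * ?Y = (1 / (2 * \<i>)) \<cdot>\<^sub>m (mat_adjoint U * (Z - mat_adjoint Z))"
      using aU Zc aZ by (intro mult_smult_distrib[of _ n n _ n]) auto
    also have "mat_adjoint U * (Z - mat_adjoint Z) = mat_adjoint U * Z - mat_adjoint U * mat_adjoint Z"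
      by (rule mult_minus_distrib_mat[OF aU Zc aZ])
    finally have "mat_adjoint U * ?Y * U = ((1 / (2 * \<i>)) \<cdot>\<^sub>m (mat_adjoint U * Z - mat_adjoint U * mat_adjoint Z)) * U" by simp
    also have "\<dots> = (1 / (2 * \<i>)) \<cdot>\<^sub>m ((mat_adjoint U * Z - mat_adjoint U * mat_adjoint Z) * U)"
      by (rule mult_smult_assoc_mat[OF minus_carrier_mat[OF UZ(2)] U(1)])
    also have "(mat_adjoint U * Z - mat_adjoint U * mat_adjoint Z) * U = mat_adjoint U * Z * U - mat_adjoint U * mat_adjoint Z * U"
      by (rule minus_mult_distrib_mat[OF UZ U(1)])
    finally show ?thesis .
  qed
  moreover have "pos_def n (mat_adjoint U * ?Y * mat_adjoint (mat_adjoint U))"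
    using Z by (intro pos_def_conj[OF _ aU aV aUV]) (simp add: half_space_def)
  ultimately show ?thesis using 1 UZ U by (simp add: half_space_def)
qed

lemma mat_trace_conj:
  assumes "T \<in> carrier_mat n n" "U \<in> carrier_mat n n" "Z \<in> carrier_mat n n"
  shows "mat_trace (T * (mat_adjoint U * Z * U)) = mat_trace (U * T * mat_adjoint U * Z)"
proof -
  have aU: "mat_adjoint U \<in> carrier_mat n n" using assms by auto
  have TU: "T * mat_adjoint U \<in> carrier_mat n n" "mat_adjoint U * Z \<in> carrier_mat n n" using assms aU by auto
  have "T * (mat_adjoint U * Z * U) = (T * (mat_adjoint U * Z)) * U"
    by (rule assoc_mult_mat[symmetric, OF assms(1) TU(2) assms(2)])
  also have "T * (mat_adjoint U * Z) = T * mat_adjoint U * Z"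
    by (rule assoc_mult_mat[symmetric, OF assms(1) aU assms(3)])
  finally have "mat_trace (T * (mat_adjoint U * Z * U)) = mat_trace (T * mat_adjoint U * Z * U)" by simp
  also have "\<dots> = mat_trace (U * (T * mat_adjoint U * Z))"
    by (rule mat_trace_comm[OF mult_carrier_mat[OF TU(1) assms(3)] assms(2)])
  also have "U * (T * mat_adjoint U * Z) = U * (T * mat_adjoint U) * Z"
    by (rule assoc_mult_mat[symmetric, OF assms(2) TU(1) assms(3)])
  also have "U * (T * mat_adjoint U) = U * T * mat_adjoint U"
    by (rule assoc_mult_mat[symmetric, OF assms(2,1) aU])
  finally show ?thesis .
qed

lemma conj_conj_inverse:
  fixes T U V :: "complex mat"
  assumes "T \<in> carrier_mat n n" "U \<in> carrier_mat n n" "V \<in> carrier_mat n n" "U * V = 1\<^sub>m n"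
  shows "U * (V * T * mat_adjoint V) * mat_adjoint U = T"
proof -
  have c: "mat_adjoint U \<in> carrier_mat n n" "mat_adjoint V \<in> carrier_mat n n" "V * T \<in> carrier_mat n n"
    "V * T * mat_adjoint V \<in> carrier_mat n n" "U * (V * T) \<in> carrier_mat n n" using assms by auto
  have VU: "mat_adjoint V * mat_adjoint U = 1\<^sub>m n"
    using mat_adjoint_mult[OF assms(2,3)] assms(4) by simp
  have "U * (V * T * mat_adjoint V) = U * (V * T) * mat_adjoint V"
    by (rule assoc_mult_mat[symmetric, OF assms(2) c(3) c(2)])
  also have "U * (V * T) = U * V * T" by (rule assoc_mult_mat[symmetric, OF assms(2,3,1)])
  also have "\<dots> = T" using assms by simp
  finally have "U * (V * T * mat_adjoint V) * mat_adjoint U = T * mat_adjoint V * mat_adjoint U" by simp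
  also have "\<dots> = T * (mat_adjoint V * mat_adjoint U)" by (rule assoc_mult_mat[OF assms(1) c(2,1)])
  finally show ?thesis using VU assms by simp
qed

text \<open>The identity matrix with the block of rows \<open>(a, b)\<close> and
  \<open>(c, d)\<close> inserted at the positions \<open>i\<close> and \<open>j\<close>.\<close>

definition pmat :: "nat \<Rightarrow> nat \<Rightarrow> nat \<Rightarrow> complex \<Rightarrow> complex \<Rightarrow> complex \<Rightarrow> complex \<Rightarrow> complex mat" where
  "pmat n i j a b c d = Matrix.mat n n (\<lambda>(r, t).
     if r = i then (if t = i then a else 0) + (if t = j then b else 0)
     else if r = j then (if t = i then c else 0) + (if t = j then d else 0)
     else if t = r then 1 else 0)"

lemma pmat_carrier [simp, intro]: "pmat n i j a b c d \<in> carrier_mat n n"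
  by (simp add: pmat_def)

lemma pmat_dim [simp]: "dim_row (pmat n i j a b c d) = n" "dim_col (pmat n i j a b c d) = n"
  by (simp_all add: pmat_def)

lemma pmat_sum:
  assumes "i < n" "j < n" "r < n"
  shows "(\<Sum>t<n. pmat n i j a b c d $$ (r, t) * x t) =
    (if r = i then a * x i + b * x j else if r = j then c * x i + d * x j else x r)"
proof -
  have s: "(\<Sum>t<n. ((if t = i then p else 0) + (if t = j then q else 0)) * x t) = p * x i + q * x j" for p q
  proof -
    have "(\<Sum>t<n. ((if t = i then p else 0) + (if t = j then q else 0)) * x t)
        = (\<Sum>t<n. (if t = i then p * x t else 0) + (if t = j then q * x t else 0))"
      by (intro sum.cong) (auto simp: algebra_simps)
    then show ?thesis using assms by (simp add: sum.distrib)
  qed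
  show ?thesis
  proof (cases "r = i")
    case True
    then show ?thesis using assms s[of a b] by (simp add: pmat_def)
  next
    case False
    show ?thesis
    proof (cases "r = j")
      case True
      then show ?thesis using assms False s[of c d] by (simp add: pmat_def)
    next
      case nj: False
      have "(\<Sum>t<n. pmat n i j a b c d $$ (r, t) * x t) = (\<Sum>t<n. if t = r then x t else 0)"
        using assms False nj by (intro sum.cong) (auto simp: pmat_def)
      then show ?thesis using assms False nj by simp
    qed
  qed
qed

lemma pmat_inverse:
  assumes "i < n" "j < n" "i \<noteq> j" "a * d - b * c = 1"
  shows "pmat n i j a b c d * pmat n i j d (- b) (- c) a = 1\<^sub>m n"
proof (rule eq_matI)
  fix r s assume "r < dim_row (1\<^sub>m n :: complex mat)" "s < dim_col (1\<^sub>m n :: complex mat)"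
  then have rs: "r < n" "s < n" by auto
  have "(pmat n i j a b c d * pmat n i j d (- b) (- c) a) $$ (r, s) =
      (\<Sum>t<n. pmat n i j a b c d $$ (r, t) * pmat n i j d (- b) (- c) a $$ (t, s))"
    by (rule mat_mult_index[OF pmat_carrier pmat_carrier rs])
  also have "\<dots> = 1\<^sub>m n $$ (r, s)"
    unfolding pmat_sum[OF assms(1,2) rs(1)] using assms rs by (auto simp: pmat_def algebra_simps)
  finally show "(pmat n i j a b c d * pmat n i j d (- b) (- c) a) $$ (r, s) = 1\<^sub>m n $$ (r, s)" .
qed auto

lemma pmat_mult_vec:
  assumes "i < n" "j < n"
  shows "pmat n i j a b c d *\<^sub>v Matrix.vec n w =
    Matrix.vec n (\<lambda>r. if r = i then a * w i + b * w j else if r = j then c * w i + d * w j else w r)"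
proof (rule eq_vecI)
  fix r assume "r < dim_vec (Matrix.vec n (\<lambda>r. if r = i then a * w i + b * w j else if r = j then c * w i + d * w j else w r))"
  then have r: "r < n" by simp
  have "(pmat n i j a b c d *\<^sub>v Matrix.vec n w) $ r = (\<Sum>t<n. pmat n i j a b c d $$ (r, t) * w t)"
    using r by (simp add: scalar_prod_def lessThan_atLeast0)
  then show "(pmat n i j a b c d *\<^sub>v Matrix.vec n w) $ r =
      Matrix.vec n (\<lambda>r. if r = i then a * w i + b * w j else if r = j then c * w i + d * w j else w r) $ r"
    using r pmat_sum[OF assms r, of a b c d w] by simp
qed simp

lemma U_mat_eq_pmat:
  assumes "n \<ge> 2" shows "U_mat n x = pmat n (n - 2) (n - 1) 1 0 x 1"
  using assms by (intro eq_matI) (auto simp: U_mat_def pmat_def)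

lemma det_in_ring_ints:
  assumes m: "squarefree m" and A: "A \<in> carrier_mat n n"
    and O: "\<And>i j. i < n \<Longrightarrow> j < n \<Longrightarrow> A $$ (i, j) \<in> ring_ints m"
  shows "Determinant.det A \<in> ring_ints m"
  unfolding det_def'[OF A]
proof (rule ring_ints_sum[OF m], rule ring_ints_mult[OF m])
  fix p assume p: "p \<in> {p. p permutes {0..<n}}"
  show "signof p \<in> ring_ints m"
    using ring_ints_of_int[of 1 m] ring_ints_of_int[of "-1" m] by (simp add: sign_def)
  show "(\<Prod>i = 0..<n. A $$ (i, p i)) \<in> ring_ints m"
    using p by (intro ring_ints_prod[OF m] O) (auto simp: permutes_in_image)
qed

lemma scalar_imaginary_half_space: "\<i> \<cdot>\<^sub>m 1\<^sub>m n \<in> half_space n"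
proof -
  have "(1 / (2 * \<i>)) \<cdot>\<^sub>m (\<i> \<cdot>\<^sub>m 1\<^sub>m n - mat_adjoint (\<i> \<cdot>\<^sub>m 1\<^sub>m n)) = 1\<^sub>m n"
    by (intro eq_matI) (auto simp: complex_eq_iff)
  moreover have "pos_def n (1\<^sub>m n)"
    unfolding pos_def_alt
  proof (intro conjI ballI impI)
    fix v :: "complex Matrix.vec" assume v: "v \<in> carrier_vec n" "v \<noteq> 0\<^sub>v n"
    have "hform (1\<^sub>m n) v v = of_real (sqnorm v)" using v by (simp add: hform_def cscalar_self)
    then show "Re (hform (1\<^sub>m n) v v) > 0" using v sqnorm_eq_0_iff[OF v(1)] sqnorm_nonneg[of v] by simp
  qed (simp add: hermitian_mat_def)
  ultimately show ?thesis by (simp add: half_space_def)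
qed

section \<open>From complex vectors to rational and integral ones\<close>

lemma common_denominator:
  fixes n :: nat
  assumes m: "squarefree m" and w: "\<And>j. j < n \<Longrightarrow> w j \<in> quad_field m"
  obtains D :: int where "D > 0" "\<And>j. j < n \<Longrightarrow> of_int D * w j \<in> ring_ints m"
proof -
  have "\<forall>j\<in>{..<n}. \<exists>d::int. d > 0 \<and> of_int d * w j \<in> ring_ints m"
    using quad_field_denominator[OF m] w by (metis lessThan_iff)
  then obtain d :: "nat \<Rightarrow> int" where d: "\<And>j. j < n \<Longrightarrow> d j > 0" "\<And>j. j < n \<Longrightarrow> of_int (d j) * w j \<in> ring_ints m"
    by (metis lessThan_iff)
  have "of_int (\<Prod>j<n. d j) * w i \<in> ring_ints m" if i: "i < n" for i
  proof -
    have "(\<Prod>j<n. d j) = (\<Prod>j\<in>{..<n} - {i}. d j) * d i"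
      using i by (subst prod.remove[of _ i]) (auto simp: mult.commute)
    then have "of_int (\<Prod>j<n. d j) * w i = of_int (\<Prod>j\<in>{..<n} - {i}. d j) * (of_int (d i) * w i)"
      by (simp add: mult.assoc del: of_int_prod)
    then show ?thesis using d(2)[OF i] ring_ints_mult[OF m ring_ints_of_int] by metis
  qed
  moreover have "(\<Prod>j<n. d j) > 0" using d by (intro prod_pos) auto
  ultimately show ?thesis using that by blast
qed

lemma herm_lattice_in_quad_field:
  assumes T: "T \<in> herm_lattice m n" and ij: "i < n" "j < n"
  shows "T $$ (i, j) \<in> quad_field m"
proof (cases "i = j")
  case True
  then show ?thesis using assms by (auto simp: herm_lattice_def elim!: Ints_cases)
next
  case False
  then obtain a where "a \<in> ring_ints m" "T $$ (i, j) = a / csqrt (of_int (quad_disc m))"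
    using assms unfolding herm_lattice_def by blast
  moreover have "csqrt (of_int (quad_disc m)) \<in> quad_field m"
    unfolding om_diff_cnj[symmetric] by auto
  ultimately show ?thesis using ring_ints_subset_quad_field by auto
qed

text \<open>The entries of \<open>T\<close> lie in the quadratic field, so applying a linear
  functional over that field to each coordinate preserves the kernel; choosing it nonzero at a
  nonzero coordinate of \<open>v\<close> keeps the vector nonzero.\<close>

lemma rational_null_vector:
  assumes m: "m > 0" and T: "T \<in> herm_lattice m n"
    and v: "v \<in> carrier_vec n" "v \<noteq> 0\<^sub>v n" "T *\<^sub>v v = 0\<^sub>v n"
  obtains w where "\<And>i. i < n \<Longrightarrow> w i \<in> quad_field m" "\<exists>i<n. w i \<noteq> 0" "T *\<^sub>v Matrix.vec n w = 0\<^sub>v n"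
proof -
  have Tc: "T \<in> carrier_mat n n" using T by (auto simp: herm_lattice_def hermitian_mat_def)
  obtain i0 where i0: "i0 < n" "v $ i0 \<noteq> 0"
    using v by (metis carrier_vecD eq_vecI index_zero_vec(1) index_zero_vec(2))
  obtain \<phi> where \<phi>: "\<And>z. \<phi> z \<in> quad_field m" "\<And>z w. \<phi> (z + w) = \<phi> z + \<phi> w"
    "\<And>k z. k \<in> quad_field m \<Longrightarrow> \<phi> (k * z) = k * \<phi> z" "\<phi> (v $ i0) \<noteq> 0"
    using quad_field_linear_functional[OF m i0(2)] by blast
  have \<phi>0: "\<phi> 0 = 0" using \<phi>(2)[of 0 0] by simp
  have \<phi>_sum: "\<phi> (sum g A) = (\<Sum>j\<in>A. \<phi> (g j))" for g and A :: "nat set"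
    by (induction A rule: infinite_finite_induct) (auto simp: \<phi>0 \<phi>(2))
  define w where "w j = \<phi> (v $ j)" for j
  have "T *\<^sub>v Matrix.vec n w = 0\<^sub>v n"
  proof (rule eq_vecI)
    fix i assume "i < dim_vec (0\<^sub>v n :: complex Matrix.vec)"
    then have i: "i < n" by simp
    have "(T *\<^sub>v Matrix.vec n w) $ i = (\<Sum>j<n. T $$ (i, j) * \<phi> (v $ j))"
      using Tc i by (simp add: scalar_prod_def w_def lessThan_atLeast0)
    also have "\<dots> = \<phi> (\<Sum>j<n. T $$ (i, j) * v $ j)"
      using herm_lattice_in_quad_field[OF T i] by (simp add: \<phi>_sum \<phi>(3))
    also have "(\<Sum>j<n. T $$ (i, j) * v $ j) = (T *\<^sub>v v) $ i"
      using Tc v(1) i by (simp add: scalar_prod_def lessThan_atLeast0)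
    finally show "(T *\<^sub>v Matrix.vec n w) $ i = 0\<^sub>v n $ i" using v(3) i \<phi>0 by simp
  qed (use Tc in simp)
  moreover have "\<exists>i<n. w i \<noteq> 0" using i0 \<phi>(4) by (auto simp: w_def)
  ultimately show ?thesis using that[of w] \<phi>(1) by (simp add: w_def)
qed

text \<open>Negativity is an open condition and the quadratic field is dense in the complex numbers;
  clearing denominators multiplies the value by a positive square.\<close>

lemma integral_negative_vector:
  assumes m: "squarefree m" and A: "A \<in> carrier_mat n n"
    and v: "v \<in> carrier_vec n" "Re (hform A v v) < 0"
  obtains w where "\<And>i. i < n \<Longrightarrow> w i \<in> ring_ints m" "Re (hform A (Matrix.vec n w) (Matrix.vec n w)) < 0"
proof -
  have m0: "m > 0" using m by (metis not_squarefree_0 gr0I)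
  have ex: "\<exists>q. q \<in> quad_field m \<and> norm (v $ j - q) < 1 / real (Suc l)" for j l
    using quad_field_dense[OF m0, of "1 / real (Suc l)" "v $ j"] by auto
  define q where "q l j = (SOME q. q \<in> quad_field m \<and> norm (v $ j - q) < 1 / real (Suc l))" for l j
  have q: "q l j \<in> quad_field m" "norm (v $ j - q l j) < 1 / real (Suc l)" for l j
    using someI_ex[OF ex[of j l]] unfolding q_def by blast+
  have lim: "(\<lambda>l. q l j) \<longlonglongrightarrow> v $ j" for j
  proof -
    have "(\<lambda>l. q l j - v $ j) \<longlonglongrightarrow> 0"
    proof (rule tendsto_norm_zero_cancel, rule tendsto_sandwich[OF _ _ tendsto_const LIMSEQ_Suc[OF lim_1_over_n]])
      show "\<forall>\<^sub>F l in sequentially. norm (q l j - v $ j) \<le> 1 / real (Suc l)"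
        using q(2)[of j] by (intro always_eventually allI) (simp add: norm_minus_commute less_imp_le)
    qed auto
    then show ?thesis by (simp add: LIM_zero_iff)
  qed
  have "(\<lambda>l. Re (\<Sum>i<n. \<Sum>j<n. A $$ (i, j) * q l j * cnj (q l i))) \<longlonglongrightarrow>
      Re (\<Sum>i<n. \<Sum>j<n. A $$ (i, j) * v $ j * cnj (v $ i))"
    by (intro tendsto_intros lim)
  then have "(\<lambda>l. Re (hform A (Matrix.vec n (q l)) (Matrix.vec n (q l)))) \<longlonglongrightarrow> Re (hform A v v)"
    using A v(1) by (simp add: hform_sum[of _ n])
  then have "eventually (\<lambda>l. Re (hform A (Matrix.vec n (q l)) (Matrix.vec n (q l))) < 0) sequentially"
    using v(2) by (rule order_tendstoD(2))
  then obtain l where l: "Re (hform A (Matrix.vec n (q l)) (Matrix.vec n (q l))) < 0"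
    by (auto simp: eventually_sequentially)
  obtain D :: int where D: "D > 0" "\<And>j. j < n \<Longrightarrow> of_int D * q l j \<in> ring_ints m"
    using common_denominator[OF m, of n "q l"] q(1) by metis
  have "Matrix.vec n (\<lambda>j. of_int D * q l j) = of_int D \<cdot>\<^sub>v Matrix.vec n (q l)" by (intro eq_vecI) auto
  then have "hform A (Matrix.vec n (\<lambda>j. of_int D * q l j)) (Matrix.vec n (\<lambda>j. of_int D * q l j)) =
      of_real (of_int D * of_int D) * hform A (Matrix.vec n (q l)) (Matrix.vec n (q l))"
    using A by (simp add: hform_smult_left[of _ n] hform_smult_right[of _ n])
  then have "Re (hform A (Matrix.vec n (\<lambda>j. of_int D * q l j)) (Matrix.vec n (\<lambda>j. of_int D * q l j))) =
      (of_int D * of_int D) * Re (hform A (Matrix.vec n (q l)) (Matrix.vec n (q l)))"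
    by (simp del: of_real_mult)
  moreover have "real_of_int D * real_of_int D > 0" using D(1) by simp
  ultimately have "Re (hform A (Matrix.vec n (\<lambda>j. of_int D * q l j)) (Matrix.vec n (\<lambda>j. of_int D * q l j))) < 0"
    using l by (simp add: mult_pos_neg)
  then show ?thesis using that[of "\<lambda>j. of_int D * q l j"] D(2) by blast
qed

section \<open>The Koecher principle\<close>

lemma int_pair_elimination:
  obtains a b c d :: int where "a * d - b * c = 1" "a * p + b * q = 0"
proof (cases "p = 0 \<and> q = 0")
  case True
  then show ?thesis using that[of 1 1 0 0] by simp
next
  case False
  define g where "g = gcd p q"
  have g: "g \<noteq> 0" using False by (simp add: g_def)
  obtain p' where p': "p = g * p'" unfolding g_def by (meson dvdE gcd_dvd1)
  obtain q' where q': "q = g * q'" unfolding g_def by (meson dvdE gcd_dvd2)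
  obtain s t where "s * p + t * q = g" unfolding g_def using bezout_int by blast
  then have "g * (s * p' + t * q') = g * 1" by (simp add: p' q' algebra_simps)
  then have "s * p' + t * q' = 1" using g by (simp only: mult_cancel_left) simp
  \<comment> \<open>The row \<open>(q', - p')\<close> kills \<open>(p, q)\<close>, and the Bezout
    coefficients complete it to determinant 1. The instantiation is in the order \<open>a\<close>,
    \<open>d\<close>, \<open>b\<close>, \<open>c\<close>.\<close>
  then show ?thesis by (intro that[of q' t "- p'" s]) (simp_all add: p' q' algebra_simps)
qed

text \<open>A vector of integers of \<open>K\<close> is a pair of vectors of rational integers, in which operations over
  \<open>\<int>\<close> clear all but the last two positions; these are dealt with by the ideal classes.\<close>

lemma vector_orbit_induct:
  fixes P :: "(nat \<Rightarrow> complex) \<Rightarrow> bool" and u :: "'j \<Rightarrow> complex"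
  assumes sq: "squarefree m" and n: "n \<ge> 2"
    and cong: "\<And>w w'. (\<And>i. i < n \<Longrightarrow> w i = w' i) \<Longrightarrow> P w \<Longrightarrow> P w'"
    and move: "\<And>w i j a b c d. i < n \<Longrightarrow> j < n \<Longrightarrow> i \<noteq> j \<Longrightarrow> a \<in> ring_ints m \<Longrightarrow> b \<in> ring_ints m \<Longrightarrow>
      c \<in> ring_ints m \<Longrightarrow> d \<in> ring_ints m \<Longrightarrow> a * d - b * c = 1 \<Longrightarrow>
      P (\<lambda>r. if r = i then a * w i + b * w j else if r = j then c * w i + d * w j else w r) \<Longrightarrow> P w"
    and scale: "\<And>w \<kappa>. \<kappa> \<noteq> 0 \<Longrightarrow> P (\<lambda>r. \<kappa> * w r) \<longleftrightarrow> P w"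
    and base: "\<And>j. j \<in> A \<Longrightarrow> P (\<lambda>i. if i = n - 2 then u j else if i = n - 1 then 1 else 0)"
    and classes: "\<And>C. C \<in> ideal_classes m \<Longrightarrow> \<exists>j\<in>A. C = ideal_class m (ideal_gen1 m (u j))"
    and w: "\<And>i. i < n \<Longrightarrow> w i \<in> quad_field m" and nz: "\<exists>i<n. w i \<noteq> 0"
  shows "P w"
proof -
  define Q where "Q w \<longleftrightarrow> ((\<exists>i<n. w i \<noteq> 0) \<longrightarrow> P w)" for w
  have Q_cong: "Q w \<Longrightarrow> Q w'" if "\<And>i. i < n \<Longrightarrow> w i = w' i" for w w'
    using cong[OF that] that by (auto simp: Q_def)
  have Q_move: "Q w" if ij: "i < n" "j < n" "i \<noteq> j" and O: "a \<in> ring_ints m" "b \<in> ring_ints m"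
      "c \<in> ring_ints m" "d \<in> ring_ints m" and det: "a * d - b * c = 1"
    and Q: "Q (\<lambda>r. if r = i then a * w i + b * w j else if r = j then c * w i + d * w j else w r)" for w i j a b c d
    unfolding Q_def
  proof
    let ?w = "\<lambda>r. if r = i then a * w i + b * w j else if r = j then c * w i + d * w j else w r"
    assume nz: "\<exists>i<n. w i \<noteq> 0"
    have "\<exists>r<n. ?w r \<noteq> 0"
    proof (rule ccontr)
      assume "\<not> (\<exists>r<n. ?w r \<noteq> 0)"
      then have z: "?w r = 0" if "r < n" for r using that by blast
      have z1: "a * w i + b * w j = 0" "c * w i + d * w j = 0" using z[of i] z[of j] ij by auto
      have "w i = (a * d - b * c) * w i" using det by simp
      also have "\<dots> = d * (a * w i + b * w j) - b * (c * w i + d * w j)" by (simp add: algebra_simps)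
      finally have wi: "w i = 0" using z1 by simp
      have "w j = (a * d - b * c) * w j" using det by simp
      also have "\<dots> = a * (c * w i + d * w j) - c * (a * w i + b * w j)" by (simp add: algebra_simps)
      finally have wj: "w j = 0" using z1 by simp
      have "w r = 0" if "r < n" for r using z[OF that] wi wj by (cases "r = i \<or> r = j") auto
      then show False using nz by blast
    qed
    then have "P ?w" using Q by (simp add: Q_def)
    then show "P w" by (rule move[OF ij O det])
  qed
  define W where "W x y t = of_int (x t) + of_int (y t) * om m" for x y :: "nat \<Rightarrow> int" and t :: nat
  have Q_int: "Q (W x y)" if ij: "i < n" "j < n" "i \<noteq> j" and det: "a * d - b * c = 1"
    and Q: "Q (W (x(i := a * x i + b * x j, j := c * x i + d * x j)) (y(i := a * y i + b * y j, j := c * y i + d * y j)))"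
    for x y i j and a b c d :: int
  proof (rule Q_move[OF ij])
    have "of_int (a * d - b * c) = (1 :: complex)" using det by simp
    then show "of_int a * of_int d - of_int b * of_int c = (1 :: complex)" by simp
    show "Q (\<lambda>r. if r = i then of_int a * W x y i + of_int b * W x y j
      else if r = j then of_int c * W x y i + of_int d * W x y j else W x y r)"
      by (rule Q_cong[OF _ Q]) (use ij in \<open>auto simp: W_def algebra_simps\<close>)
  qed auto
  define p where "p = n - 2"
  have p: "n - 1 = Suc p" "n = Suc (Suc p)" using n by (auto simp: p_def)
  have final: "Q w" if O: "\<And>i. i < n \<Longrightarrow> w i \<in> ring_ints m" and z: "\<And>i. i < p \<Longrightarrow> w i = 0" for w
    unfolding Q_def
  proof
    assume nz: "\<exists>i<n. w i \<noteq> 0"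
    have pn: "p < n" "Suc p < n" using p by auto
    have ab: "w p \<in> ring_ints m" "w (Suc p) \<in> ring_ints m" using O pn by auto
    have nz': "w p \<noteq> 0 \<or> w (Suc p) \<noteq> 0"
    proof -
      obtain i where "i < n" "w i \<noteq> 0" using nz by blast
      then have "i = p \<or> i = Suc p" using z[of i] p by fastforce
      then show ?thesis using \<open>w i \<noteq> 0\<close> by auto
    qed
    let ?I = "gen2 m (w p) (w (Suc p))"
    have "ideal_class m ?I \<in> ideal_classes m"
      unfolding ideal_class_def ideal_classes_def by (intro quotientI gen2_fractional[OF sq] ab nz')
    then obtain j where j: "j \<in> A" "ideal_class m ?I = ideal_class m (ideal_gen1 m (u j))"
      using classes by blast
    obtain \<kappa> a b c d where \<kappa>: "\<kappa> \<noteq> 0"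
      "a \<in> ring_ints m" "b \<in> ring_ints m" "c \<in> ring_ints m" "d \<in> ring_ints m"
      "a * d - b * c = 1" "a * w p + b * w (Suc p) = \<kappa> * u j" "c * w p + d * w (Suc p) = \<kappa>"
      using gen2_ideal_class[OF sq ab nz' j(2)] by metis
    have "P (\<lambda>r. \<kappa> * (if r = n - 2 then u j else if r = n - 1 then 1 else 0))"
      by (rule iffD2[OF scale[OF \<kappa>(1)] base[OF j(1)]])
    then have "P (\<lambda>r. if r = p then a * w p + b * w (Suc p) else if r = Suc p then c * w p + d * w (Suc p) else w r)"
      by (rule cong[rotated]) (use p z \<kappa> in \<open>auto simp: less_Suc_eq\<close>)
    then show "P w" by (rule move[OF pn n_not_Suc_n \<kappa>(2-6)])
  qed
  \<comment> \<open>Downward induction on the number \<open>s\<close> of leading positions already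
    cleared, ending at \<open>s = p\<close>, where \<open>final\<close> takes over.\<close>
  have ints: "Q (W x y)" if "\<And>t. t < s \<Longrightarrow> x t = 0 \<and> y t = 0" "s \<le> p" for s x y
    using that(2,1)
  proof (induction s arbitrary: x y rule: inc_induct)
    case base
    show ?case
      by (rule final) (use base in \<open>auto simp: W_def\<close>)
  next
    case (step s)
    have ne: "s < n" "p < n" "Suc p < n" "s \<noteq> p" "s \<noteq> Suc p" using step.hyps p by auto
    \<comment> \<open>Three eliminations clear position \<open>s\<close> of both integer vectors.
      The first two make the \<open>x\<close>-part zero at \<open>s\<close> and at \<open>p\<close>,
      using the last position; the third, between \<open>s\<close> and \<open>p\<close>, then clears
      the \<open>y\<close>-part without disturbing these zeros.\<close>
    obtain a b c d where 1: "a * d - b * c = 1" "a * x s + b * x (Suc p) = 0"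
      by (rule int_pair_elimination)
    show ?case
    proof (rule Q_int[OF ne(1,3,5) 1(1)])
      define x1 where "x1 = x(s := a * x s + b * x (Suc p), Suc p := c * x s + d * x (Suc p))"
      define y1 where "y1 = y(s := a * y s + b * y (Suc p), Suc p := c * y s + d * y (Suc p))"
      have x1: "x1 s = 0" using ne 1 by (simp add: x1_def)
      obtain a2 b2 c2 d2 where 2: "a2 * d2 - b2 * c2 = 1" "a2 * x1 p + b2 * x1 (Suc p) = 0"
        by (rule int_pair_elimination)
      have "Q (W x1 y1)"
      proof (rule Q_int[OF ne(2,3) n_not_Suc_n 2(1)])
        define x2 where "x2 = x1(p := a2 * x1 p + b2 * x1 (Suc p), Suc p := c2 * x1 p + d2 * x1 (Suc p))"
        define y2 where "y2 = y1(p := a2 * y1 p + b2 * y1 (Suc p), Suc p := c2 * y1 p + d2 * y1 (Suc p))"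
        have x2: "x2 s = 0" "x2 p = 0" using ne 2 x1 by (simp_all add: x2_def)
        obtain a3 b3 c3 d3 where 3: "a3 * d3 - b3 * c3 = 1" "a3 * y2 s + b3 * y2 p = 0"
          by (rule int_pair_elimination)
        have "Q (W x2 y2)"
        proof (rule Q_int[OF ne(1,2,4) 3(1)], rule step.IH)
          fix t assume "t < Suc s"
          then consider "t = s" | "t < s" by linarith
          then show "(x2(s := a3 * x2 s + b3 * x2 p, p := c3 * x2 s + d3 * x2 p)) t = 0 \<and>
              (y2(s := a3 * y2 s + b3 * y2 p, p := c3 * y2 s + d3 * y2 p)) t = 0"
          proof cases
            case 1
            then show ?thesis using ne x2 3 by simp
          next
            case 2
            then show ?thesis using step.prems[OF 2] step.hyps
              by (simp add: x2_def y2_def x1_def y1_def)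
          qed
        qed
        then show "Q (W (x1(p := a2 * x1 p + b2 * x1 (Suc p), Suc p := c2 * x1 p + d2 * x1 (Suc p)))
          (y1(p := a2 * y1 p + b2 * y1 (Suc p), Suc p := c2 * y1 p + d2 * y1 (Suc p))))"
          by (simp only: x2_def y2_def)
      qed
      then show "Q (W (x(s := a * x s + b * x (Suc p), Suc p := c * x s + d * x (Suc p)))
        (y(s := a * y s + b * y (Suc p), Suc p := c * y s + d * y (Suc p))))"
        by (simp only: x1_def y1_def)
    qed
  qed
  obtain D :: int where D: "D > 0" "\<And>j. j < n \<Longrightarrow> of_int D * w j \<in> ring_ints m"
    using common_denominator[OF sq, of n w] w by metis
  have "\<forall>j\<in>{..<n}. \<exists>x y. of_int D * w j = of_int x + of_int y * om m"
    using D(2) ring_ints_basisE[OF sq] by (metis lessThan_iff)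
  then obtain x y where xy: "\<And>j. j < n \<Longrightarrow> of_int D * w j = W x y j"
    unfolding W_def by (metis lessThan_iff)
  have "Q (W x y)" by (rule ints[of 0]) auto
  then have "Q (\<lambda>j. of_int D * w j)" by (rule Q_cong[rotated]) (use xy in simp)
  then have "P (\<lambda>j. of_int D * w j)" using nz D(1) by (simp add: Q_def)
  then show ?thesis using scale[of "of_int D" w] D(1) by simp
qed

lemma half_space_add_hermitian:
  assumes Z: "Z \<in> half_space n" and X: "hermitian_mat n X"
  shows "Z + X \<in> half_space n"
proof -
  have c: "Z \<in> carrier_mat n n" "X \<in> carrier_mat n n" "mat_adjoint X = X"
    using assms by (auto simp: half_space_def hermitian_mat_def)
  have "Z + X - mat_adjoint (Z + X) = Z - mat_adjoint Z"
    unfolding mat_adjoint_add[OF c(1,2)] c(3) using c by (intro eq_matI) auto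
  then show ?thesis using Z c by (simp add: half_space_def)
qed

text \<open>Since \<open>exp E \<ge> 1 + E\<close>, a bound on the exponentials would bound a
  quadratic polynomial with positive leading coefficient at all natural numbers.\<close>

lemma quadratic_exp_unbounded:
  fixes A B C p S :: real
  assumes C: "C < 0" and p: "p > 0" and le: "\<And>t::nat. p * exp (- 2 * pi * (A + 2 * real t * B + (real t)\<^sup>2 * C)) \<le> S"
  shows False
proof -
  define c where "c = - 2 * pi * C"
  have c: "c > 0" using C by (simp add: c_def mult_pos_neg)
  define K where "K = \<bar>S / p + 2 * pi * A\<bar> + \<bar>4 * pi * B\<bar>"
  obtain t0 :: nat where t0: "K < real t0 * c" using reals_Archimedean3[OF c] by blast
  have K0: "K \<ge> 0" by (simp add: K_def)
  then have "t0 \<noteq> 0" using t0 by (intro notI) simp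
  then have t1: "real t0 \<ge> 1" by simp
  let ?E = "- 2 * pi * (A + 2 * real t0 * B + (real t0)\<^sup>2 * C)"
  have "p * ?E \<le> p * exp ?E" using exp_ge_add_one_self[of ?E] p by (intro mult_left_mono) linarith+
  then have "p * ?E \<le> S" using le[of t0] by linarith
  then have "?E \<le> S / p" using p by (simp add: field_simps)
  then have "real t0 * (real t0 * c) \<le> (S / p + 2 * pi * A) + real t0 * (4 * pi * B)"
    by (simp add: c_def power2_eq_square algebra_simps)
  also have "\<dots> \<le> real t0 * \<bar>S / p + 2 * pi * A\<bar> + real t0 * \<bar>4 * pi * B\<bar>"
  proof (intro add_mono mult_left_mono)
    have "S / p + 2 * pi * A \<le> 1 * \<bar>S / p + 2 * pi * A\<bar>" by simp
    also have "\<dots> \<le> real t0 * \<bar>S / p + 2 * pi * A\<bar>" using t1 by (intro mult_right_mono) auto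
    finally show "S / p + 2 * pi * A \<le> real t0 * \<bar>S / p + 2 * pi * A\<bar>" .
  qed auto
  also have "\<dots> = real t0 * K" by (simp add: K_def algebra_simps)
  finally have "real t0 * c \<le> K" using t1 by simp
  then show False using t0 by simp
qed

context
  fixes m n :: nat and k :: int and f :: "complex mat \<Rightarrow> complex" and a :: "complex mat \<Rightarrow> complex"
  assumes sq: "squarefree m" and n: "n \<ge> 2" and f: "f \<in> modular_forms m n k"
    and expansion: "\<And>Z. Z \<in> half_space n \<Longrightarrow>
      ((\<lambda>T. a T * ee (mat_trace (T * Z))) has_sum f Z) {T. hermitian_mat n T}"
begin

text \<open>Invariance rewrites \<open>f\<close> as a multiple of
  \<open>f (mat_adjoint U * Z * U)\<close>, and uniqueness compares the two series. Indexing by all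
  Hermitian matrices makes \<open>T\<close> to \<open>V * T * mat_adjoint V\<close> a bijection of
  the index set without reference to the lattice.\<close>

lemma coefficient_conj:
  assumes c: "U \<in> carrier_mat n n" "V \<in> carrier_mat n n" "U * V = 1\<^sub>m n"
    and O: "\<And>i j. i < n \<Longrightarrow> j < n \<Longrightarrow> U $$ (i, j) \<in> ring_ints m"
      "\<And>i j. i < n \<Longrightarrow> j < n \<Longrightarrow> V $$ (i, j) \<in> ring_ints m"
  obtains d where "cmod d = 1" "\<And>T. hermitian_mat n T \<Longrightarrow> a (U * T * mat_adjoint U) = d * a T"
proof -
  let ?H = "{T. hermitian_mat n T}"
  have m0: "m > 0" using sq by (metis not_squarefree_0 gr0I)
  have VU: "V * U = 1\<^sub>m n" using mat_mult_left_right_inverse[OF c] .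
  have Hc: "T \<in> carrier_mat n n" if "hermitian_mat n T" for T using that by (simp add: hermitian_mat_def)
  define d where "d = Determinant.det V powi (- k)"
  have "Determinant.det V * Determinant.det U = 1" using det_mult[OF c(2,1)] VU by simp
  then have "cmod (Determinant.det V) = 1"
    using ring_ints_unit_norm[OF sq] det_in_ring_ints[OF sq c(2) O(2)] det_in_ring_ints[OF sq c(1) O(1)] by blast
  then have d: "cmod d = 1" by (simp add: d_def norm_power_int)
  have fd: "f Z = d * f (mat_adjoint U * Z * U)" if Z: "Z \<in> half_space n" for Z
  proof -
    have "mat_adjoint U * Z \<in> carrier_mat n n" using c half_space_carrier[OF Z] by auto
    moreover have "d * f ((mat_adjoint U * Z + 0\<^sub>m n n) * U) = f Z"
      unfolding d_def using c O
      by (intro modular_form_upper_block[OF f Z _ _ c(2)]) (auto intro!: eq_matI simp: scalar_prod_def)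
    ultimately show ?thesis by simp
  qed
  have bij: "bij_betw (\<lambda>T. V * T * mat_adjoint V) ?H ?H"
  proof (rule bij_betw_byWitness[where f' = "\<lambda>T. U * T * mat_adjoint U"])
    show "\<forall>T\<in>?H. U * (V * T * mat_adjoint V) * mat_adjoint U = T"
      using conj_conj_inverse[OF Hc c] by blast
    show "\<forall>T\<in>?H. V * (U * T * mat_adjoint U) * mat_adjoint V = T"
      using conj_conj_inverse[OF Hc c(2,1) VU] by blast
    show "(\<lambda>T. V * T * mat_adjoint V) ` ?H \<subseteq> ?H" "(\<lambda>T. U * T * mat_adjoint U) ` ?H \<subseteq> ?H"
      using hermitian_conj c by blast+
  qed
  have sum': "((\<lambda>T. a (V * T * mat_adjoint V) * ee (mat_trace (T * Z))) has_sum f (mat_adjoint U * Z * U)) ?H"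
    if Z: "Z \<in> half_space n" for Z
  proof -
    have Zc: "Z \<in> carrier_mat n n" by (rule half_space_carrier[OF Z])
    have "((\<lambda>T. a T * ee (mat_trace (T * (mat_adjoint U * Z * U)))) has_sum f (mat_adjoint U * Z * U)) ?H"
      by (rule expansion) (rule half_space_conj[OF Z c(1,2) VU])
    then have "((\<lambda>T. a (V * T * mat_adjoint V) * ee (mat_trace ((V * T * mat_adjoint V) * (mat_adjoint U * Z * U)))) has_sum f (mat_adjoint U * Z * U)) ?H"
      by (subst has_sum_reindex_bij_betw[OF bij])
    then show ?thesis
    proof (rule has_sum_cong[THEN iffD1, rotated])
      fix T assume "T \<in> ?H"
      then have T: "T \<in> carrier_mat n n" using Hc by simp
      have "V * T * mat_adjoint V \<in> carrier_mat n n" using T c by auto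
      then show "a (V * T * mat_adjoint V) * ee (mat_trace ((V * T * mat_adjoint V) * (mat_adjoint U * Z * U))) =
          a (V * T * mat_adjoint V) * ee (mat_trace (T * Z))"
        using mat_trace_conj[OF _ c(1) Zc] conj_conj_inverse[OF T c] by simp
    qed
  qed
  have "a T = d * a (V * T * mat_adjoint V)" if T: "hermitian_mat n T" for T
  proof -
    have "a T - d * a (V * T * mat_adjoint V) = 0"
    proof (rule hermitian_series_unique[OF m0 _ half_space_carrier[OF scalar_imaginary_half_space], where S = ?H and T = T and
          a = "\<lambda>T. a T - d * a (V * T * mat_adjoint V)"])
      fix x :: "nat \<times> nat \<Rightarrow> real"
      let ?Z = "\<i> \<cdot>\<^sub>m 1\<^sub>m n + zmat m n (\<lambda>p. of_real (x p))"
      have Z: "?Z \<in> half_space n" by (intro half_space_add_hermitian scalar_imaginary_half_space zmat_real_hermitian)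
      have "((\<lambda>T. a T * ee (mat_trace (T * ?Z)) + - (d * (a (V * T * mat_adjoint V) * ee (mat_trace (T * ?Z)))))
          has_sum (f ?Z + - (d * f (mat_adjoint U * ?Z * U)))) ?H"
        by (intro has_sum_add has_sum_uminusI has_sum_cmult_right expansion sum' Z)
      moreover have "f ?Z + - (d * f (mat_adjoint U * ?Z * U)) = 0" unfolding fd[OF Z] by simp
      ultimately show "((\<lambda>T. (a T - d * a (V * T * mat_adjoint V)) * ee (mat_trace (T * ?Z))) has_sum 0) ?H"
        by (simp add: left_diff_distrib mult.assoc)
    qed (use T in auto)
    then show ?thesis by simp
  qed
  then have "a (U * T * mat_adjoint U) = d * a T" if T: "hermitian_mat n T" for T
    using hermitian_conj[OF T c(1)] conj_conj_inverse[OF Hc[OF T] c(2,1) VU] by metis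
  then show ?thesis using that d by blast
qed

text \<open>The Koecher principle: if \<open>v* T v < 0\<close> with \<open>v\<close> integral, choose \<open>x\<close> integral with \<open>v* x = 0\<close>.
  The unipotent matrices \<open>1 + t x v*\<close> preserve the absolute value of the coefficient at \<open>T\<close>, while the
  trace of the transformed index tends to \<open>-\<infinity>\<close> quadratically in \<open>t\<close>.\<close>

lemma koecher:
  assumes T: "hermitian_mat n T" and aT: "a T \<noteq> 0"
  shows "pos_semidef n T"
proof (rule ccontr)
  assume "\<not> pos_semidef n T"
  then obtain v0 where v0: "v0 \<in> carrier_vec n" "Re (hform T v0 v0) < 0"
    using T by (auto simp: pos_semidef_alt not_le)
  have Tc: "T \<in> carrier_mat n n" using T by (simp add: hermitian_mat_def)
  obtain w where w: "\<And>i. i < n \<Longrightarrow> w i \<in> ring_ints m" "Re (hform T (Matrix.vec n w) (Matrix.vec n w)) < 0"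
    using integral_negative_vector[OF sq Tc v0] by blast
  let ?v = "Matrix.vec n w"
  define q where "q = Re (hform T ?v ?v)"
  obtain i0 where i0: "i0 < n" "w i0 \<noteq> 0"
  proof (rule ccontr)
    assume "\<not> thesis"
    then have "w i = 0" if "i < n" for i using that \<open>\<And>i0. i0 < n \<Longrightarrow> w i0 \<noteq> 0 \<Longrightarrow> thesis\<close> by blast
    then have "hform T ?v ?v = 0" by (simp add: hform_sum[OF Tc])
    then show False using w(2) by simp
  qed
  \<comment> \<open>A second position, available since \<open>n \<ge> 2\<close>; two coordinates are
    enough to build a nonzero integral vector \<open>x\<close> orthogonal to
    \<open>w\<close>.\<close>
  define j0 where "j0 = (if i0 = 0 then 1 else 0 :: nat)"
  have j0: "j0 < n" "j0 \<noteq> i0" using n by (auto simp: j0_def)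
  define x where "x t = (if t = i0 then - cnj (w j0) else if t = j0 then cnj (w i0) else 0)" for t
  have xO: "x i \<in> ring_ints m" for i
    using w(1)[OF i0(1)] w(1)[OF j0(1)] sq by (auto simp: x_def)
  have orth: "(\<Sum>r<n. cnj (w r) * x r) = 0"
  proof -
    have "(\<Sum>r<n. cnj (w r) * x r) = (\<Sum>r<n. (if r = i0 then - (cnj (w i0) * cnj (w j0)) else 0) + (if r = j0 then cnj (w j0) * cnj (w i0) else 0))"
      using j0 by (intro sum.cong) (auto simp: x_def)
    then show ?thesis using i0 j0 by (simp add: sum.distrib)
  qed
  define N where "N s = Matrix.mat n n (\<lambda>(i, j). (if i = j then 1 else 0) + s * (x i * cnj (w j)))" for s
  have Nc: "N s \<in> carrier_mat n n" for s by (simp add: N_def)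
  have NN: "N s * N (- s) = 1\<^sub>m n" for s
  proof (rule eq_matI)
    fix i j assume "i < dim_row (1\<^sub>m n :: complex mat)" "j < dim_col (1\<^sub>m n :: complex mat)"
    then have ij: "i < n" "j < n" by auto
    have "(N s * N (- s)) $$ (i, j) = (\<Sum>r<n. N s $$ (i, r) * N (- s) $$ (r, j))"
      by (rule mat_mult_index[OF Nc Nc ij])
    also have "\<dots> = (\<Sum>r<n. (if r = i then (if i = j then 1 else 0) - s * (x i * cnj (w j)) else 0)
        + (if r = j then s * (x i * cnj (w j)) else 0) - s * s * x i * cnj (w j) * (cnj (w r) * x r))"
      using ij by (intro sum.cong) (auto simp: N_def algebra_simps)
    also have "\<dots> = (if i = j then 1 else 0) - s * s * x i * cnj (w j) * (\<Sum>r<n. cnj (w r) * x r)"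
      using ij by (simp add: sum.distrib sum_subtractf sum_distrib_left)
    finally show "(N s * N (- s)) $$ (i, j) = 1\<^sub>m n $$ (i, j)" using ij orth by simp
  qed (use Nc in auto)
  have NO: "N (of_int s) $$ (i, j) \<in> ring_ints m" if "i < n" "j < n" for s :: int and i j
  proof -
    have "x i * cnj (w j) \<in> ring_ints m"
      by (intro ring_ints_mult[OF sq] xO ring_ints_cnj w(1) that)
    then have "of_int s * (x i * cnj (w j)) \<in> ring_ints m"
      by (rule ring_ints_mult[OF sq ring_ints_of_int])
    then show ?thesis using that by (auto simp: N_def intro: ring_ints_add[OF sq])
  qed
  \<comment> \<open>The adjoint of \<open>N t\<close> maps the unit vector at \<open>i\<close> to
    that vector plus \<open>t\<close> times \<open>y i\<close>; this makes each diagonal entry of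
    the transformed index a quadratic polynomial in \<open>t\<close>.\<close>
  define y where "y i = cnj (x i) \<cdot>\<^sub>v ?v" for i
  have yc: "y i \<in> carrier_vec n" for i by (simp add: y_def)
  have diag: "Re ((N (of_real t) * T * mat_adjoint (N (of_real t))) $$ (i, i)) =
      Re (T $$ (i, i)) + 2 * t * Re (hform T (unit_vec n i) (y i)) + t\<^sup>2 * ((cmod (x i))\<^sup>2 * q)"
    if i: "i < n" for t i
  proof -
    have Nt: "mat_adjoint (N (of_real t)) *\<^sub>v unit_vec n i = unit_vec n i + of_real t \<cdot>\<^sub>v y i"
    proof (rule eq_vecI)
      fix r assume "r < dim_vec (unit_vec n i + of_real t \<cdot>\<^sub>v y i)"
      then have r: "r < n" by (simp add: y_def)
      have aN: "mat_adjoint (N (of_real t)) \<in> carrier_mat n n" using Nc by auto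
      have "(mat_adjoint (N (of_real t)) *\<^sub>v unit_vec n i) $ r = (\<Sum>l<n. mat_adjoint (N (of_real t)) $$ (r, l) * unit_vec n i $ l)"
        using r aN carrier_matD[OF Nc[of "of_real t"]] by (simp add: scalar_prod_def lessThan_atLeast0)
      also have "\<dots> = (\<Sum>l<n. if l = i then mat_adjoint (N (of_real t)) $$ (r, i) else 0)"
        using i by (intro sum.cong) auto
      also have "\<dots> = cnj (N (of_real t) $$ (i, r))" using i r Nc[of "of_real t"] by simp
      finally show "(mat_adjoint (N (of_real t)) *\<^sub>v unit_vec n i) $ r = (unit_vec n i + of_real t \<cdot>\<^sub>v y i) $ r"
        using i r by (auto simp: N_def y_def)
    qed (use Nc[of "of_real t"] in \<open>simp add: y_def\<close>)
    have "Re ((N (of_real t) * T * mat_adjoint (N (of_real t))) $$ (i, i)) =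
        Re (hform T (unit_vec n i + of_real t \<cdot>\<^sub>v y i) (unit_vec n i + of_real t \<cdot>\<^sub>v y i))"
      using hform_unit[of "N (of_real t) * T * mat_adjoint (N (of_real t))" n i] i Nc[of "of_real t"] Tc
        hform_conj[OF Tc Nc[of "of_real t"] unit_vec_carrier unit_vec_carrier, of i i]
      by (simp add: Nt mult_carrier_mat[of _ n n _ n])
    also have "\<dots> = Re (T $$ (i, i)) + 2 * t * Re (hform T (unit_vec n i) (y i)) + t\<^sup>2 * Re (hform T (y i) (y i))"
      using hform_expand[OF T unit_vec_carrier yc] hform_unit[OF Tc i] by simp
    also have "hform T (y i) (y i) = of_real ((cmod (x i))\<^sup>2) * hform T ?v ?v"
      unfolding y_def using Tc by (simp add: hform_smult_left[of _ n] hform_smult_right[of _ n] complex_norm_square mult_ac del: of_real_power)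
    finally show ?thesis by (simp add: q_def del: of_real_power)
  qed
  define A B C where "A = (\<Sum>i<n. Re (T $$ (i, i)))" and "B = (\<Sum>i<n. Re (hform T (unit_vec n i) (y i)))"
    and "C = (\<Sum>i<n. (cmod (x i))\<^sup>2 * q)"
  have "C < 0"
  proof -
    have "x j0 \<noteq> 0" using i0 j0 by (simp add: x_def)
    then have "(\<Sum>i<n. (cmod (x i))\<^sup>2) > 0" using j0 by (intro sum_pos2[of _ j0]) auto
    moreover have "q < 0" using w(2) by (simp add: q_def)
    ultimately show ?thesis by (simp add: C_def mult_pos_neg flip: sum_distrib_right)
  qed
  let ?H = "{T. hermitian_mat n T}" and ?I = "\<i> \<cdot>\<^sub>m 1\<^sub>m n :: complex mat"
  have "(\<lambda>T. a T * ee (mat_trace (T * ?I))) summable_on ?H"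
    using expansion[OF scalar_imaginary_half_space] by (rule has_sum_imp_summable)
  then have summ: "(\<lambda>T. norm (a T * ee (mat_trace (T * ?I)))) summable_on ?H"
    by (rule summable_on_iff_abs_summable_on_complex[THEN iffD1])
  \<comment> \<open>The absolute sum at \<open>\<i>\<close> times the identity bounds each single
    term, in particular those at all transforms of \<open>T\<close>.\<close>
  define S where "S = (\<Sum>\<^sub>\<infinity>T\<in>?H. norm (a T * ee (mat_trace (T * ?I))))"
  have "cmod (a T) * exp (- 2 * pi * (A + 2 * real t * B + (real t)\<^sup>2 * C)) \<le> S" for t :: nat
  proof -
    let ?N = "N (of_real (real t))"
    define T' where "T' = ?N * T * mat_adjoint ?N"
    have T': "hermitian_mat n T'" "T' \<in> carrier_mat n n"
      using hermitian_conj[OF T Nc] unfolding T'_def by (auto simp: hermitian_mat_def)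
    obtain d where d: "cmod d = 1" "a T' = d * a T"
    proof -
      have O: "?N $$ (i, j) \<in> ring_ints m" "N (- of_real (real t)) $$ (i, j) \<in> ring_ints m" if "i < n" "j < n" for i j
        using NO[OF that, of "int t"] NO[OF that, of "- int t"] by simp_all
      show ?thesis
        using coefficient_conj[OF Nc Nc NN O] T that unfolding T'_def by metis
    qed
    have "mat_trace (T' * ?I) = \<i> * mat_trace T'"
      using T'(2) by (simp add: mat_trace_smult[of _ n])
    then have "norm (a T' * ee (mat_trace (T' * ?I))) = cmod (a T) * exp (- 2 * pi * Re (mat_trace T'))"
      by (simp add: norm_mult norm_ee d)
    moreover have "Re (mat_trace T') = A + 2 * real t * B + (real t)\<^sup>2 * C"
    proof -
      have "Re (mat_trace T') = (\<Sum>i<n. Re (T' $$ (i, i)))" using T'(2) by (simp add: mat_trace_def)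
      also have "\<dots> = (\<Sum>i<n. Re (T $$ (i, i)) + 2 * real t * Re (hform T (unit_vec n i) (y i)) + (real t)\<^sup>2 * ((cmod (x i))\<^sup>2 * q))"
        unfolding T'_def by (intro sum.cong refl diag) simp
      finally show ?thesis by (simp add: A_def B_def C_def sum.distrib sum_distrib_left)
    qed
    moreover have "norm (a T' * ee (mat_trace (T' * ?I))) \<le> S"
    proof -
      have "sum (\<lambda>T. norm (a T * ee (mat_trace (T * ?I)))) {T'} \<le> S"
        unfolding S_def using T' by (intro finite_sum_le_infsum summ) auto
      then show ?thesis by simp
    qed
    ultimately show ?thesis by simp
  qed
  then show False using quadratic_exp_unbounded[OF \<open>C < 0\<close>, of "cmod (a T)" A B S] aT by simp
qed

end

section \<open>The Siegel operator\<close>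

definition block_arg :: "nat \<Rightarrow> complex mat \<Rightarrow> real \<Rightarrow> complex mat" where
  "block_arg p Z1 y = four_block_mat Z1 (0\<^sub>m p 1) (0\<^sub>m 1 p) (Matrix.mat 1 1 (\<lambda>_. \<i> * of_real y))"

definition top_block :: "nat \<Rightarrow> complex mat \<Rightarrow> complex mat" where
  "top_block p T = Matrix.mat p p (\<lambda>(i, j). T $$ (i, j))"

lemma top_block_carrier [simp, intro]: "top_block p T \<in> carrier_mat p p"
  by (simp add: top_block_def)

lemma block_arg_index:
  assumes Z1: "Z1 \<in> carrier_mat p p" and ij: "i < Suc p" "j < Suc p"
  shows "block_arg p Z1 y $$ (i, j) =
    (if i < p \<and> j < p then Z1 $$ (i, j) else if i = p \<and> j = p then \<i> * of_real y else 0)"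
  using carrier_matD[OF Z1] ij by (auto simp: block_arg_def)

lemma block_arg_carrier: "Z1 \<in> carrier_mat p p \<Longrightarrow> block_arg p Z1 y \<in> carrier_mat (Suc p) (Suc p)"
  by (auto simp: block_arg_def intro!: carrier_matI)

lemma sum_sum_block:
  fixes g :: "nat \<Rightarrow> nat \<Rightarrow> complex"
  assumes "\<And>i. i < p \<Longrightarrow> g i p = 0" "\<And>j. j < p \<Longrightarrow> g p j = 0"
  shows "(\<Sum>i<Suc p. \<Sum>j<Suc p. g i j) = (\<Sum>i<p. \<Sum>j<p. g i j) + g p p"
  using assms by (simp add: sum.distrib)

lemma mat_trace_block_arg:
  assumes T: "T \<in> carrier_mat (Suc p) (Suc p)" and Z1: "Z1 \<in> carrier_mat p p"
  shows "mat_trace (T * block_arg p Z1 y) = mat_trace (top_block p T * Z1) + T $$ (p, p) * (\<i> * of_real y)"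
proof -
  note I = block_arg_index[OF Z1]
  have "mat_trace (T * block_arg p Z1 y) = (\<Sum>i<Suc p. \<Sum>j<Suc p. T $$ (i, j) * block_arg p Z1 y $$ (j, i))"
    by (rule mat_trace_mult[OF T block_arg_carrier[OF Z1]])
  also have "\<dots> = (\<Sum>i<p. \<Sum>j<p. T $$ (i, j) * block_arg p Z1 y $$ (j, i)) + T $$ (p, p) * block_arg p Z1 y $$ (p, p)"
    by (rule sum_sum_block) (simp_all add: I)
  also have "(\<Sum>i<p. \<Sum>j<p. T $$ (i, j) * block_arg p Z1 y $$ (j, i)) = mat_trace (top_block p T * Z1)"
    by (subst mat_trace_mult[OF top_block_carrier Z1]) (auto simp: I top_block_def intro!: sum.cong)
  finally show ?thesis by (simp add: I)
qed

lemma block_arg_half_space: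
  assumes Z1: "Z1 \<in> half_space p" and y: "y > 0"
  shows "block_arg p Z1 y \<in> half_space (Suc p)"
proof -
  have Z1c: "Z1 \<in> carrier_mat p p" by (rule half_space_carrier[OF Z1])
  note I = block_arg_index[OF Z1c]
  have Bc: "block_arg p Z1 y \<in> carrier_mat (Suc p) (Suc p)" by (rule block_arg_carrier[OF Z1c])
  let ?Y1 = "(1 / (2 * \<i>)) \<cdot>\<^sub>m (Z1 - mat_adjoint Z1)"
  let ?Y = "(1 / (2 * \<i>)) \<cdot>\<^sub>m (block_arg p Z1 y - mat_adjoint (block_arg p Z1 y))"
  have Y1: "pos_def p ?Y1" using Z1 by (simp add: half_space_def)
  have Y1c: "?Y1 \<in> carrier_mat p p" and Yc: "?Y \<in> carrier_mat (Suc p) (Suc p)" using Z1c Bc by auto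
  have Yi: "?Y $$ (i, j) = (if i < p \<and> j < p then ?Y1 $$ (i, j) else if i = p \<and> j = p then of_real y else 0)"
    if ij: "i < Suc p" "j < Suc p" for i j
    using ij carrier_matD[OF Z1c] carrier_matD[OF Bc] by (auto simp: I complex_eq_iff)
  have "hermitian_mat (Suc p) ?Y"
    unfolding hermitian_mat_def
  proof (intro conjI Yc)
    show "mat_adjoint ?Y = ?Y"
    proof (rule eq_matI)
      fix i j assume "i < dim_row ?Y" "j < dim_col ?Y"
      then have ij: "i < Suc p" "j < Suc p" using carrier_matD[OF Bc] by auto
      have "mat_adjoint ?Y $$ (i, j) = cnj (?Y $$ (j, i))"
        using ij carrier_matD[OF Yc] by (intro mat_adjoint_index) auto
      also have "\<dots> = ?Y $$ (i, j)"
        unfolding Yi[OF ij] Yi[OF ij(2,1)] using hermitian_index[of p ?Y1 j i] Y1 by (auto simp: pos_def_def)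
      finally show "mat_adjoint ?Y $$ (i, j) = ?Y $$ (i, j)" .
    qed (use carrier_matD[OF Yc] in auto)
  qed
  moreover have "Re (hform ?Y v v) > 0" if v: "v \<in> carrier_vec (Suc p)" "v \<noteq> 0\<^sub>v (Suc p)" for v
  proof -
    define v1 where "v1 = Matrix.vec p (\<lambda>i. v $ i)"
    have v1: "v1 \<in> carrier_vec p" by (simp add: v1_def)
    have "hform ?Y v v = (\<Sum>i<Suc p. \<Sum>j<Suc p. ?Y $$ (i, j) * v $ j * cnj (v $ i))"
      by (rule hform_sum[OF Yc v(1) v(1)])
    also have "\<dots> = (\<Sum>i<p. \<Sum>j<p. ?Y $$ (i, j) * v $ j * cnj (v $ i)) + ?Y $$ (p, p) * v $ p * cnj (v $ p)"
    proof (rule sum_sum_block)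
      fix i assume i: "i < p"
      have "?Y $$ (i, p) = 0" "?Y $$ (p, i) = 0" using Yi[of i p] Yi[of p i] i by simp_all
      then show "?Y $$ (i, p) * v $ p * cnj (v $ i) = 0" "?Y $$ (p, i) * v $ i * cnj (v $ p) = 0"
        by (simp_all only: mult_zero_left)
    qed
    also have "(\<Sum>i<p. \<Sum>j<p. ?Y $$ (i, j) * v $ j * cnj (v $ i)) = hform ?Y1 v1 v1"
      unfolding hform_sum[OF Y1c v1 v1] by (intro sum.cong refl) (simp only: Yi less_SucI lessThan_iff, simp add: v1_def)
    also have "?Y $$ (p, p) * v $ p * cnj (v $ p) = of_real (y * (cmod (v $ p))\<^sup>2)"
      unfolding Yi[OF lessI lessI] by (simp add: complex_norm_square mult.assoc del: of_real_power)
    finally have *: "Re (hform ?Y v v) = Re (hform ?Y1 v1 v1) + y * (cmod (v $ p))\<^sup>2" by simp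
    have "Re (hform ?Y1 v1 v1) > 0" if "v1 \<noteq> 0\<^sub>v p"
      using Y1 v1 that by (auto simp: pos_def_alt)
    moreover have "Re (hform ?Y1 v1 v1) \<ge> 0"
      using pos_def_imp_semidef[OF Y1] v1 by (auto simp: pos_semidef_alt)
    moreover have "v1 \<noteq> 0\<^sub>v p \<or> v $ p \<noteq> 0"
    proof (rule ccontr)
      assume "\<not> ?thesis"
      then have z: "v1 = 0\<^sub>v p" "v $ p = 0" by auto
      have "v $ i = 0" if "i < p" for i using arg_cong[OF z(1), of "\<lambda>w. vec_index w i"] that by (simp add: v1_def)
      then have "v = 0\<^sub>v (Suc p)" using z v by (intro eq_vecI) (auto simp: less_Suc_eq)
      then show False using v by simp
    qed
    moreover have "y * (cmod (v $ p))\<^sup>2 > 0" if "v $ p \<noteq> 0" using y that by simp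
    moreover have "y * (cmod (v $ p))\<^sup>2 \<ge> 0" using y by simp
    ultimately show ?thesis unfolding * by (smt (verit))
  qed
  ultimately have "pos_def (Suc p) ?Y" by (simp add: pos_def_alt)
  then show ?thesis using Bc by (simp add: half_space_def)
qed

text \<open>Moving \<open>U\<close> from the argument to the index turns the series into one in
  \<open>exp (- y)\<close> whose exponents are \<open>2 * pi\<close> times the corner entries of the
  transformed indices, nonnegative by semidefiniteness. \<open>tendsto_exp_series\<close> applies
  from height 1 on.\<close>

lemma siegel_limit:
  fixes b :: "complex mat \<Rightarrow> complex"
  assumes S: "\<And>T. T \<in> S \<Longrightarrow> pos_semidef (Suc p) T"
    and sum: "\<And>Z. Z \<in> half_space (Suc p) \<Longrightarrow> ((\<lambda>T. b T * ee (mat_trace (T * Z))) has_sum f Z) S"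
    and U: "U \<in> carrier_mat (Suc p) (Suc p)" "V \<in> carrier_mat (Suc p) (Suc p)" "V * U = 1\<^sub>m (Suc p)"
    and Z1: "Z1 \<in> half_space p"
  defines "S0 \<equiv> {T \<in> S. (U * T * mat_adjoint U) $$ (p, p) = 0}"
    and "g \<equiv> \<lambda>T. b T * ee (mat_trace (top_block p (U * T * mat_adjoint U) * Z1))"
  shows "((\<lambda>y. f (mat_adjoint U * block_arg p Z1 y * U)) \<longlongrightarrow> infsum g S0) at_top" "g summable_on S0"
proof -
  have Z1c: "Z1 \<in> carrier_mat p p" by (rule half_space_carrier[OF Z1])
  let ?T' = "\<lambda>T. U * T * mat_adjoint U"
  have T': "pos_semidef (Suc p) (?T' T)" if "T \<in> S" for T by (rule pos_semidef_conj[OF S[OF that] U(1)])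
  have Tc: "T \<in> carrier_mat (Suc p) (Suc p)" if "T \<in> S" for T
    using S[OF that] by (auto simp: pos_semidef_def hermitian_mat_def)
  have T'c: "?T' T \<in> carrier_mat (Suc p) (Suc p)" if "T \<in> S" for T
    using T'[OF that] by (auto simp: pos_semidef_def hermitian_mat_def)
  define l where "l T = 2 * pi * Re (?T' T $$ (p, p))" for T
  have real: "?T' T $$ (p, p) = of_real (Re (?T' T $$ (p, p)))" if "T \<in> S" for T
    using hermitian_index[of "Suc p" "?T' T" p p] T'[OF that] by (auto simp: pos_semidef_def complex_eq_iff)
  have l: "l T \<ge> 0" if "T \<in> S" for T
  proof -
    have "Re (hform (?T' T) (unit_vec (Suc p) p) (unit_vec (Suc p) p)) \<ge> 0"
      using T'[OF that] unfolding pos_semidef_alt by simp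
    then show ?thesis using hform_unit[OF T'c[OF that], of p] by (simp add: l_def)
  qed
  have has: "((\<lambda>T. g T * exp (- of_real (l T * y))) has_sum f (mat_adjoint U * block_arg p Z1 y * U)) S"
    if y: "y \<ge> 1" for y
  proof -
    have B: "block_arg p Z1 y \<in> half_space (Suc p)" using y by (intro block_arg_half_space[OF Z1]) simp
    have "((\<lambda>T. b T * ee (mat_trace (T * (mat_adjoint U * block_arg p Z1 y * U)))) has_sum
        f (mat_adjoint U * block_arg p Z1 y * U)) S"
      by (rule sum) (rule half_space_conj[OF B U])
    then show ?thesis
    proof (rule has_sum_cong[THEN iffD1, rotated])
      fix T assume T: "T \<in> S"
      have "mat_trace (T * (mat_adjoint U * block_arg p Z1 y * U)) =
          mat_trace (top_block p (?T' T) * Z1) + ?T' T $$ (p, p) * (\<i> * of_real y)"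
        unfolding mat_trace_conj[OF Tc[OF T] U(1) half_space_carrier[OF B]]
        by (rule mat_trace_block_arg[OF T'c[OF T] Z1c])
      moreover have "ee (?T' T $$ (p, p) * (\<i> * of_real y)) = exp (- of_real (l T * y))"
      proof -
        have "ee (of_real r * (\<i> * of_real y)) = exp (- of_real (2 * pi * r * y))" for r
          by (simp add: ee_def algebra_simps)
        then show ?thesis unfolding l_def by (subst real[OF T]) simp
      qed
      ultimately show "b T * ee (mat_trace (T * (mat_adjoint U * block_arg p Z1 y * U))) = g T * exp (- of_real (l T * y))"
        by (simp add: g_def ee_add)
    qed
  qed
  have S0: "S0 = {T \<in> S. l T = 0}"
    unfolding S0_def l_def by (rule Collect_cong) (use real in \<open>auto simp: complex_eq_iff\<close>)
  have "(\<lambda>T. norm (g T * exp (- of_real (l T * 1)))) summable_on S"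
    using has_sum_imp_summable[OF has[of 1]] by (intro summable_on_iff_abs_summable_on_complex[THEN iffD1]) simp
  note * = tendsto_exp_series[OF this l has]
  show "((\<lambda>y. f (mat_adjoint U * block_arg p Z1 y * U)) \<longlongrightarrow> infsum g S0) at_top" "g summable_on S0"
    using * unfolding S0 by blast+
qed

text \<open>For the limit 0 the automorphy factor, a nonzero constant here, can be
  cancelled.\<close>

lemma has_siegel_phi_R_mat:
  assumes U: "U \<in> carrier_mat (Suc p) (Suc p)" "V \<in> carrier_mat (Suc p) (Suc p)" "U * V = 1\<^sub>m (Suc p)"
    and Z1: "Z1 \<in> carrier_mat p p"
  shows "has_siegel_phi (Suc p) (slash (Suc p) k (R_mat (Suc p) U) f) Z1 0 \<longleftrightarrow>
    ((\<lambda>y. f (mat_adjoint U * block_arg p Z1 y * U)) \<longlongrightarrow> 0) at_top"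
proof -
  let ?n = "Suc p"
  have VU: "V * U = 1\<^sub>m ?n" using mat_mult_left_right_inverse[OF U] .
  have iU: "mat_inv U = V" by (rule mat_inv_eqI[OF U])
  have iV: "mat_inv V = U" by (rule mat_inv_eqI[OF U(2,1) VU])
  have aU: "mat_adjoint U \<in> carrier_mat ?n ?n" using U by auto
  define c where "c = Determinant.det V powi (- k)"
  have "Determinant.det V * Determinant.det U = 1" using det_mult[OF U(2,1)] VU by simp
  then have c: "c \<noteq> 0" by (auto simp: c_def)
  have "slash ?n k (R_mat ?n U) f (block_arg p Z1 y) = c * f (mat_adjoint U * block_arg p Z1 y * U)" for y
  proof -
    have B: "block_arg p Z1 y \<in> carrier_mat ?n ?n" by (rule block_arg_carrier[OF Z1])
    have "0\<^sub>m ?n ?n * block_arg p Z1 y + V = V" using B U by simp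
    moreover have "mat_adjoint U * block_arg p Z1 y + 0\<^sub>m ?n ?n = mat_adjoint U * block_arg p Z1 y"
      using aU B by simp
    ultimately show ?thesis
      unfolding R_mat_def iU slash_four_block[OF aU zero_carrier_mat zero_carrier_mat U(2)] by (simp add: c_def iV)
  qed
  then have "has_siegel_phi ?n (slash ?n k (R_mat ?n U) f) Z1 0 \<longleftrightarrow>
      ((\<lambda>y. c * f (mat_adjoint U * block_arg p Z1 y * U)) \<longlongrightarrow> c * 0) at_top"
    unfolding has_siegel_phi_def block_arg_def[symmetric] by (simp add: block_arg_def[symmetric])
  also have "\<dots> \<longleftrightarrow> ((\<lambda>y. f (mat_adjoint U * block_arg p Z1 y * U)) \<longlongrightarrow> 0) at_top"
    by (rule tendsto_mult_left_iff[OF c])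
  finally show ?thesis .
qed

lemma U_mat_inverse:
  assumes "n \<ge> 2" shows "U_mat n x \<in> carrier_mat n n" "U_mat n x * U_mat n (- x) = 1\<^sub>m n"
  using assms by (auto simp: U_mat_eq_pmat intro!: pmat_inverse[of "n - 2" n "n - 1" 1 1 0 x, simplified])

text \<open>The adjoint of the matrix sends the last unit vector to \<open>w\<close>; conjugating
  the entry turns \<open>cnj u\<close> back into \<open>u\<close>. For semidefinite \<open>T\<close>
  a vanishing corner thus means that \<open>w\<close> is a null vector of \<open>T\<close>.\<close>

lemma U_mat_corner:
  fixes u :: complex
  assumes n: "Suc p \<ge> 2" and T: "T \<in> carrier_mat (Suc p) (Suc p)"
  defines "w \<equiv> Matrix.vec (Suc p) (\<lambda>i. if i = Suc p - 2 then u else if i = Suc p - 1 then 1 else 0)"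
  shows "(U_mat (Suc p) (cnj u) * T * mat_adjoint (U_mat (Suc p) (cnj u))) $$ (p, p) = hform T w w"
proof -
  let ?U = "U_mat (Suc p) (cnj u)"
  have Uc: "?U \<in> carrier_mat (Suc p) (Suc p)" by (rule U_mat_inverse[OF n])
  have "mat_adjoint ?U *\<^sub>v unit_vec (Suc p) p = w"
  proof (rule eq_vecI)
    fix r assume "r < dim_vec w"
    then have r: "r < Suc p" by (simp add: w_def)
    have "(mat_adjoint ?U *\<^sub>v unit_vec (Suc p) p) $ r = (\<Sum>l<Suc p. mat_adjoint ?U $$ (r, l) * unit_vec (Suc p) p $ l)"
      using r carrier_matD[OF Uc] by (simp add: scalar_prod_def lessThan_atLeast0 del: sum.lessThan_Suc sum.op_ivl_Suc)
    also have "\<dots> = (\<Sum>l<Suc p. if l = p then mat_adjoint ?U $$ (r, p) else 0)"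
      by (intro sum.cong) auto
    also have "\<dots> = cnj (?U $$ (p, r))" using r carrier_matD[OF Uc] by simp
    also have "\<dots> = w $ r" using r n by (auto simp: U_mat_def w_def)
    finally show "(mat_adjoint ?U *\<^sub>v unit_vec (Suc p) p) $ r = w $ r" .
  qed (use carrier_matD[OF Uc] in \<open>simp add: w_def\<close>)
  moreover have "?U * T * mat_adjoint ?U \<in> carrier_mat (Suc p) (Suc p)" using Uc T by auto
  ultimately show ?thesis
    using hform_unit[of "?U * T * mat_adjoint ?U" "Suc p" p]
      hform_conj[OF T Uc unit_vec_carrier unit_vec_carrier, of p p] by simp
qed

text \<open>Conjugation preserves definiteness and a definite matrix has a positive corner entry, so
  the limit series contains no nonzero coefficient, whatever \<open>x\<close> is.\<close>

lemma cusp_form_imp_siegel_phi_zero: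
  assumes n: "Suc p \<ge> 2" and cusp: "cusp_form m (Suc p) k f" and Z1: "Z1 \<in> half_space p"
  shows "has_siegel_phi (Suc p) (slash (Suc p) k (R_mat (Suc p) (U_mat (Suc p) x)) f) Z1 0"
proof -
  let ?n = "Suc p" and ?U = "U_mat (Suc p) x" and ?V = "U_mat (Suc p) (- x)"
  have U: "?U \<in> carrier_mat ?n ?n" "?V \<in> carrier_mat ?n ?n" "?U * ?V = 1\<^sub>m ?n" "?V * ?U = 1\<^sub>m ?n"
    using U_mat_inverse[OF n, of x] U_mat_inverse[OF n, of "- x"] by simp_all
  obtain \<alpha> where \<alpha>: "has_fourier_expansion m ?n f \<alpha>" "\<And>T. T \<in> fourier_index m ?n \<Longrightarrow> \<alpha> T \<noteq> 0 \<Longrightarrow> pos_def ?n T"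
    using cusp by (auto simp: cusp_form_def)
  let ?S0 = "{T \<in> fourier_index m ?n. (?U * T * mat_adjoint ?U) $$ (p, p) = 0}"
  let ?g = "\<lambda>T. \<alpha> T * ee (mat_trace (top_block p (?U * T * mat_adjoint ?U) * Z1))"
  have "((\<lambda>y. f (mat_adjoint ?U * block_arg p Z1 y * ?U)) \<longlongrightarrow> infsum ?g ?S0) at_top"
  proof (rule siegel_limit(1)[OF _ _ U(1,2,4) Z1])
    show "((\<lambda>T. \<alpha> T * ee (mat_trace (T * Z))) has_sum f Z) (fourier_index m ?n)" if "Z \<in> half_space ?n" for Z
      using \<alpha>(1) that by (simp add: has_fourier_expansion_def ee_def)
  qed (simp add: fourier_index_def)
  moreover have "infsum ?g ?S0 = 0"
  proof (rule infsum_0)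
    fix T assume T: "T \<in> ?S0"
    have "\<alpha> T = 0"
    proof (rule ccontr)
      assume "\<alpha> T \<noteq> 0"
      then have pd: "pos_def ?n (?U * T * mat_adjoint ?U)" using T \<alpha>(2) by (intro pos_def_conj[OF _ U(1-3)]) auto
      then have "?U * T * mat_adjoint ?U \<in> carrier_mat ?n ?n" by (auto simp: pos_def_def hermitian_mat_def)
      from hform_unit[OF this, of p] have "hform (?U * T * mat_adjoint ?U) (unit_vec ?n p) (unit_vec ?n p) = 0" using T by simp
      moreover have "unit_vec ?n p \<noteq> (0\<^sub>v ?n :: complex Matrix.vec)"
        by (metis index_unit_vec(1) index_zero_vec(1) lessI zero_neq_one)
      ultimately show False using pd unfolding pos_def_alt by (metis less_irrefl unit_vec_carrier zero_complex.sel(1))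
    qed
    then show "?g T = 0" by simp
  qed
  ultimately show ?thesis
    using has_siegel_phi_R_mat[OF U(1-3) half_space_carrier[OF Z1]] by simp
qed

text \<open>The last unit vector is a null vector, so the last column vanishes. Such a matrix is
  determined by its top block.\<close>

lemma pos_semidef_corner_zero:
  assumes T: "pos_semidef (Suc p) T" and 0: "T $$ (p, p) = 0" and i: "i < Suc p"
  shows "T $$ (i, p) = 0" "T $$ (p, i) = 0"
proof -
  have Tc: "T \<in> carrier_mat (Suc p) (Suc p)" "hermitian_mat (Suc p) T" using T by (auto simp: pos_semidef_def hermitian_mat_def)
  have "T *\<^sub>v unit_vec (Suc p) p = 0\<^sub>v (Suc p)"
    using hform_unit[OF Tc(1), of p] 0 by (intro pos_semidef_null_vector[OF T]) auto
  moreover have "(T *\<^sub>v unit_vec (Suc p) p) $ i = T $$ (i, p)" using i carrier_matD[OF Tc(1)] by simp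
  ultimately show 1: "T $$ (i, p) = 0" using i by simp
  show "T $$ (p, i) = 0" using hermitian_index[OF Tc(2) i, of p] 1 by simp
qed

text \<open>The limit is itself a series of exponentials in \<open>Z1\<close>, to which uniqueness applies.\<close>

lemma siegel_phi_zero_imp_coefficient_zero:
  assumes n: "Suc p \<ge> 2"
    and S: "\<And>T. T \<in> S \<Longrightarrow> pos_semidef (Suc p) T"
    and sum: "\<And>Z. Z \<in> half_space (Suc p) \<Longrightarrow> ((\<lambda>T. b T * ee (mat_trace (T * Z))) has_sum f Z) S"
    and phi: "\<And>Z1. Z1 \<in> half_space p \<Longrightarrow>
      has_siegel_phi (Suc p) (slash (Suc p) k (R_mat (Suc p) (U_mat (Suc p) (cnj u))) f) Z1 0"
    and T: "T \<in> S"
      "T *\<^sub>v Matrix.vec (Suc p) (\<lambda>i. if i = Suc p - 2 then u else if i = Suc p - 1 then 1 else 0) = 0\<^sub>v (Suc p)"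
  shows "b T = 0"
proof -
  let ?n = "Suc p" and ?U = "U_mat (Suc p) (cnj u)" and ?V = "U_mat (Suc p) (- cnj u)"
  let ?T' = "\<lambda>T. ?U * T * mat_adjoint ?U"
  have U: "?U \<in> carrier_mat ?n ?n" "?V \<in> carrier_mat ?n ?n" "?U * ?V = 1\<^sub>m ?n" "?V * ?U = 1\<^sub>m ?n"
    using U_mat_inverse[OF n, of "cnj u"] U_mat_inverse[OF n, of "- cnj u"] by simp_all
  have Tc: "T \<in> carrier_mat ?n ?n" if "T \<in> S" for T using S[OF that] by (auto simp: pos_semidef_def hermitian_mat_def)
  have T'S: "pos_semidef ?n (?T' T)" if "T \<in> S" for T by (rule pos_semidef_conj[OF S[OF that] U(1)])
  define S0 where "S0 = {T \<in> S. ?T' T $$ (p, p) = 0}"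
  define t where "t T = top_block p (?T' T)" for T
  \<comment> \<open>No two indices merge when only the top block is kept, so every coefficient
    survives separately in the limit series.\<close>
  have inj: "inj_on t S0"
  proof (rule inj_onI)
    fix A B assume AB: "A \<in> S0" "B \<in> S0" "t A = t B"
    have S: "A \<in> S" "B \<in> S" and 0: "?T' A $$ (p, p) = 0" "?T' B $$ (p, p) = 0" using AB by (auto simp: S0_def)
    have c: "?T' A \<in> carrier_mat ?n ?n" "?T' B \<in> carrier_mat ?n ?n"
      using T'S S by (auto simp: pos_semidef_def hermitian_mat_def)
    have "?T' A = ?T' B"
    proof (rule eq_matI)
      fix i j assume "i < dim_row (?T' B)" "j < dim_col (?T' B)"
      then have ij: "i < ?n" "j < ?n" using carrier_matD[OF c(2)] by auto
      show "?T' A $$ (i, j) = ?T' B $$ (i, j)"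
      proof (cases "i < p \<and> j < p")
        case True
        then show ?thesis using arg_cong[OF AB(3), of "\<lambda>M. M $$ (i, j)"] unfolding t_def top_block_def by simp
      next
        case False
        then have "i = p \<or> j = p" using ij by auto
        then show ?thesis
          using pos_semidef_corner_zero[OF T'S[OF S(1)] 0(1)] pos_semidef_corner_zero[OF T'S[OF S(2)] 0(2)] ij by auto
      qed
    qed (use carrier_matD[OF c(1)] carrier_matD[OF c(2)] in auto)
    then show "A = B"
      using conj_conj_inverse[OF Tc[OF S(1)] U(2,1,4)] conj_conj_inverse[OF Tc[OF S(2)] U(2,1,4)] by metis
  qed
  have zero: "((\<lambda>T. b T * ee (mat_trace (t T * Z1))) has_sum 0) S0" if Z1: "Z1 \<in> half_space p" for Z1
  proof -
    have "((\<lambda>y. f (mat_adjoint ?U * block_arg p Z1 y * ?U)) \<longlongrightarrow> 0) at_top"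
      using phi[OF Z1] has_siegel_phi_R_mat[OF U(1-3) half_space_carrier[OF Z1]] by blast
    moreover have "((\<lambda>y. f (mat_adjoint ?U * block_arg p Z1 y * ?U)) \<longlongrightarrow> infsum (\<lambda>T. b T * ee (mat_trace (t T * Z1))) S0) at_top"
      and summ: "(\<lambda>T. b T * ee (mat_trace (t T * Z1))) summable_on S0"
      unfolding S0_def t_def by (rule siegel_limit[OF S sum U(1,2,4) Z1]; assumption)+
    ultimately have "infsum (\<lambda>T. b T * ee (mat_trace (t T * Z1))) S0 = 0"
      by (intro tendsto_unique[OF trivial_limit_at_top_linorder])
    then show ?thesis using has_sum_infsum[OF summ] by simp
  qed
  define b' where "b' = b \<circ> the_inv_into S0 t"
  have b': "b' (t T) = b T" if "T \<in> S0" for T using the_inv_into_f_f[OF inj that] by (simp add: b'_def)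
  have "(?T' T) $$ (p, p) = 0"
    unfolding U_mat_corner[OF n Tc[OF T(1)]] hform_def T(2) by simp
  then have TS0: "T \<in> S0" using T by (simp add: S0_def)
  \<comment> \<open>In \<open>hermitian_series_unique\<close> the field serves only to give
    coordinates on Hermitian matrices; here the one with parameter 1 is chosen.\<close>
  have one_pos: "(0::nat) < 1" by simp
  have "b' (t T) = 0"
  proof (rule hermitian_series_unique[OF one_pos _ half_space_carrier[OF scalar_imaginary_half_space[of p]],
        where S = "t ` S0" and a = b' and T = "t T"])
    fix A assume "A \<in> t ` S0"
    then obtain B where B: "A = t B" "B \<in> S" by (auto simp: S0_def)
    have h: "hermitian_mat ?n (?T' B)" using T'S[OF B(2)] by (simp add: pos_semidef_def)
    have "mat_adjoint (top_block p (?T' B)) = top_block p (?T' B)"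
      using hermitian_index[OF h] by (intro eq_matI) (auto simp: top_block_def)
    then show "hermitian_mat p A" unfolding B(1) t_def hermitian_mat_def by simp
  next
    fix x :: "nat \<times> nat \<Rightarrow> real"
    let ?Z = "\<i> \<cdot>\<^sub>m 1\<^sub>m p + zmat 1 p (\<lambda>q. of_real (x q))"
    have "?Z \<in> half_space p" by (intro half_space_add_hermitian scalar_imaginary_half_space zmat_real_hermitian)
    from zero[OF this] have "(((\<lambda>A. b' A * ee (mat_trace (A * ?Z))) \<circ> t) has_sum 0) S0"
      by (rule has_sum_cong[THEN iffD1, rotated]) (simp add: b')
    then show "((\<lambda>A. b' A * ee (mat_trace (A * ?Z))) has_sum 0) (t ` S0)"
      unfolding has_sum_reindex[OF inj] .
  qed (use TS0 in simp)
  then show ?thesis using b'[OF TS0] by simp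
qed

theorem theorem3:
  fixes m n h :: nat and k :: int
    and u :: "nat \<Rightarrow> complex" and f :: "complex mat \<Rightarrow> complex"
  assumes "squarefree m" and "n \<ge> 2"
    and "h = class_number m"
    and "\<forall>j\<in>{1..h}. u j \<in> quad_field m"
    and "bij_betw (\<lambda>j. ideal_class m (ideal_gen1 m (u j))) {1..h} (ideal_classes m)"
    and "f \<in> modular_forms m n k"
  shows "cusp_form m n k f \<longleftrightarrow>
    (\<forall>j\<in>{1..h}. \<forall>Z1\<in>half_space (n - 1).
       has_siegel_phi n (slash n k (R_mat n (U_mat n (cnj (u j)))) f) Z1 0)"
proof -
  note sq = assms(1) and n = assms(2) and f = assms(6)
  have m0: "m > 0" using sq by (metis not_squarefree_0 gr0I)
  define p where "p = n - 1"
  have np: "n = Suc p" using n by (simp add: p_def)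
  have np2: "Suc p \<ge> 2" using n np by simp
  show ?thesis
  proof
    assume "cusp_form m n k f"
    then show "\<forall>j\<in>{1..h}. \<forall>Z1\<in>half_space (n - 1).
       has_siegel_phi n (slash n k (R_mat n (U_mat n (cnj (u j)))) f) Z1 0"
      using cusp_form_imp_siegel_phi_zero[OF np2] unfolding np by simp
  next
    assume phi: "\<forall>j\<in>{1..h}. \<forall>Z1\<in>half_space (n - 1).
       has_siegel_phi n (slash n k (R_mat n (U_mat n (cnj (u j)))) f) Z1 0"
    obtain \<alpha> where \<alpha>: "\<And>Z. Z \<in> half_space n \<Longrightarrow>
        ((\<lambda>T. \<alpha> T * ee (mat_trace (T * Z))) has_sum f Z) (herm_lattice m n)"
      using hermitian_lattice_expansion[OF sq f] scalar_imaginary_half_space by blast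
    \<comment> \<open>Extension by zero from the lattice to all Hermitian matrices, the form in
      which \<open>coefficient_conj\<close> and \<open>koecher\<close> take the expansion.\<close>
    define a where "a T = (if T \<in> herm_lattice m n then \<alpha> T else 0)" for T
    have exp: "((\<lambda>T. a T * ee (mat_trace (T * Z))) has_sum f Z) {T. hermitian_mat n T}" if Z: "Z \<in> half_space n" for Z
      using \<alpha>[OF Z] by (rule has_sum_cong_neutral[THEN iffD1, rotated -1]) (auto simp: a_def herm_lattice_def)
    note coefficient_conj' = coefficient_conj[OF sq n f exp]
    have psd: "pos_semidef n T" if "hermitian_mat n T" "a T \<noteq> 0" for T
      by (rule koecher[OF sq n f exp that])
    have expF: "((\<lambda>T. a T * ee (mat_trace (T * Z))) has_sum f Z) (fourier_index m n)" if Z: "Z \<in> half_space n" for Z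
      using exp[OF Z]
    proof (rule has_sum_cong_neutral[THEN iffD1, rotated -1])
      fix T assume "T \<in> {T. hermitian_mat n T} - fourier_index m n"
      then have "a T = 0"
        using psd[of T] by (cases "a T = 0") (auto simp: fourier_index_eq a_def split: if_splits)
      then show "a T * ee (mat_trace (T * Z)) = 0" by simp
    qed (auto simp: fourier_index_eq herm_lattice_def)
    \<comment> \<open>The property to be carried along orbits: every index annihilating
      \<open>w\<close> has coefficient zero.\<close>
    define P where "P w \<longleftrightarrow> (\<forall>T. hermitian_mat n T \<longrightarrow> T *\<^sub>v Matrix.vec n w = 0\<^sub>v n \<longrightarrow> a T = 0)" for w
    have Hc: "T \<in> carrier_mat n n" if "hermitian_mat n T" for T using that by (simp add: hermitian_mat_def)
    have P: "P w" if w: "\<And>i. i < n \<Longrightarrow> w i \<in> quad_field m" "\<exists>i<n. w i \<noteq> 0" for w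
    proof (rule vector_orbit_induct[OF sq n, where P = P and A = "{1..h}" and u = u])
      fix w w' :: "nat \<Rightarrow> complex" assume "\<And>i. i < n \<Longrightarrow> w i = w' i"
      then have "Matrix.vec n w = Matrix.vec n w'" by (intro eq_vecI) auto
      then show "P w \<Longrightarrow> P w'" by (simp add: P_def)
    next
      fix w :: "nat \<Rightarrow> complex" and i j a' b' c' d'
      assume ij: "i < n" "j < n" "i \<noteq> j" and O: "a' \<in> ring_ints m" "b' \<in> ring_ints m" "c' \<in> ring_ints m" "d' \<in> ring_ints m"
        and det: "a' * d' - b' * c' = 1"
        and Pw: "P (\<lambda>r. if r = i then a' * w i + b' * w j else if r = j then c' * w i + d' * w j else w r)"
      let ?W = "pmat n i j a' b' c' d'" and ?X = "pmat n i j d' (- b') (- c') a'"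
      have WX: "?W * ?X = 1\<^sub>m n" by (rule pmat_inverse[OF ij det])
      have XW: "?X * ?W = 1\<^sub>m n" by (rule mat_mult_left_right_inverse[OF pmat_carrier pmat_carrier WX])
      have aXW: "mat_adjoint ?X * mat_adjoint ?W = 1\<^sub>m n"
        using mat_adjoint_mult[of ?W n n ?X n] WX by simp
      have ent: "mat_adjoint ?X $$ (r, s) \<in> ring_ints m" "mat_adjoint ?W $$ (r, s) \<in> ring_ints m"
        if rs: "r < n" "s < n" for r s
      proof -
        have "- cnj b' \<in> ring_ints m" "- cnj c' \<in> ring_ints m" using O sq by auto
        then show "mat_adjoint ?X $$ (r, s) \<in> ring_ints m" "mat_adjoint ?W $$ (r, s) \<in> ring_ints m"
          using rs O ij by (auto simp: pmat_def)
      qed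
      show "P w"
        unfolding P_def
      proof (intro allI impI)
        fix T assume T: "hermitian_mat n T" "T *\<^sub>v Matrix.vec n w = 0\<^sub>v n"
        \<comment> \<open>If \<open>T\<close> annihilates \<open>w\<close>, then this index
          annihilates the moved vector \<open>?W *\<^sub>v w\<close>, because \<open>?X\<close>
          inverts \<open>?W\<close>; its coefficient has the same absolute value as that of
          \<open>T\<close>.\<close>
        let ?T = "mat_adjoint ?X * T * ?X"
        have "\<exists>d. cmod d = 1 \<and> (\<forall>T. hermitian_mat n T \<longrightarrow> a (mat_adjoint ?X * T * mat_adjoint (mat_adjoint ?X)) = d * a T)"
          by (rule coefficient_conj'[OF _ mat_adjoint_carrier[OF pmat_carrier] mat_adjoint_carrier[OF pmat_carrier] aXW ent])
             (assumption | blast)+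
        then obtain d where d: "cmod d = 1" "\<And>T. hermitian_mat n T \<Longrightarrow> a (mat_adjoint ?X * T * mat_adjoint (mat_adjoint ?X)) = d * a T"
          by blast
        have hT: "hermitian_mat n ?T" using hermitian_conj[OF T(1), of "mat_adjoint ?X"] by simp
        let ?v = "Matrix.vec n w"
        have "?T *\<^sub>v (?W *\<^sub>v ?v) = (mat_adjoint ?X * T) *\<^sub>v (?X *\<^sub>v (?W *\<^sub>v ?v))"
          using Hc[OF T(1)] mult_mat_vec_carrier[of ?W n n ?v] by (intro assoc_mult_mat_vec[of _ n n _ n]) auto
        also have "?X *\<^sub>v (?W *\<^sub>v ?v) = (?X * ?W) *\<^sub>v ?v"
          by (rule assoc_mult_mat_vec[symmetric, of _ n n _ n]) auto
        also have "\<dots> = ?v" unfolding XW by simp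
        also have "(mat_adjoint ?X * T) *\<^sub>v ?v = mat_adjoint ?X *\<^sub>v (T *\<^sub>v ?v)"
          using Hc[OF T(1)] by (intro assoc_mult_mat_vec[of _ n n _ n]) auto
        also have "\<dots> = 0\<^sub>v n" unfolding T(2) by (intro eq_vecI) (auto simp: scalar_prod_def)
        finally have "a ?T = 0"
          using Pw hT unfolding P_def pmat_mult_vec[OF ij(1,2)] by blast
        then show "a T = 0" using d(2)[OF T(1)] d(1) by auto
      qed
    next
      fix w :: "nat \<Rightarrow> complex" and \<kappa> :: complex assume \<kappa>: "\<kappa> \<noteq> 0"
      have "T *\<^sub>v Matrix.vec n (\<lambda>r. \<kappa> * w r) = 0\<^sub>v n \<longleftrightarrow> T *\<^sub>v Matrix.vec n w = 0\<^sub>v n" if T: "hermitian_mat n T" for T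
      proof -
        have "Matrix.vec n (\<lambda>r. \<kappa> * w r) = \<kappa> \<cdot>\<^sub>v Matrix.vec n w" by (intro eq_vecI) auto
        then have "T *\<^sub>v Matrix.vec n (\<lambda>r. \<kappa> * w r) = \<kappa> \<cdot>\<^sub>v (T *\<^sub>v Matrix.vec n w)"
          using Hc[OF T] by (simp add: mult_mat_vec[of _ n n])
        then show ?thesis using \<kappa> Hc[OF T] by (auto simp: vec_eq_iff)
      qed
      then show "P (\<lambda>r. \<kappa> * w r) \<longleftrightarrow> P w" by (simp add: P_def)
    next
      fix j assume j: "j \<in> {1..h}"
      show "P (\<lambda>i. if i = n - 2 then u j else if i = n - 1 then 1 else 0)"
        unfolding P_def
      proof (intro allI impI)
        fix T assume T: "hermitian_mat n T" "T *\<^sub>v Matrix.vec n (\<lambda>i. if i = n - 2 then u j else if i = n - 1 then 1 else 0) = 0\<^sub>v n"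
        show "a T = 0"
        proof (rule ccontr)
          assume aT: "a T \<noteq> 0"
          then have "T \<in> fourier_index m (Suc p)"
            using psd[OF T(1)] by (auto simp: fourier_index_eq a_def np split: if_splits)
          then have "a T = 0"
          proof (rule siegel_phi_zero_imp_coefficient_zero[OF np2, rotated -2])
            show "T *\<^sub>v Matrix.vec (Suc p) (\<lambda>i. if i = Suc p - 2 then u j else if i = Suc p - 1 then 1 else 0) = 0\<^sub>v (Suc p)"
              using T(2) by (simp only: np)
            show "((\<lambda>T. a T * ee (mat_trace (T * Z))) has_sum f Z) (fourier_index m (Suc p))" if "Z \<in> half_space (Suc p)" for Z
              using expF that by (simp only: np)
            show "has_siegel_phi (Suc p) (slash (Suc p) k (R_mat (Suc p) (U_mat (Suc p) (cnj (u j)))) f) Z1 0"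
              if "Z1 \<in> half_space p" for Z1
              using phi j that unfolding np by simp
          qed (simp add: fourier_index_def)
          then show False using aT by simp
        qed
      qed
    next
      fix C assume "C \<in> ideal_classes m"
      then show "\<exists>j\<in>{1..h}. C = ideal_class m (ideal_gen1 m (u j))"
        using assms(5) unfolding bij_betw_def by blast
    qed (use w in auto)
    have "pos_def n T" if T: "T \<in> fourier_index m n" and aT: "a T \<noteq> 0" for T
    proof (rule ccontr)
      assume npd: "\<not> pos_def n T"
      have TL: "T \<in> herm_lattice m n" and Tp: "pos_semidef n T" using T by (auto simp: fourier_index_eq)
      have Th: "hermitian_mat n T" using Tp by (simp add: pos_semidef_def)
      obtain v where v: "v \<in> carrier_vec n" "v \<noteq> 0\<^sub>v n" "\<not> Re (hform T v v) > 0"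
        using npd Th by (auto simp: pos_def_alt)
      then have "Re (hform T v v) = 0" using Tp by (auto simp: pos_semidef_alt intro: antisym)
      from pos_semidef_null_vector[OF Tp v(1) this]
      obtain w where "\<And>i. i < n \<Longrightarrow> w i \<in> quad_field m" "\<exists>i<n. w i \<noteq> 0" "T *\<^sub>v Matrix.vec n w = 0\<^sub>v n"
        using rational_null_vector[OF m0 TL v(1,2)] by metis
      then show False using P[of w] Th aT by (auto simp: P_def)
    qed
    moreover have "has_fourier_expansion m n f a"
      unfolding has_fourier_expansion_def using expF by (simp add: ee_def)
    ultimately show "cusp_form m n k f" using f by (auto simp: cusp_form_def)
  qed
qed

end
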